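(* Let $m\ge1$ and $1\le i\le 2m-1$, and let $$H^m=\Bigl(\bigl(H^{m-1}\oplus\bar H^m\oplus\bar H^m\oplus H^m_1\bigr)\otimes\mathcal V\{1\}\Bigr)\oplus H^m_2\otimes\mathcal V\{1\}\otimes\mathcal V\{1\}\qquad(\ast)$$ be the decomposition of Khovanov's arc ring, as a graded abelian group, described in the context. Then: 1. $Kh(\cup_{i;m}\cap_{i;m})=\Bigl(\bigl(H^{m-1}\oplus\bar H^m\oplus\bar H^m\oplus H^m_1\bigr)\otimes\mathcal V\{1\}\otimes\mathcal V\Bigr)\oplus H^m_2\otimes\mathcal V\{2\}$. 2. On the first four direct summands of $(\ast)$, the map $\alpha:\mathcal F(a^t\,id_m\,b)\to\mathcal F(a^t\cup_{i;m}\cap_{i;m}b)$ is given by the comultiplication $\Delta:\mathcal V\{1\}\to\mathcal V\{1\}\otimes\mathcal V$ tensored with the identity map. On the last summand it is given by the multiplication $m:\mathcal V\{1\}\otimes\mathcal V\{1\}\to\mathcal V\{2\}$ tensored with the identity. 3. On the first four direct summands, the map $\beta:\mathcal F(a^t\cup_{i;m}\cap_{i;m}b)\to\mathcal F(a^t\,id_m\,b)$ is given by the multiplication $m:\mathcal V\otimes\mathcal V\to\mathcal V$ tensored with the identity map. On the last one it is given by the comultiplication $\Delta$ tensored with the identity. 4. As graded abelian groups, $$\overline{Kh}(\sigma_i^+)=\bigl(H^{m-1}\oplus\bar H^m\oplus\bar H^m\oplus H^m_1\bigr)\otimes\mathcal V\{-1\}\ \oplus\ H^m_2\otimes\mathcal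 V\{2\},$$ $$\overline{Kh}(\sigma_i^-)=\bigl(H^{m-1}\oplus\bar H^m\oplus\bar H^m\oplus H^m_1\bigr)\otimes\mathcal V\{3\}\ \oplus\ H^m_2\otimes\mathcal V\{2\}.$$
   Context: **Frobenius algebra.** $\mathcal V$ is the free abelian group on $\mathbf 1$ (degree $-1$) and $\mathbf X$ (degree $1$), with unit $\mathbf 1$, $\mathbf X^2=0$, $\Delta(\mathbf 1)=\mathbf 1\otimes\mathbf X+\mathbf X\otimes\mathbf 1$, $\Delta(\mathbf X)=\mathbf X\otimes\mathbf X$, $\epsilon(\mathbf X)=1$, $\epsilon(\mathbf 1)=0$. $\mathcal F$ is the corresponding $(1+1)$-dimensional TQFT. $\{k\}$ raises the internal degree by $k$. **Tangles.** Tangles are composed left to right. $\mathcal C_m$ is the set of isotopy classes of crossingless matchings of $2m$ points on the real line by arcs in the upper half plane, viewed as tangles from $2m$ points to no points; $a^t$ is the mirror image, so $a^tb$ is a union of circles. $id_m$ is the identity tangle on $2m$ strands. $\cup_{i;m}\cap_{i;m}$ is the flat tangle from $2m$ points to $2m$ points which joins the points $i,i+1$ by an arc on each side and is the identity on the remaining strands. For a flat tangle $T$ from $2m$ to $2n$ points, $Kh(T)=\bigoplus_{a\in\mathcal C_m,b\in\mathcal C_n}\mathcal F(a^tTb)\{n\}$. $H^m=Kh(id_m)$ as a graded abelian group. **Decomposition $(\ast)$.** Let $\mathcal C_m'\subset\mathcal C_m$ be the matchings containing an arc joining points $i$ and $i+1$, and $\mathcal C_m''$ its complement. $\mathcal C_m'$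 is in bijection with $\mathcal C_{m-1}$ by deleting this arc. Let $\mathcal P\subset\mathcal C_m''\times\mathcal C_m''$ be the set of $(a,b)$ for which the points $i$ and $i+1$ lie on a single circle of $a^tb$; for other pairs in $\mathcal C_m''\times\mathcal C_m''$ they lie on two different circles. For $(a,b)$ let $\mathcal F'(a^tb)$ be $\mathcal F$ of the circles of $a^tb$ not passing through $i$ or $i+1$. - The pairs in $\mathcal C_m'\times\mathcal C_m'$ contribute $H^{m-1}\otimes\mathcal V\{1\}$. - Set $\bar H^m=\bigoplus_{a\in\mathcal C_m',b\in\mathcal C_m''}\mathcal F'(a^tb)\{m-1\}$ (and the same for $\mathcal C_m''\times\mathcal C_m'$, giving the second copy). - Set $H^m_1=\bigoplus_{(a,b)\in\mathcal P}\mathcal F'(a^tb)\{m-1\}$. - Set $H^m_2=\bigoplus_{(a,b)\in(\mathcal C_m''\times\mathcal C_m'')\setminus\mathcal P}\mathcal F'(a^tb)\{m-2\}$. The factors $\mathcal V\{1\}$ correspond to the circle(s) through $i,i+1$. **Maps and complexes.** $\alpha:Kh(id_m)\to Kh(\cup_{i;m}\cap_{i;m})\{-1\}$ and $\beta:Kh(\cup_{i;m}\cap_{i;m})\to Kh(id_m)\{-1\}$ are the direct sums over $a,b\in\mathcal C_m$ of the maps induced under $\mathcal F$ by the saddle cobordism between $id_m$ and $\cup_{i;m}\cap_{i;m}$, in the respective directions. $C^+$ is the two-term complex $Kh(id_m)\xrightarrow{\alpha}Kh(\cup_{i;m}\cap_{i;m})\{-1\}$ and $C^-$ is $Kh(\cup_{i;m}\cap_{i;m})\xrightarrow{\beta}Kh(id_m)\{-1\}$,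 with the domains in homological degree $0$. For the elementary positive and negative crossings $\sigma_i^\pm$ on the strands $i,i+1$, $Kh(\sigma_i^+)=C^+\{-1\}$ and $Kh(\sigma_i^-)=C^-[1]\{2\}$, where $[1]$ lowers the homological degree by one. $\overline{Kh}$ is the cohomology of $Kh$ graded by the sum of the homological and the internal degree. *)

theory Defs
  imports "HOL-Algebra.Free_Abelian_Groups" "HOL-Library.Disjoint_Sets"
begin

section \<open>Free graded abelian groups\<close>

text \<open>
  All chain groups below are free abelian groups with a preferred basis of homogeneous elements.
  Such a group is recorded by its basis and the degrees of the basis elements; the underlying
  abelian group and its homogeneous pieces are the library's free abelian groups on (parts of) this
  basis. Linear maps are functions on \<open>'x \<Rightarrow>\<^sub>0 int\<close>, mostly obtained from their values on the basis by
  \<^const>\<open>frag_extend\<close>. Cohomology is not assumed to be free: it is formed below as a quotient of groups.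
\<close>

record 'x graded =
  gbasis :: "'x set"
  gdeg :: "'x \<Rightarrow> int"

definition grp :: "'x graded \<Rightarrow> ('x \<Rightarrow>\<^sub>0 int) monoid" where
  "grp A = free_Abelian_group (gbasis A)"

definition piece :: "'x graded \<Rightarrow> int \<Rightarrow> ('x \<Rightarrow>\<^sub>0 int) monoid" where
  "piece A d = free_Abelian_group {x \<in> gbasis A. gdeg A x = d}"

definition gr_iso :: "'x graded \<Rightarrow> 'y graded \<Rightarrow> (('x \<Rightarrow>\<^sub>0 int) \<Rightarrow> ('y \<Rightarrow>\<^sub>0 int)) \<Rightarrow> bool" where
  "gr_iso A B f \<longleftrightarrow>
     f \<in> iso (grp A) (grp B) \<and> (\<forall>d. f ` carrier (piece A d) = carrier (piece B d))"

definition gshift :: "'x graded \<Rightarrow> int \<Rightarrow> 'x graded"  ("(_\<lbrace>_\<rbrace>)" [1000, 0] 1000) where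
  "A\<lbrace>k\<rbrace> = \<lparr>gbasis = gbasis A, gdeg = (\<lambda>x. gdeg A x + k)\<rparr>"

definition gzero :: "'x graded" where
  "gzero = \<lparr>gbasis = {}, gdeg = (\<lambda>_. 0)\<rparr>"

definition gplus :: "'x graded \<Rightarrow> 'y graded \<Rightarrow> ('x + 'y) graded"  (infixr "\<oplus>\<^sub>g" 65) where
  "A \<oplus>\<^sub>g B = \<lparr>gbasis = gbasis A <+> gbasis B, gdeg = case_sum (gdeg A) (gdeg B)\<rparr>"

definition gtensor :: "'x graded \<Rightarrow> 'y graded \<Rightarrow> ('x \<times> 'y) graded"  (infixr "\<otimes>\<^sub>g" 70) where
  "A \<otimes>\<^sub>g B = \<lparr>gbasis = gbasis A \<times> gbasis B, gdeg = (\<lambda>(x, y). gdeg A x + gdeg B y)\<rparr>"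

definition gsum :: "'i set \<Rightarrow> ('i \<Rightarrow> 'x graded) \<Rightarrow> ('i \<times> 'x) graded" where
  "gsum I A = \<lparr>gbasis = Sigma I (\<lambda>i. gbasis (A i)), gdeg = (\<lambda>(i, x). gdeg (A i) x)\<rparr>"

definition tensor_elt :: "('x \<Rightarrow>\<^sub>0 int) \<Rightarrow> ('y \<Rightarrow>\<^sub>0 int) \<Rightarrow> ('x \<times> 'y \<Rightarrow>\<^sub>0 int)" where
  "tensor_elt u v = frag_extend (\<lambda>x. frag_extend (\<lambda>y. frag_of (x, y)) v) u"

definition tensor_map ::
  "(('x \<Rightarrow>\<^sub>0 int) \<Rightarrow> ('x' \<Rightarrow>\<^sub>0 int)) \<Rightarrow> (('y \<Rightarrow>\<^sub>0 int) \<Rightarrow> ('y' \<Rightarrow>\<^sub>0 int))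
     \<Rightarrow> ('x \<times> 'y \<Rightarrow>\<^sub>0 int) \<Rightarrow> ('x' \<times> 'y' \<Rightarrow>\<^sub>0 int)" where
  "tensor_map f g = frag_extend (\<lambda>(x, y). tensor_elt (f (frag_of x)) (g (frag_of y)))"

definition plus_map ::
  "(('x \<Rightarrow>\<^sub>0 int) \<Rightarrow> ('x' \<Rightarrow>\<^sub>0 int)) \<Rightarrow> (('y \<Rightarrow>\<^sub>0 int) \<Rightarrow> ('y' \<Rightarrow>\<^sub>0 int))
     \<Rightarrow> ('x + 'y \<Rightarrow>\<^sub>0 int) \<Rightarrow> ('x' + 'y' \<Rightarrow>\<^sub>0 int)" where
  "plus_map f g = frag_extend (case_sum
     (\<lambda>x. frag_extend (\<lambda>x'. frag_of (Inl x')) (f (frag_of x)))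
     (\<lambda>y. frag_extend (\<lambda>y'. frag_of (Inr y')) (g (frag_of y))))"

definition gsum_map ::
  "('i \<Rightarrow> ('x \<Rightarrow>\<^sub>0 int) \<Rightarrow> ('y \<Rightarrow>\<^sub>0 int)) \<Rightarrow> ('i \<times> 'x \<Rightarrow>\<^sub>0 int) \<Rightarrow> ('i \<times> 'y \<Rightarrow>\<^sub>0 int)" where
  "gsum_map f = frag_extend (\<lambda>(i, x). frag_extend (\<lambda>y. frag_of (i, y)) (f i (frag_of x)))"

section \<open>The Frobenius algebra\<close>

datatype vgen = V1 | VX

definition V :: "vgen graded" where
  "V = \<lparr>gbasis = UNIV, gdeg = case_vgen (- 1) 1\<rparr>"

definition v_mult :: "(vgen \<times> vgen \<Rightarrow>\<^sub>0 int) \<Rightarrow> (vgen \<Rightarrow>\<^sub>0 int)" where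
  "v_mult = frag_extend (\<lambda>(x, y).
     case x of V1 \<Rightarrow> frag_of y | VX \<Rightarrow> (case y of V1 \<Rightarrow> frag_of VX | VX \<Rightarrow> 0))"

definition v_comult :: "(vgen \<Rightarrow>\<^sub>0 int) \<Rightarrow> (vgen \<times> vgen \<Rightarrow>\<^sub>0 int)" where
  "v_comult = frag_extend (\<lambda>x.
     case x of V1 \<Rightarrow> frag_of (V1, VX) + frag_of (VX, V1) | VX \<Rightarrow> frag_of (VX, VX))"

section \<open>Crossingless matchings, flat tangles and circles\<close>

text \<open>
  An isotopy class of crossingless matchings of the points \<open>1, \<dots>, 2m\<close> is determined by the set of
  pairs of points that are joined by an arc.
\<close>

definition CM :: "nat \<Rightarrow> nat set set set" where
  "CM m = {a. partition_on {1..2 * m} a \<and> (\<forall>e\<in>a. card e = 2) \<and>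
     \<not> (\<exists>p q r s. p < q \<and> q < r \<and> r < s \<and> {p, r} \<in> a \<and> {q, s} \<in> a)}"

text \<open>
  A flat tangle without closed components is given by the pairs of end points that are joined by
  an arc: \<open>Inl k\<close> is the \<open>k\<close>-th point on the left, \<open>Inr k\<close> the \<open>k\<close>-th point on the right.
\<close>

type_synonym flat_tangle = "(nat + nat) set set"

definition id_tangle :: "nat \<Rightarrow> flat_tangle" where
  "id_tangle m = {{Inl k, Inr k} | k. k \<in> {1..2 * m}}"

definition cupcap :: "nat \<Rightarrow> nat \<Rightarrow> flat_tangle" where
  "cupcap m i = {{Inl i, Inl (i + 1)}, {Inr i, Inr (i + 1)}} \<union>
     {{Inl k, Inr k} | k. k \<in> {1..2 * m} - {i, i + 1}}"

text \<open>The arcs of the closed diagram \<open>a\<^sup>t T b\<close>: \<open>a\<^sup>t\<close> closes up the left points, \<open>b\<close> the right ones.\<close>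

definition closure_arcs :: "nat set set \<Rightarrow> flat_tangle \<Rightarrow> nat set set \<Rightarrow> (nat + nat) set set" where
  "closure_arcs a T b = image Inl ` a \<union> T \<union> image Inr ` b"

text \<open>
  A circle of a closed diagram is represented by the set of end points it passes through, i.e. by a
  connected component of the graph formed by the arcs. If two end points are joined by two
  arcs (as by \<open>a\<close> and by \<open>T\<close>), these two arcs form a circle, although the set of arcs
  contains the pair only once; components are not affected by this.
\<close>

definition circ :: "'p set set \<Rightarrow> 'p \<Rightarrow> 'p set" where
  "circ E p = {(x, y). {x, y} \<in> E}\<^sup>* `` {p}"

definition circles :: "'p set set \<Rightarrow> 'p set set" where
  "circles E = circ E ` \<Union>E"

section \<open>The TQFT\<close>

text \<open>
  \<open>TF S\<close> is the tensor product of copies of \<open>V\<close> indexed by the set \<open>S\<close> of circles: its basis consists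
  of the labellings of the circles by the generators of \<open>V\<close>. In particular \<open>TF {}\<close> is
  the group of integers in degree 0.
\<close>

definition TF :: "'c set \<Rightarrow> ('c \<Rightarrow> vgen) graded" where
  "TF S = \<lparr>gbasis = S \<rightarrow>\<^sub>E UNIV, gdeg = (\<lambda>l. \<Sum>C\<in>S. gdeg V (l C))\<rparr>"

text \<open>
  The map induced by a saddle cobordism from the closed diagram \<open>E\<close> to the closed diagram \<open>E'\<close>. The
  saddle replaces two arcs \<open>pq\<close>, \<open>rs\<close> by \<open>pr\<close>, \<open>qs\<close>; so the circles of either diagram that take part
  in it are those through \<open>p\<close> and through \<open>s\<close>. The other circles are multiplied by
  cylinders and keep their labels. The remaining component of the cobordism is a pair of pants, which
  merges two circles or splits one, and induces \<^const>\<open>v_mult\<close> or \<^const>\<open>v_comult\<close> (the order of the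
  two circles is irrelevant by commutativity and cocommutativity).
  The last alternative would be a nonorientable saddle.
\<close>

definition TF_saddle ::
  "'p set set \<Rightarrow> 'p set set \<Rightarrow> 'p \<Rightarrow> 'p \<Rightarrow> (('p set \<Rightarrow> vgen) \<Rightarrow>\<^sub>0 int) \<Rightarrow> (('p set \<Rightarrow> vgen) \<Rightarrow>\<^sub>0 int)" where
  "TF_saddle E E' p s = frag_extend (\<lambda>l.
     let l0 = restrict l (circles E - {circ E p, circ E s}) in
     if circ E p \<noteq> circ E s \<and> circ E' p = circ E' s then
       frag_extend (\<lambda>v. frag_of (l0(circ E' p := v)))
         (v_mult (frag_of (l (circ E p), l (circ E s))))
     else if circ E p = circ E s \<and> circ E' p \<noteq> circ E' s then
       frag_extend (\<lambda>(v, w). frag_of (l0(circ E' p := v, circ E' s := w)))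
         (v_comult (frag_of (l (circ E p))))
     else 0)"

section \<open>Khovanov groups of flat tangles and the saddle maps\<close>

type_synonym label = "(nat + nat) set \<Rightarrow> vgen"
type_synonym kh_gen = "(nat set set \<times> nat set set) \<times> label"

definition Kh_flat :: "nat \<Rightarrow> nat \<Rightarrow> flat_tangle \<Rightarrow> kh_gen graded" where
  "Kh_flat m n T =
     gsum (CM m \<times> CM n) (\<lambda>(a, b). (TF (circles (closure_arcs a T b)))\<lbrace>int n\<rbrace>)"

definition arcH :: "nat \<Rightarrow> kh_gen graded" where
  "arcH m = Kh_flat m m (id_tangle m)"

definition Kh_cupcap :: "nat \<Rightarrow> nat \<Rightarrow> kh_gen graded" where
  "Kh_cupcap m i = Kh_flat m m (cupcap m i)"

definition alpha :: "nat \<Rightarrow> nat \<Rightarrow> (kh_gen \<Rightarrow>\<^sub>0 int) \<Rightarrow> (kh_gen \<Rightarrow>\<^sub>0 int)" where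
  "alpha m i = gsum_map (\<lambda>(a, b).
     TF_saddle (closure_arcs a (id_tangle m) b) (closure_arcs a (cupcap m i) b)
       (Inl i) (Inr (i + 1)))"

definition beta :: "nat \<Rightarrow> nat \<Rightarrow> (kh_gen \<Rightarrow>\<^sub>0 int) \<Rightarrow> (kh_gen \<Rightarrow>\<^sub>0 int)" where
  "beta m i = gsum_map (\<lambda>(a, b).
     TF_saddle (closure_arcs a (cupcap m i) b) (closure_arcs a (id_tangle m) b)
       (Inl i) (Inr (i + 1)))"

section \<open>The decomposition of the arc ring\<close>

definition CM' :: "nat \<Rightarrow> nat \<Rightarrow> nat set set set" where
  "CM' m i = {a \<in> CM m. {i, i + 1} \<in> a}"

definition CM'' :: "nat \<Rightarrow> nat \<Rightarrow> nat set set set" where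
  "CM'' m i = CM m - CM' m i"

text \<open>
  \<open>skip i\<close> is the increasing bijection from the numbering of the points after removal of
  \<open>i\<close>, \<open>i + 1\<close> to the original numbering.
\<close>

definition skip :: "nat \<Rightarrow> nat \<Rightarrow> nat" where
  "skip i k = (if k < i then k else k + 2)"

definition delete_arc :: "nat \<Rightarrow> nat set set \<Rightarrow> nat set set" where
  "delete_arc i a = {e. skip i ` e \<in> a}"

definition id_closure :: "nat \<Rightarrow> nat set set \<Rightarrow> nat set set \<Rightarrow> (nat + nat) set set" where
  "id_closure m a b = closure_arcs a (id_tangle m) b"

definition single_circle :: "nat \<Rightarrow> nat \<Rightarrow> (nat set set \<times> nat set set) set" where
  "single_circle m i = {(a, b) \<in> CM'' m i \<times> CM'' m i.
     circ (id_closure m a b) (Inl i) = circ (id_closure m a b) (Inl (i + 1))}"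

text \<open>
  The circles of \<open>a\<^sup>t b\<close> not passing through \<open>i\<close> or \<open>i + 1\<close>. As sets of end points, they are
  also the circles of \<open>a\<^sup>t T b\<close> away from these points when \<open>T\<close> is \<open>cupcap m i\<close>.
\<close>

definition far_circles :: "nat \<Rightarrow> nat \<Rightarrow> nat set set \<Rightarrow> nat set set \<Rightarrow> (nat + nat) set set" where
  "far_circles m i a b =
     {C \<in> circles (id_closure m a b). C \<inter> {Inl i, Inl (i + 1), Inr i, Inr (i + 1)} = {}}"

definition TF' :: "nat \<Rightarrow> nat \<Rightarrow> nat set set \<times> nat set set \<Rightarrow> label graded" where
  "TF' m i = (\<lambda>(a, b). TF (far_circles m i a b))"

definition arcHbar :: "nat \<Rightarrow> nat \<Rightarrow> kh_gen graded" where
  "arcHbar m i = gsum (CM' m i \<times> CM'' m i) (\<lambda>ab. (TF' m i ab)\<lbrace>int m - 1\<rbrace>)"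

definition arcH1 :: "nat \<Rightarrow> nat \<Rightarrow> kh_gen graded" where
  "arcH1 m i = gsum (single_circle m i) (\<lambda>ab. (TF' m i ab)\<lbrace>int m - 1\<rbrace>)"

definition arcH2 :: "nat \<Rightarrow> nat \<Rightarrow> kh_gen graded" where
  "arcH2 m i = gsum (CM'' m i \<times> CM'' m i - single_circle m i) (\<lambda>ab. (TF' m i ab)\<lbrace>int m - 2\<rbrace>)"

type_synonym kh_gen4 = "kh_gen + kh_gen + kh_gen + kh_gen"

text \<open>
  The position of a pair \<open>(a, b)\<close> and of the labels of the circles away from \<open>i\<close>, \<open>i + 1\<close> in
  \<open>arcH (m - 1) \<oplus>\<^sub>g arcHbar m i \<oplus>\<^sub>g arcHbar m i \<oplus>\<^sub>g arcH1 m i\<close>. For \<open>a, b\<close> in \<open>CM' m i\<close> the labels are transported along the renumbering of the points. The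
  pairs in \<open>CM'' m i \<times> CM' m i\<close> give the second copy of \<open>arcHbar m i\<close> by reflection: \<open>a\<^sup>t b\<close>
  and \<open>b\<^sup>t a\<close> have the same circles, as sets of end points.
\<close>

definition first_four_part :: "nat \<Rightarrow> nat \<Rightarrow> nat set set \<Rightarrow> nat set set \<Rightarrow> label \<Rightarrow> kh_gen4" where
  "first_four_part m i a b l =
     (let l0 = restrict l (far_circles m i a b);
          a0 = delete_arc i a; b0 = delete_arc i b
      in if a \<in> CM' m i \<and> b \<in> CM' m i then
           Inl ((a0, b0), \<lambda>C\<in>circles (id_closure (m - 1) a0 b0). l (map_sum (skip i) (skip i) ` C))
         else if a \<in> CM' m i then Inr (Inl ((a, b), l0))
         else if b \<in> CM' m i then Inr (Inr (Inl ((b, a), l0)))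
         else Inr (Inr (Inr ((a, b), l0))))"

definition H2_part :: "nat \<Rightarrow> nat \<Rightarrow> nat set set \<Rightarrow> nat set set \<Rightarrow> label \<Rightarrow> kh_gen" where
  "H2_part m i a b l = ((a, b), restrict l (far_circles m i a b))"

text \<open>
  The identification of \<open>arcH m\<close> with the right hand side of the decomposition. The factors
  \<open>V\<lbrace>1\<rbrace>\<close> record the labels of the circle(s) through \<open>i\<close> and \<open>i + 1\<close>.
\<close>

definition Phi :: "nat \<Rightarrow> nat \<Rightarrow> (kh_gen \<Rightarrow>\<^sub>0 int)
     \<Rightarrow> (kh_gen4 \<times> vgen + kh_gen \<times> vgen \<times> vgen \<Rightarrow>\<^sub>0 int)" where
  "Phi m i = frag_extend (\<lambda>((a, b), l).
     let E = id_closure m a b in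
     frag_of
       (if (a, b) \<in> CM'' m i \<times> CM'' m i - single_circle m i
        then Inr (H2_part m i a b l, l (circ E (Inl i)), l (circ E (Inl (i + 1))))
        else Inl (first_four_part m i a b l, l (circ E (Inl i)))))"

text \<open>
  The corresponding identification for \<open>cupcap m i\<close>. Here the circle through the left arc comes
  first, the circle through the right arc second if it is a different one.
\<close>

definition Psi :: "nat \<Rightarrow> nat \<Rightarrow> (kh_gen \<Rightarrow>\<^sub>0 int)
     \<Rightarrow> (kh_gen4 \<times> vgen \<times> vgen + kh_gen \<times> vgen \<Rightarrow>\<^sub>0 int)" where
  "Psi m i = frag_extend (\<lambda>((a, b), l).
     let E = closure_arcs a (cupcap m i) b in
     frag_of
       (if (a, b) \<in> CM'' m i \<times> CM'' m i - single_circle m i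
        then Inr (H2_part m i a b l, l (circ E (Inl i)))
        else Inl (first_four_part m i a b l, l (circ E (Inl i)), l (circ E (Inr i)))))"

section \<open>Complexes and cohomology\<close>

record 'x complex =
  obj :: "int \<Rightarrow> 'x graded"
  cdiff :: "int \<Rightarrow> ('x \<Rightarrow>\<^sub>0 int) \<Rightarrow> ('x \<Rightarrow>\<^sub>0 int)"

definition two_term :: "'x graded \<Rightarrow> (('x \<Rightarrow>\<^sub>0 int) \<Rightarrow> ('x \<Rightarrow>\<^sub>0 int)) \<Rightarrow> 'x graded \<Rightarrow> 'x complex" where
  "two_term A f B =
     \<lparr>obj = (\<lambda>h. if h = 0 then A else if h = 1 then B else gzero),
      cdiff = (\<lambda>h. if h = 0 then f else (\<lambda>_. 0))\<rparr>"

definition int_shift :: "'x complex \<Rightarrow> int \<Rightarrow> 'x complex" where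
  "int_shift C k = \<lparr>obj = (\<lambda>h. (obj C h)\<lbrace>k\<rbrace>), cdiff = cdiff C\<rparr>"

text \<open>
  \<open>hom_shift C k\<close> lowers the homological degree by \<open>k\<close>. The customary sign of the differential
  is omitted; it affects neither kernels nor images.
\<close>

definition hom_shift :: "'x complex \<Rightarrow> int \<Rightarrow> 'x complex" where
  "hom_shift C k = \<lparr>obj = (\<lambda>h. obj C (h + k)), cdiff = (\<lambda>h. cdiff C (h + k))\<rparr>"

text \<open>Cohomology in homological degree \<open>h\<close> and internal degree \<open>q\<close>.\<close>

definition cohomology :: "'x complex \<Rightarrow> int \<Rightarrow> int \<Rightarrow> ('x \<Rightarrow>\<^sub>0 int) set monoid" where
  "cohomology C h q =
     (piece (obj C h) q)
       \<lparr>carrier := kernel (piece (obj C h) q) (piece (obj C (h + 1)) q) (cdiff C h)\<rparr>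
     Mod (cdiff C (h - 1) ` carrier (piece (obj C (h - 1)) q))"

text \<open>The part of the cohomology in which the homological and the internal degree add up to \<open>d\<close>.\<close>

definition total_cohomology ::
  "'x complex \<Rightarrow> int \<Rightarrow> (int \<Rightarrow> ('x \<Rightarrow>\<^sub>0 int) set) monoid" where
  "total_cohomology C d = sum_group UNIV (\<lambda>h. cohomology C h (d - h))"

definition C_plus :: "nat \<Rightarrow> nat \<Rightarrow> kh_gen complex" where
  "C_plus m i = two_term (arcH m) (alpha m i) (Kh_cupcap m i)\<lbrace>- 1\<rbrace>"

definition C_minus :: "nat \<Rightarrow> nat \<Rightarrow> kh_gen complex" where
  "C_minus m i = two_term (Kh_cupcap m i) (beta m i) (arcH m)\<lbrace>- 1\<rbrace>"

definition Kh_sigma_plus :: "nat \<Rightarrow> nat \<Rightarrow> kh_gen complex" where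
  "Kh_sigma_plus m i = int_shift (C_plus m i) (- 1)"

definition Kh_sigma_minus :: "nat \<Rightarrow> nat \<Rightarrow> kh_gen complex" where
  "Kh_sigma_minus m i = int_shift (hom_shift (C_minus m i) 1) 2"

end

theory Submission
  imports Defs
begin

text \<open>
  On basis elements the identifications \<open>Phi\<close> and \<open>Psi\<close> are bijections, because the circles of a closed
  diagram are the circles away from \<open>i\<close>, \<open>i + 1\<close>, which both diagrams share, together with one or two
  circles through these points. The saddle splits the circle in \<open>a\<^sup>t b\<close> if the points \<open>i\<close> and
  \<open>i + 1\<close> lie on one circle and merges the two circles otherwise. This uses planarity: arcs of a
  crossingless matching join points of different parity, so the walk which leaves the left point \<open>i\<close> along \<open>a\<close>
  and avoids the arcs of the saddle cannot return at the right point \<open>i + 1\<close>, and its end point is the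
  left point \<open>i + 1\<close> or the right point \<open>i\<close>. These are the two cases.
  Thus \<open>\<alpha>\<close> and \<open>\<beta>\<close> become sums of \<open>\<Delta>\<close> and \<open>m\<close>. Since \<open>\<Delta>\<close> is a split injection and \<open>m\<close> a split
  surjection, the cohomology is the sum of the cokernel of one and the kernel of the other.
\<close>

section \<open>Free graded groups and two-term complexes\<close>

text \<open>Each splitting is given by a contraction: a projection \<open>r\<close>, an inclusion
  \<open>s\<close> and a homotopy \<open>h\<close> with \<open>r s = id\<close>, with
  \<open>s r + h d = id\<close> on the source of the differential \<open>d\<close> and
  \<open>s r + d h = id\<close> on its target. Such identities are checked on the generators of V,
  extend to all summands by linearity, and compute the cohomology in every degree. The shifts in the
  cohomology have the same origin. Modulo \<Delta>(1) and \<Delta>(X) the elements 1 \<otimes> v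
  form a basis of V \<otimes> V, so the cokernel of \<Delta> is V with degrees lowered by 1. The
  kernel of m has the basis 1 \<otimes> X - X \<otimes> 1, X \<otimes> X, which is V with degrees
  raised by 1. Circles are sets of end points because a circle away from the saddle is then
  literally the same set in both diagrams, so that labels can be compared without any transport.
  Only the removal of an arc from both matchings requires a renumbering.\<close>

lemma carrier_grp: "x \<in> carrier (grp A) \<longleftrightarrow> Poly_Mapping.keys x \<subseteq> gbasis A"
  by (simp add: grp_def)

lemma carrier_piece:
  "x \<in> carrier (piece A d) \<longleftrightarrow> Poly_Mapping.keys x \<subseteq> {x \<in> gbasis A. gdeg A x = d}"
  by (simp add: piece_def)

lemma gshift_simps [simp]: "gbasis A\<lbrace>k\<rbrace> = gbasis A" "gdeg A\<lbrace>k\<rbrace> x = gdeg A x + k"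
  by (simp_all add: gshift_def)

lemma gshift_gshift [simp]: "A\<lbrace>j\<rbrace>\<lbrace>k\<rbrace> = A\<lbrace>j + k\<rbrace>"
  by (simp add: gshift_def add.assoc)

lemma grp_gshift [simp]: "grp A\<lbrace>k\<rbrace> = grp A"
  by (simp add: grp_def)

lemma gplus_simps [simp]:
  "gbasis (A \<oplus>\<^sub>g B) = gbasis A <+> gbasis B" "gdeg (A \<oplus>\<^sub>g B) = case_sum (gdeg A) (gdeg B)"
  by (simp_all add: gplus_def)

lemma gtensor_simps [simp]:
  "gbasis (A \<otimes>\<^sub>g B) = gbasis A \<times> gbasis B" "gdeg (A \<otimes>\<^sub>g B) (x, y) = gdeg A x + gdeg B y"
  by (simp_all add: gtensor_def)

lemma gsum_simps [simp]:
  "gbasis (gsum I A) = Sigma I (\<lambda>i. gbasis (A i))" "gdeg (gsum I A) (i, x) = gdeg (A i) x"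
  by (simp_all add: gsum_def)

lemma V_simps [simp]: "gbasis V = UNIV" "gdeg V V1 = - 1" "gdeg V VX = 1"
  by (simp_all add: V_def)

lemma TF_simps [simp]: "gbasis (TF S) = S \<rightarrow>\<^sub>E UNIV" "gdeg (TF S) l = (\<Sum>C\<in>S. gdeg V (l C))"
  by (simp_all add: TF_def)

section \<open>Linear maps prescribed on a basis\<close>

lemma keys_frag_extend_subset:
  assumes "Poly_Mapping.keys x \<subseteq> S" "\<And>y. y \<in> S \<Longrightarrow> Poly_Mapping.keys (f y) \<subseteq> T"
  shows "Poly_Mapping.keys (frag_extend f x) \<subseteq> T"
  using keys_frag_extend[of f x] assms by blast

lemma frag_extend_frag_extend:
  "frag_extend f (frag_extend g x) = frag_extend (\<lambda>y. frag_extend f (g y)) x"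
proof -
  have "Poly_Mapping.keys x \<subseteq> UNIV" by simp
  then show ?thesis
    by (induction x rule: frag_induction) (auto simp: frag_extend_diff)
qed

lemma frag_extend_comp_eq_0:
  assumes "Poly_Mapping.keys x \<subseteq> S" "\<And>y. y \<in> S \<Longrightarrow> frag_extend f (g y) = 0"
  shows "frag_extend f (frag_extend g x) = 0"
  unfolding frag_extend_frag_extend by (rule frag_extend_eq_0) (use assms in auto)

lemma frag_extend_plus_fun:
  "frag_extend f x + frag_extend g x = frag_extend (\<lambda>y. f y + g y) x"
proof -
  have "Poly_Mapping.keys x \<subseteq> UNIV" by simp
  then show ?thesis
    by (induction x rule: frag_induction) (auto simp: frag_extend_diff algebra_simps)
qed

lemma frag_extend_id_on:
  assumes "Poly_Mapping.keys x \<subseteq> S" "\<And>y. y \<in> S \<Longrightarrow> f y = frag_of y"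
  shows "frag_extend f x = x"
  using frag_extend_eq[of x f frag_of] assms frag_expansion[of x] by (metis subsetD)

lemma frag_extend_basis_map_iso:
  assumes "bij_betw \<phi> S T"
  shows "frag_extend (frag_of \<circ> \<phi>) \<in> iso (free_Abelian_group S) (free_Abelian_group T)"
    and "frag_extend (frag_of \<circ> \<phi>) ` carrier (free_Abelian_group S) = carrier (free_Abelian_group T)"
proof -
  let ?\<psi> = "inv_into S \<phi>"
  have \<phi>: "\<phi> x \<in> T" if "x \<in> S" for x using assms that by (auto simp: bij_betw_def)
  have \<psi>: "?\<psi> y \<in> S" if "y \<in> T" for y using assms that by (metis bij_betw_def inv_into_into)
  have k1: "Poly_Mapping.keys (frag_extend (frag_of \<circ> \<phi>) x) \<subseteq> T" if "Poly_Mapping.keys x \<subseteq> S" for x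
    by (rule keys_frag_extend_subset[OF that]) (auto simp: \<phi>)
  have k2: "Poly_Mapping.keys (frag_extend (frag_of \<circ> ?\<psi>) y) \<subseteq> S" if "Poly_Mapping.keys y \<subseteq> T" for y
    by (rule keys_frag_extend_subset[OF that]) (auto simp: \<psi>)
  have bij: "bij_betw (frag_extend (frag_of \<circ> \<phi>)) {c. Poly_Mapping.keys c \<subseteq> S} {c. Poly_Mapping.keys c \<subseteq> T}"
  proof (rule bij_betw_byWitness[where f' = "frag_extend (frag_of \<circ> ?\<psi>)"])
    show "\<forall>a\<in>{c. Poly_Mapping.keys c \<subseteq> S}. frag_extend (frag_of \<circ> ?\<psi>) (frag_extend (frag_of \<circ> \<phi>) a) = a"
      using assms by (auto simp: frag_extend_frag_extend bij_betw_inv_into_left intro!: frag_extend_id_on)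
    show "\<forall>a\<in>{c. Poly_Mapping.keys c \<subseteq> T}. frag_extend (frag_of \<circ> \<phi>) (frag_extend (frag_of \<circ> ?\<psi>) a) = a"
      using assms by (auto simp: frag_extend_frag_extend bij_betw_inv_into_right intro!: frag_extend_id_on)
  qed (use k1 k2 in auto)
  show "frag_extend (frag_of \<circ> \<phi>) \<in> iso (free_Abelian_group S) (free_Abelian_group T)"
    using bij k1 by (auto simp: iso_def hom_def frag_extend_add free_Abelian_group_def)
  show "frag_extend (frag_of \<circ> \<phi>) ` carrier (free_Abelian_group S) = carrier (free_Abelian_group T)"
    using bij by (auto simp: bij_betw_def free_Abelian_group_def)
qed

text \<open>A degree-preserving bijection of bases restricts to a bijection in each degree, so
  \<open>frag_extend_basis_map_iso\<close> applies to the whole group and to every homogeneous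
  piece.\<close>

lemma gr_iso_basis_map:
  assumes bij: "bij_betw \<phi> (gbasis A) (gbasis B)"
    and deg: "\<And>x. x \<in> gbasis A \<Longrightarrow> gdeg B (\<phi> x) = gdeg A x"
  shows "gr_iso A B (frag_extend (frag_of \<circ> \<phi>))"
proof -
  have "bij_betw \<phi> {x \<in> gbasis A. gdeg A x = d} {x \<in> gbasis B. gdeg B x = d}" for d
  proof (rule bij_betw_subset[OF bij])
    show "\<phi> ` {x \<in> gbasis A. gdeg A x = d} = {x \<in> gbasis B. gdeg B x = d}"
    proof (intro equalityI subsetI)
      fix y assume y: "y \<in> {x \<in> gbasis B. gdeg B x = d}"
      then obtain x where "x \<in> gbasis A" "y = \<phi> x" using bij by (auto simp: bij_betw_def)
      then show "y \<in> \<phi> ` {x \<in> gbasis A. gdeg A x = d}" using deg y by auto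
    next
      fix y assume "y \<in> \<phi> ` {x \<in> gbasis A. gdeg A x = d}"
      then show "y \<in> {x \<in> gbasis B. gdeg B x = d}" using bij_betwE[OF bij] deg by auto
    qed
  qed auto
  then show ?thesis
    unfolding gr_iso_def grp_def piece_def
    using frag_extend_basis_map_iso(1)[OF bij] frag_extend_basis_map_iso(2) by blast
qed

lemma gr_iso_shift:
  assumes "gr_iso A B f" shows "gr_iso A\<lbrace>k\<rbrace> B\<lbrace>k\<rbrace> f"
proof -
  have "f ` carrier (piece A (d - k)) = carrier (piece B (d - k))" for d
    using assms by (auto simp: gr_iso_def)
  moreover have "piece A\<lbrace>k\<rbrace> d = piece A (d - k)" "piece B\<lbrace>k\<rbrace> d = piece B (d - k)" for d
    by (auto simp: piece_def algebra_simps intro!: arg_cong[of _ _ free_Abelian_group])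
  moreover have "grp A\<lbrace>k\<rbrace> = grp A" "grp B\<lbrace>k\<rbrace> = grp B"
    by (simp_all add: grp_def)
  ultimately show ?thesis using assms by (simp add: gr_iso_def)
qed

text \<open>This is the first isomorphism theorem for \<open>r\<close> on the cocycles: by
  \<open>im\<close> its kernel there consists of the coboundaries, by \<open>surj\<close> its image
  is the free group. That the quotient is a group is recorded as well, for the later passage to
  direct sums.\<close>

lemma cohomology_iso_free:
  assumes diff: "cdiff C h = frag_extend f"
    and im: "\<And>x. x \<in> cdiff C (h - 1) ` carrier (piece (obj C (h - 1)) q) \<longleftrightarrow>
      x \<in> carrier (piece (obj C h) q) \<and> frag_extend f x = 0 \<and> frag_extend r x = 0"
    and surj: "frag_extend r ` {x \<in> carrier (piece (obj C h) q). frag_extend f x = 0} =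
      carrier (free_Abelian_group S)"
  shows "cohomology C h q \<cong> free_Abelian_group S \<and> group (cohomology C h q)"
proof -
  let ?G = "piece (obj C h) q"
  let ?K = "{x \<in> carrier ?G. frag_extend f x = 0}"
  have G: "group ?G" by (simp add: piece_def)
  have mult: "x \<otimes>\<^bsub>?G\<^esub> y = x + y" and one: "\<one>\<^bsub>?G\<^esub> = 0" for x y by (simp_all add: piece_def)
  have "subgroup ?K ?G"
  proof (rule group.subgroupI[OF G])
    show "?K \<noteq> {}"
      by (auto simp: piece_def intro!: exI[of _ 0])
    show "inv\<^bsub>?G\<^esub> a \<in> ?K" if "a \<in> ?K" for a
      using that by (auto simp: piece_def frag_extend_minus)
    show "a \<otimes>\<^bsub>?G\<^esub> b \<in> ?K" if "a \<in> ?K" "b \<in> ?K" for a b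
      using that group.subgroup_self[OF G] subgroup.m_closed[of "carrier ?G" ?G a b]
      by (auto simp: mult frag_extend_add)
  qed auto
  then have K: "group (?G\<lparr>carrier := ?K\<rparr>)" by (rule subgroup.subgroup_is_group[OF _ G])
  interpret group_hom "?G\<lparr>carrier := ?K\<rparr>" "free_Abelian_group S" "frag_extend r"
    using surj by (intro group_hom.intro K group_hom_axioms.intro homI)
      (auto simp: mult frag_extend_add simp del: carrier_free_Abelian_group_iff)
  have "kernel (?G\<lparr>carrier := ?K\<rparr>) (free_Abelian_group S) (frag_extend r) =
      cdiff C (h - 1) ` carrier (piece (obj C (h - 1)) q)"
    using im by (auto simp: kernel_def)
  \<comment> \<open>A kernel sees its codomain only through the unit, which is 0 in every
    piece.\<close>
  moreover have "kernel ?G (piece (obj C (h + 1)) q) (cdiff C h) = ?K"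
    by (auto simp: kernel_def diff piece_def)
  ultimately have coh: "cohomology C h q =
      ?G\<lparr>carrier := ?K\<rparr> Mod kernel (?G\<lparr>carrier := ?K\<rparr>) (free_Abelian_group S) (frag_extend r)"
    by (simp only: cohomology_def)
  have "frag_extend r ` carrier (?G\<lparr>carrier := ?K\<rparr>) = carrier (free_Abelian_group S)"
    using surj by simp
  from FactGroup_iso[OF this] normal.factorgroup_is_group[OF normal_kernel] show ?thesis
    unfolding coh by (rule conjI)
qed

text \<open>On the kernel of \<delta> the contraction identity \<open>sr\<close> reduces to
  \<open>s r = id\<close>, so \<open>r\<close> is injective there. Since \<delta> vanishes on the
  image of \<open>s\<close> and \<open>r s = id\<close>, every element of the target is reached from
  the kernel.\<close>

lemma kernel_contraction:
  assumes s: "\<And>w. w \<in> W \<Longrightarrow> Poly_Mapping.keys (s w) \<subseteq> A"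
    and r: "\<And>x. x \<in> A \<Longrightarrow> Poly_Mapping.keys (r x) \<subseteq> W"
    and ds: "\<And>w. w \<in> W \<Longrightarrow> frag_extend \<delta> (s w) = 0"
    and rs: "\<And>w. w \<in> W \<Longrightarrow> frag_extend r (s w) = frag_of w"
    and sr: "\<And>x. x \<in> A \<Longrightarrow> frag_extend s (r x) + frag_extend h (\<delta> x) = frag_of x"
  shows "frag_extend r ` {x. Poly_Mapping.keys x \<subseteq> A \<and> frag_extend \<delta> x = 0} = {w. Poly_Mapping.keys w \<subseteq> W}"
    and "\<And>x. Poly_Mapping.keys x \<subseteq> A \<Longrightarrow> frag_extend \<delta> x = 0 \<Longrightarrow> frag_extend r x = 0 \<Longrightarrow> x = 0"
proof -
  show "x = 0" if "Poly_Mapping.keys x \<subseteq> A" "frag_extend \<delta> x = 0" "frag_extend r x = 0" for x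
  proof -
    have "frag_extend s (frag_extend r x) + frag_extend h (frag_extend \<delta> x) = x"
      using that(1) sr by (auto simp: frag_extend_frag_extend frag_extend_plus_fun intro!: frag_extend_id_on)
    then show ?thesis using that by simp
  qed
  have "w \<in> frag_extend r ` {x. Poly_Mapping.keys x \<subseteq> A \<and> frag_extend \<delta> x = 0}" if w: "Poly_Mapping.keys w \<subseteq> W" for w
  proof (rule image_eqI)
    show "w = frag_extend r (frag_extend s w)"
      using w rs by (auto simp: frag_extend_frag_extend intro!: frag_extend_id_on[symmetric])
    show "frag_extend s w \<in> {x. Poly_Mapping.keys x \<subseteq> A \<and> frag_extend \<delta> x = 0}"
      using keys_frag_extend_subset[OF w s] frag_extend_comp_eq_0[OF w ds] by simp
  qed
  moreover have "Poly_Mapping.keys (frag_extend r x) \<subseteq> W" if "Poly_Mapping.keys x \<subseteq> A" for x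
    using keys_frag_extend_subset[OF that r] .
  ultimately show "frag_extend r ` {x. Poly_Mapping.keys x \<subseteq> A \<and> frag_extend \<delta> x = 0} = {w. Poly_Mapping.keys w \<subseteq> W}"
    by (intro equalityI subsetI) auto
qed

text \<open>Dual to the kernel case: if \<open>r y = 0\<close>, the contraction identity reads y =
  \<delta>(h y) and exhibits y as a boundary, while \<open>rd\<close> gives the converse.
  Surjectivity of \<open>r\<close> comes from its right inverse \<open>s\<close>.\<close>

lemma cokernel_contraction:
  assumes s: "\<And>w. w \<in> W \<Longrightarrow> Poly_Mapping.keys (s w) \<subseteq> B"
    and r: "\<And>x. x \<in> B \<Longrightarrow> Poly_Mapping.keys (r x) \<subseteq> W"
    and d: "\<And>x. x \<in> A \<Longrightarrow> Poly_Mapping.keys (\<delta> x) \<subseteq> B"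
    and h: "\<And>y. y \<in> B \<Longrightarrow> Poly_Mapping.keys (h y) \<subseteq> A"
    and rd: "\<And>x. x \<in> A \<Longrightarrow> frag_extend r (\<delta> x) = 0"
    and rs: "\<And>w. w \<in> W \<Longrightarrow> frag_extend r (s w) = frag_of w"
    and sr: "\<And>y. y \<in> B \<Longrightarrow> frag_extend s (r y) + frag_extend \<delta> (h y) = frag_of y"
  shows "frag_extend r ` {y. Poly_Mapping.keys y \<subseteq> B} = {w. Poly_Mapping.keys w \<subseteq> W}"
    and "frag_extend \<delta> ` {x. Poly_Mapping.keys x \<subseteq> A} =
      {y. Poly_Mapping.keys y \<subseteq> B \<and> frag_extend r y = 0}"
proof -
  have "w \<in> frag_extend r ` {y. Poly_Mapping.keys y \<subseteq> B}" if w: "Poly_Mapping.keys w \<subseteq> W" for w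
  proof (rule image_eqI)
    show "w = frag_extend r (frag_extend s w)"
      using w rs by (auto simp: frag_extend_frag_extend intro!: frag_extend_id_on[symmetric])
    show "frag_extend s w \<in> {y. Poly_Mapping.keys y \<subseteq> B}"
      using keys_frag_extend_subset[OF w s] by simp
  qed
  moreover have "Poly_Mapping.keys (frag_extend r x) \<subseteq> W" if "Poly_Mapping.keys x \<subseteq> B" for x
    using keys_frag_extend_subset[OF that r] .
  ultimately show "frag_extend r ` {y. Poly_Mapping.keys y \<subseteq> B} = {w. Poly_Mapping.keys w \<subseteq> W}"
    by (intro equalityI subsetI) auto
  have "y \<in> frag_extend \<delta> ` {x. Poly_Mapping.keys x \<subseteq> A}"
    if y: "Poly_Mapping.keys y \<subseteq> B" "frag_extend r y = 0" for y
  proof (rule image_eqI)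
    have "frag_extend s (frag_extend r y) + frag_extend \<delta> (frag_extend h y) = y"
      using y(1) sr by (auto simp: frag_extend_frag_extend frag_extend_plus_fun intro!: frag_extend_id_on)
    then show "y = frag_extend \<delta> (frag_extend h y)" using y by simp
    show "frag_extend h y \<in> {x. Poly_Mapping.keys x \<subseteq> A}"
      using keys_frag_extend_subset[OF y(1) h] by simp
  qed
  moreover have "Poly_Mapping.keys (frag_extend \<delta> x) \<subseteq> B \<and> frag_extend r (frag_extend \<delta> x) = 0"
    if x: "Poly_Mapping.keys x \<subseteq> A" for x
    using keys_frag_extend_subset[OF x d] frag_extend_comp_eq_0[OF x rd] by simp
  ultimately show "frag_extend \<delta> ` {x. Poly_Mapping.keys x \<subseteq> A} =
      {y. Poly_Mapping.keys y \<subseteq> B \<and> frag_extend r y = 0}"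
    by (intro equalityI subsetI) auto
qed

text \<open>The isomorphisms \<phi>, \<psi> replace the complex by a model \<delta> from
  \<open>A'\<close> to \<open>B'\<close>. One homotopy \<open>h\<close> contracts the model on both
  sides: \<open>W0\<close> becomes the kernel, \<open>W1\<close> the cokernel of \<delta>. Degrees
  in \<open>W\<close> are total degrees, hence the terms \<open>k\<close> and \<open>k + 1\<close>
  in the assumptions on \<open>r0\<close>, \<open>s0\<close>, \<open>r1\<close>,
  \<open>s1\<close>.\<close>

theorem total_cohomology_two_term:
  fixes C :: "'x complex" and W :: "'w graded"
  assumes obj: "obj C k = A" "obj C (k + 1) = B" "\<And>j. j \<noteq> k \<Longrightarrow> j \<noteq> k + 1 \<Longrightarrow> gbasis (obj C j) = {}"
    and cdiff: "cdiff C k = frag_extend f" "\<And>j. j \<noteq> k \<Longrightarrow> cdiff C j = (\<lambda>_. 0)"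
    and \<phi>: "gr_iso A A' (frag_extend \<phi>)" and \<psi>: "gr_iso B B' (frag_extend \<psi>)"
    and comm: "\<And>x. x \<in> carrier (grp A) \<Longrightarrow> frag_extend f x \<in> carrier (grp B) \<and>
      frag_extend \<psi> (frag_extend f x) = frag_extend \<delta> (frag_extend \<phi> x)"
    and W: "gbasis W = W0 \<union> W1" "W0 \<inter> W1 = {}"
    and deg_\<delta>: "\<And>x. x \<in> gbasis A' \<Longrightarrow> Poly_Mapping.keys (\<delta> x) \<subseteq> {y \<in> gbasis B'. gdeg B' y = gdeg A' x}"
    and deg_h: "\<And>y. y \<in> gbasis B' \<Longrightarrow> Poly_Mapping.keys (h y) \<subseteq> {x \<in> gbasis A'. gdeg A' x = gdeg B' y}"
    and deg_r0: "\<And>x. x \<in> gbasis A' \<Longrightarrow> Poly_Mapping.keys (r0 x) \<subseteq> {w \<in> W0. gdeg W w = gdeg A' x + k}"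
    and deg_s0: "\<And>w. w \<in> W0 \<Longrightarrow> Poly_Mapping.keys (s0 w) \<subseteq> {x \<in> gbasis A'. gdeg A' x = gdeg W w - k}"
    and deg_r1: "\<And>y. y \<in> gbasis B' \<Longrightarrow> Poly_Mapping.keys (r1 y) \<subseteq> {w \<in> W1. gdeg W w = gdeg B' y + k + 1}"
    and deg_s1: "\<And>w. w \<in> W1 \<Longrightarrow> Poly_Mapping.keys (s1 w) \<subseteq> {y \<in> gbasis B'. gdeg B' y = gdeg W w - k - 1}"
    and ds: "\<And>w. w \<in> W0 \<Longrightarrow> frag_extend \<delta> (s0 w) = 0"
    and rs0: "\<And>w. w \<in> W0 \<Longrightarrow> frag_extend r0 (s0 w) = frag_of w"
    and sr0: "\<And>x. x \<in> gbasis A' \<Longrightarrow> frag_extend s0 (r0 x) + frag_extend h (\<delta> x) = frag_of x"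
    and rd: "\<And>x. x \<in> gbasis A' \<Longrightarrow> frag_extend r1 (\<delta> x) = 0"
    and rs1: "\<And>w. w \<in> W1 \<Longrightarrow> frag_extend r1 (s1 w) = frag_of w"
    and sr1: "\<And>y. y \<in> gbasis B' \<Longrightarrow> frag_extend s1 (r1 y) + frag_extend \<delta> (h y) = frag_of y"
  shows "total_cohomology C d \<cong> piece W d"
proof -
  \<comment> \<open>\<open>S j\<close> is the intended basis of the cohomology in homological degree
    \<open>j\<close> and internal degree \<open>d - j\<close>; membership in \<open>W0\<close>
    decides between \<open>j = k\<close> and \<open>j = k + 1\<close>.\<close>
  define W' where "W' j = {w \<in> gbasis W. gdeg W w = d \<and> (w \<in> W0 \<longleftrightarrow> j = k)}" for j
  define S where "S j = (if j = k \<or> j = k + 1 then W' j else {})" for j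
  let ?A = "\<lambda>q. {x \<in> gbasis A'. gdeg A' x = q}" and ?B = "\<lambda>q. {y \<in> gbasis B'. gdeg B' y = q}"
  have \<phi>_piece: "frag_extend \<phi> ` carrier (piece A q) = {c. Poly_Mapping.keys c \<subseteq> ?A q}" for q
    using \<phi> by (simp add: gr_iso_def piece_def free_Abelian_group_def)
  have \<psi>_piece: "frag_extend \<psi> ` carrier (piece B q) = {c. Poly_Mapping.keys c \<subseteq> ?B q}" for q
    using \<psi> by (simp add: gr_iso_def piece_def free_Abelian_group_def)
  have inj: "inj_on (frag_extend \<phi>) (carrier (grp A))" "inj_on (frag_extend \<psi>) (carrier (grp B))"
    using \<phi> \<psi> by (auto simp: gr_iso_def iso_def bij_betw_def)
  have sub: "carrier (piece X q) \<subseteq> carrier (grp X)" for X :: "'x graded" and q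
    by (auto simp: carrier_grp carrier_piece)
  have zero: "0 \<in> carrier (grp X)" "0 \<in> carrier (piece X q)" for X :: "'x graded" and q
    by (simp_all add: carrier_grp carrier_piece)
  have comp: "frag_extend (\<lambda>x. frag_extend r (g x)) = (\<lambda>x. frag_extend r (frag_extend g x))"
    for r :: "'u \<Rightarrow> ('v \<Rightarrow>\<^sub>0 int)" and g :: "'z \<Rightarrow> ('u \<Rightarrow>\<^sub>0 int)"
    by (simp add: frag_extend_frag_extend)
  have "cohomology C j (d - j) \<cong> free_Abelian_group (S j) \<and> group (cohomology C j (d - j))" for j
  proof -
    consider "j = k" | "j = k + 1" | "j \<noteq> k" "j \<noteq> k + 1" by blast
    then show ?thesis
    proof cases
      case 1
      have W0: "S j = {w \<in> W0. gdeg W w = d}" using 1 W by (auto simp: S_def W'_def)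
      note ker = kernel_contraction[of "S j" s0 "?A (d - k)" r0 \<delta> h]
      have deg: "Poly_Mapping.keys (s0 w) \<subseteq> ?A (d - k)" if "w \<in> S j" for w
        using deg_s0[of w] that W0 by auto
      have deg': "Poly_Mapping.keys (r0 x) \<subseteq> S j" if "x \<in> ?A (d - k)" for x
        using deg_r0[of x] that W0 by auto
      have surj: "frag_extend r0 ` {x. Poly_Mapping.keys x \<subseteq> ?A (d - k) \<and> frag_extend \<delta> x = 0} =
          {w. Poly_Mapping.keys w \<subseteq> S j}"
        using W0 ds rs0 sr0 by (intro ker(1) deg deg') auto
      have triv: "x = 0" if "Poly_Mapping.keys x \<subseteq> ?A (d - k)" "frag_extend \<delta> x = 0" "frag_extend r0 x = 0" for x
        using W0 ds rs0 sr0 that by (intro ker(2)[of x] deg deg') auto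
      have zero_iff: "frag_extend f x = 0 \<longleftrightarrow> frag_extend \<delta> (frag_extend \<phi> x) = 0"
        if "x \<in> carrier (piece A q)" for x q
      proof -
        have x: "x \<in> carrier (grp A)" using that sub by blast
        have "frag_extend f x = 0 \<longleftrightarrow> frag_extend \<psi> (frag_extend f x) = frag_extend \<psi> 0"
          using inj(2) comm[OF x] zero(1) by (metis inj_on_contraD)
        then show ?thesis using comm[OF x] by simp
      qed
      show ?thesis
      proof (rule cohomology_iso_free[where f = f and r = "\<lambda>x. frag_extend r0 (\<phi> x)"])
        show "cdiff C j = frag_extend f" using 1 cdiff by simp
        \<comment> \<open>No nonzero coboundaries arrive in degree \<open>k\<close>, so the
          projection has to be injective on the cocycles.\<close>
        have "x = 0" if x: "x \<in> carrier (piece A (d - k))" "frag_extend f x = 0"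
          "frag_extend r0 (frag_extend \<phi> x) = 0" for x
        proof -
          have "frag_extend \<phi> x = 0"
            using x zero_iff[OF x(1)] \<phi>_piece by (intro triv) auto
          then have "frag_extend \<phi> x = frag_extend \<phi> 0" by simp
          then show "x = 0" using inj(1) x(1) zero(1) sub by (meson inj_onD subsetD)
        qed
        note inj0 = this
        have "cdiff C (j - 1) ` carrier (piece (obj C (j - 1)) (d - j)) = {0}"
          using image_constant[OF zero(2)[of "obj C (j - 1)" "d - j"], of 0] 1 cdiff(2)[of "j - 1"] by simp
        then show "x \<in> cdiff C (j - 1) ` carrier (piece (obj C (j - 1)) (d - j)) \<longleftrightarrow>
            x \<in> carrier (piece (obj C j) (d - j)) \<and> frag_extend f x = 0 \<and>
            frag_extend (\<lambda>x. frag_extend r0 (\<phi> x)) x = 0" for x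
          unfolding comp using 1 obj(1) inj0[of x] zero(2)[of A "d - k"] by auto
        have "frag_extend \<phi> ` {x \<in> carrier (piece A (d - k)). frag_extend f x = 0} =
            {x. Poly_Mapping.keys x \<subseteq> ?A (d - k) \<and> frag_extend \<delta> x = 0}"
        proof (safe, goal_cases)
          case (1 _ x y) then show ?case using \<phi>_piece by blast
        next
          case (2 _ x) then show ?case using \<phi>_piece by blast
        next
          case (3 _ x) then show ?case using zero_iff by blast
        next
          case (4 y)
          then obtain x where "x \<in> carrier (piece A (d - k))" "y = frag_extend \<phi> x"
            using \<phi>_piece[of "d - k"] by blast
          then show ?case using zero_iff 4 by blast
        qed
        then show "frag_extend (\<lambda>x. frag_extend r0 (\<phi> x)) `
            {x \<in> carrier (piece (obj C j) (d - j)). frag_extend f x = 0} = carrier (free_Abelian_group (S j))"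
          unfolding comp image_image[of "frag_extend r0" "frag_extend \<phi>", symmetric]
          using surj 1 obj(1) by (simp add: free_Abelian_group_def)
      qed
    next
      case 2
      have W1: "S j = {w \<in> W1. gdeg W w = d}" using 2 W by (auto simp: S_def W'_def)
      note coker = cokernel_contraction[of "S j" s1 "?B (d - j)" r1 "?A (d - j)" \<delta> h]
      have deg: "Poly_Mapping.keys (s1 w) \<subseteq> ?B (d - j)" if "w \<in> S j" for w
        using deg_s1[of w] that W1 2 by auto
      have deg': "Poly_Mapping.keys (r1 y) \<subseteq> S j" if "y \<in> ?B (d - j)" for y
        using deg_r1[of y] that W1 2 by auto
      have deg'': "Poly_Mapping.keys (\<delta> x) \<subseteq> ?B (d - j)" if "x \<in> ?A (d - j)" for x
        using deg_\<delta>[of x] that by auto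
      have deg''': "Poly_Mapping.keys (h y) \<subseteq> ?A (d - j)" if "y \<in> ?B (d - j)" for y
        using deg_h[of y] that by auto
      have surj: "frag_extend r1 ` {y. Poly_Mapping.keys y \<subseteq> ?B (d - j)} = {w. Poly_Mapping.keys w \<subseteq> S j}"
        using W1 rd rs1 sr1 by (intro coker(1) deg deg' deg'' deg''') auto
      have im: "frag_extend \<delta> ` {x. Poly_Mapping.keys x \<subseteq> ?A (d - j)} =
          {y. Poly_Mapping.keys y \<subseteq> ?B (d - j) \<and> frag_extend r1 y = 0}"
        using W1 rd rs1 sr1 by (intro coker(2) deg deg' deg'' deg''') auto
      have im': "x \<in> frag_extend f ` carrier (piece A (d - j)) \<longleftrightarrow>
          x \<in> carrier (piece B (d - j)) \<and> frag_extend r1 (frag_extend \<psi> x) = 0" for x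
      proof
        assume "x \<in> frag_extend f ` carrier (piece A (d - j))"
        then obtain a where a: "a \<in> carrier (piece A (d - j))" "x = frag_extend f a" by blast
        then have \<psi>x: "frag_extend \<psi> x = frag_extend \<delta> (frag_extend \<phi> a)" and x: "x \<in> carrier (grp B)"
          using comm sub by blast+
        then have *: "frag_extend \<psi> x \<in> {y. Poly_Mapping.keys y \<subseteq> ?B (d - j) \<and> frag_extend r1 y = 0}"
          using im \<phi>_piece a by blast
        \<comment> \<open>Homogeneity is not among the assumptions on \<open>f\<close>. It is
          inherited from \<delta>: the image of \<open>x\<close> under \<psi> lies in the right
          degree, and \<psi> is injective on the whole group and maps pieces onto pieces.\<close>
        then have "frag_extend \<psi> x \<in> frag_extend \<psi> ` carrier (piece B (d - j))"
          unfolding \<psi>_piece by simp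
        then have "x \<in> carrier (piece B (d - j))"
          using inj_on_image_mem_iff[OF inj(2) x sub] by simp
        then show "x \<in> carrier (piece B (d - j)) \<and> frag_extend r1 (frag_extend \<psi> x) = 0" using * by simp
      next
        assume x: "x \<in> carrier (piece B (d - j)) \<and> frag_extend r1 (frag_extend \<psi> x) = 0"
        then have "frag_extend \<psi> x \<in> frag_extend \<delta> ` {x. Poly_Mapping.keys x \<subseteq> ?A (d - j)}"
          using im \<psi>_piece by blast
        then obtain a where a: "a \<in> carrier (piece A (d - j))"
          and \<psi>x: "frag_extend \<psi> x = frag_extend \<delta> (frag_extend \<phi> a)"
          unfolding \<phi>_piece[symmetric] by blast
        note fa = comm[OF subsetD[OF sub a]]
        have "x \<in> carrier (grp B)" using x subsetD[OF sub[where X = B and q = "d - j"]] by simp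
        then have "x = frag_extend f a" using inj_onD[OF inj(2), of x "frag_extend f a"] fa \<psi>x by simp
        then show "x \<in> frag_extend f ` carrier (piece A (d - j))" using a by blast
      qed
      show ?thesis
      proof (rule cohomology_iso_free[where f = "\<lambda>_. 0" and r = "\<lambda>x. frag_extend r1 (\<psi> x)"])
        show "cdiff C j = frag_extend (\<lambda>_. 0)" using 2 cdiff by (auto intro!: frag_extend_eq_0[symmetric])
        show "x \<in> cdiff C (j - 1) ` carrier (piece (obj C (j - 1)) (d - j)) \<longleftrightarrow>
            x \<in> carrier (piece (obj C j) (d - j)) \<and> frag_extend (\<lambda>_. 0) x = (0 :: 'x \<Rightarrow>\<^sub>0 int) \<and>
            frag_extend (\<lambda>x. frag_extend r1 (\<psi> x)) x = 0" for x
          unfolding comp using im'[of x] 2 obj cdiff by (simp add: frag_extend_eq_0)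
        show "frag_extend (\<lambda>x. frag_extend r1 (\<psi> x)) `
            {x \<in> carrier (piece (obj C j) (d - j)). frag_extend (\<lambda>_. 0) x = (0 :: 'x \<Rightarrow>\<^sub>0 int)} =
            carrier (free_Abelian_group (S j))"
          unfolding comp image_image[of "frag_extend r1" "frag_extend \<psi>", symmetric]
          using surj 2 obj(2) \<psi>_piece[of "d - j"] by (simp add: frag_extend_eq_0 free_Abelian_group_def)
      qed
    next
      case 3
      have S: "S j = {}" using 3 by (simp add: S_def)
      show ?thesis
      proof (rule cohomology_iso_free[where f = "\<lambda>_. 0" and r = "\<lambda>_. 0"])
        show "cdiff C j = frag_extend (\<lambda>_. 0)" using 3 cdiff by (auto intro!: frag_extend_eq_0[symmetric])
        show "x \<in> cdiff C (j - 1) ` carrier (piece (obj C (j - 1)) (d - j)) \<longleftrightarrow>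
            x \<in> carrier (piece (obj C j) (d - j)) \<and> frag_extend (\<lambda>_. 0) x = (0 :: 'x \<Rightarrow>\<^sub>0 int) \<and>
            frag_extend (\<lambda>_. 0) x = (0 :: 'w \<Rightarrow>\<^sub>0 int)" for x
        proof -
          have "cdiff C (j - 1) = (\<lambda>_. 0)" using 3 cdiff by simp
          moreover have "carrier (piece (obj C (j - 1)) (d - j)) \<noteq> {}" using zero(2) by blast
          moreover have "x \<in> carrier (piece (obj C j) (d - j)) \<longleftrightarrow> x = 0"
            using 3 obj(3)[of j] by (simp add: carrier_piece)
          ultimately show ?thesis by (auto simp: frag_extend_eq_0)
        qed
        show "frag_extend (\<lambda>_. 0) ` {x \<in> carrier (piece (obj C j) (d - j)).
            frag_extend (\<lambda>_. 0) x = (0 :: 'x \<Rightarrow>\<^sub>0 int)} = carrier (free_Abelian_group (S j))"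
          using zero(2) by (auto simp: S frag_extend_eq_0 free_Abelian_group_def)
      qed
    qed
  qed
  then have "total_cohomology C d \<cong> sum_group UNIV (\<lambda>j. free_Abelian_group (S j))"
    unfolding total_cohomology_def by (intro iso_sum_groupI) auto
  also have "\<dots> \<cong> free_Abelian_group (\<Union>j. S j)"
  proof -
    have "pairwise (\<lambda>i j. disjnt (S i) (S j)) UNIV"
    proof (rule pairwiseI)
      fix i j :: int assume "i \<noteq> j"
      then have "\<not> (w \<in> S i \<and> w \<in> S j)" for w
        by (cases "w \<in> W0") (simp_all add: S_def W'_def)
      then show "disjnt (S i) (S j)" by (simp add: disjnt_iff)
    qed
    from iso_free_Abelian_group_sum[OF this] show ?thesis by (rule is_isoI)
  qed
  also have "(\<Union>j. S j) = {w \<in> gbasis W. gdeg W w = d}"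
  proof (intro equalityI subsetI)
    fix w assume "w \<in> (\<Union>j. S j)"
    then obtain j where "w \<in> S j" by blast
    then show "w \<in> {w \<in> gbasis W. gdeg W w = d}"
      by (cases "j = k \<or> j = k + 1") (simp_all add: S_def W'_def)
  next
    fix w assume "w \<in> {w \<in> gbasis W. gdeg W w = d}"
    then have "w \<in> S (if w \<in> W0 then k else k + 1)" by (simp add: S_def W'_def)
    then show "w \<in> (\<Union>j. S j)" by blast
  qed
  finally show ?thesis by (simp add: piece_def)
qed

section \<open>Contractions of the Frobenius algebra maps\<close>

lemma tensor_map_id_frag_of:
  "tensor_map id g (frag_of (x, y)) = frag_extend (\<lambda>y'. frag_of (x, y')) (g (frag_of y))"
  by (simp add: tensor_map_def tensor_elt_def)

lemma plus_map_frag_of: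
  "plus_map f g (frag_of (Inl x)) = frag_extend (\<lambda>x'. frag_of (Inl x')) (f (frag_of x))"
  "plus_map f g (frag_of (Inr y)) = frag_extend (\<lambda>y'. frag_of (Inr y')) (g (frag_of y))"
  by (simp_all add: plus_map_def)

lemma plus_map_eq_frag_extend: "plus_map f g = frag_extend (\<lambda>x. plus_map f g (frag_of x))"
  by (simp add: plus_map_def)

lemma v_mult_frag_of [simp]:
  "v_mult (frag_of (V1, y)) = frag_of y" "v_mult (frag_of (x, V1)) = frag_of x"
  "v_mult (frag_of (VX, VX)) = 0"
  by (cases x; simp add: v_mult_def)+

lemma v_comult_frag_of [simp]:
  "v_comult (frag_of V1) = frag_of (V1, VX) + frag_of (VX, V1)"
  "v_comult (frag_of VX) = frag_of (VX, VX)"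
  by (simp_all add: v_comult_def)

text \<open>
  The cokernel of \<open>\<Delta>\<close> and the kernel of \<open>m\<close> are both copies of \<open>V\<close>; the following maps are the
  projections onto, the inclusions of, and the contracting homotopies complementary to them.
\<close>

definition coker_proj :: "vgen \<times> vgen \<Rightarrow> (vgen \<Rightarrow>\<^sub>0 int)" where
  "coker_proj = (\<lambda>(x, y). case x of V1 \<Rightarrow> frag_of y | VX \<Rightarrow> (case y of V1 \<Rightarrow> - frag_of VX | VX \<Rightarrow> 0))"

definition coker_incl :: "vgen \<Rightarrow> (vgen \<times> vgen \<Rightarrow>\<^sub>0 int)" where
  "coker_incl v = frag_of (V1, v)"

definition comult_homotopy :: "vgen \<times> vgen \<Rightarrow> (vgen \<Rightarrow>\<^sub>0 int)" where
  "comult_homotopy = (\<lambda>(x, y). case x of V1 \<Rightarrow> 0 | VX \<Rightarrow> frag_of y)"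

definition ker_proj :: "vgen \<times> vgen \<Rightarrow> (vgen \<Rightarrow>\<^sub>0 int)" where
  "ker_proj = (\<lambda>(x, y). case y of V1 \<Rightarrow> 0 | VX \<Rightarrow> frag_of x)"

definition ker_incl :: "vgen \<Rightarrow> (vgen \<times> vgen \<Rightarrow>\<^sub>0 int)" where
  "ker_incl v = (case v of V1 \<Rightarrow> frag_of (V1, VX) - frag_of (VX, V1) | VX \<Rightarrow> frag_of (VX, VX))"

definition mult_homotopy :: "vgen \<Rightarrow> (vgen \<times> vgen \<Rightarrow>\<^sub>0 int)" where
  "mult_homotopy v = frag_of (v, V1)"

lemmas v_split_defs = coker_proj_def coker_incl_def comult_homotopy_def ker_proj_def ker_incl_def
  mult_homotopy_def

definition inl_map :: "('y \<Rightarrow> ('z \<Rightarrow>\<^sub>0 int)) \<Rightarrow> 'x \<times> 'y \<Rightarrow> ('x \<times> 'z + 'w \<Rightarrow>\<^sub>0 int)" where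
  "inl_map f = (\<lambda>(x, y). frag_extend (\<lambda>z. frag_of (Inl (x, z))) (f y))"

definition inr_map :: "('y \<Rightarrow> ('z \<Rightarrow>\<^sub>0 int)) \<Rightarrow> 'x \<times> 'y \<Rightarrow> ('w + 'x \<times> 'z \<Rightarrow>\<^sub>0 int)" where
  "inr_map f = (\<lambda>(x, y). frag_extend (\<lambda>z. frag_of (Inr (x, z))) (f y))"

lemma keys_frag_diff: "Poly_Mapping.keys (frag_of x - frag_of y) \<subseteq> {x, y}"
  using keys_diff[of "frag_of x" "frag_of y"] by auto

lemma keys_frag_add: "Poly_Mapping.keys (frag_of x + frag_of y) \<subseteq> {x, y}"
  using keys_add[of "frag_of x" "frag_of y"] by auto

text \<open>The cokernel of \<Delta> in V{1} \<otimes> V is spanned by the classes of 1 \<otimes> v,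
  in the degrees of v; with internal shift \<open>c - 1\<close> and homological degree
  \<open>k + 1\<close> this makes \<open>c + k\<close>. The kernel of m in V{1} \<otimes> V{1} has
  generators of degrees 2 and 4, which is V{3}; with shift \<open>c\<close> and homological degree
  \<open>k\<close> this makes \<open>c + k + 3\<close>.\<close>

theorem total_cohomology_comult_mult:
  fixes C :: "'x complex" and P :: "'p graded" and Q :: "'q graded"
  assumes obj: "obj C k = A" "obj C (k + 1) = B" "\<And>j. j \<noteq> k \<Longrightarrow> j \<noteq> k + 1 \<Longrightarrow> gbasis (obj C j) = {}"
    and cdiff: "cdiff C k = frag_extend f" "\<And>j. j \<noteq> k \<Longrightarrow> cdiff C j = (\<lambda>_. 0)"
    and \<phi>: "gr_iso A ((P \<otimes>\<^sub>g V\<lbrace>1\<rbrace>) \<oplus>\<^sub>g (Q \<otimes>\<^sub>g V\<lbrace>1\<rbrace> \<otimes>\<^sub>g V\<lbrace>1\<rbrace>))\<lbrace>c\<rbrace> (frag_extend \<phi>)"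
    and \<psi>: "gr_iso B ((P \<otimes>\<^sub>g V\<lbrace>1\<rbrace> \<otimes>\<^sub>g V) \<oplus>\<^sub>g (Q \<otimes>\<^sub>g V\<lbrace>2\<rbrace>))\<lbrace>c - 1\<rbrace> (frag_extend \<psi>)"
    and comm: "\<And>x. x \<in> carrier (grp A) \<Longrightarrow> frag_extend f x \<in> carrier (grp B) \<and>
      frag_extend \<psi> (frag_extend f x) =
      plus_map (tensor_map id v_comult) (tensor_map id v_mult) (frag_extend \<phi> x)"
  shows "total_cohomology C d \<cong> piece ((P \<otimes>\<^sub>g V\<lbrace>c + k\<rbrace>) \<oplus>\<^sub>g (Q \<otimes>\<^sub>g V\<lbrace>c + k + 3\<rbrace>)) d"
\<comment> \<open>The cokernel comes from the summand of \<open>P\<close>, the kernel from that of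
  \<open>Q\<close>. In the cokernel X \<otimes> 1 equals -(1 \<otimes> X) and X \<otimes> X
  vanishes, which dictates \<open>coker_proj\<close>. The homotopies are one-sided inverses:
  \<open>comult_homotopy\<close> is a left inverse of \<Delta>, and \<open>mult_homotopy\<close> is
  the right inverse v \<otimes> 1 of m.\<close>
proof (rule total_cohomology_two_term[OF obj cdiff \<phi> \<psi>, where
    ?\<delta> = "\<lambda>x. plus_map (tensor_map id v_comult) (tensor_map id v_mult) (frag_of x)" and
    ?h = "case_sum (inl_map comult_homotopy) (inr_map mult_homotopy)" and
    ?W0.0 = "{} <+> gbasis Q \<times> UNIV" and ?W1.0 = "gbasis P \<times> UNIV <+> {}" and
    ?r0.0 = "case_sum (\<lambda>_. 0) (inr_map ker_proj)" and
    ?s0.0 = "case_sum (\<lambda>_. 0) (inr_map ker_incl)" and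
    ?r1.0 = "case_sum (inl_map coker_proj) (\<lambda>_. 0)" and
    ?s1.0 = "case_sum (inl_map coker_incl) (\<lambda>_. 0)"])
  fix x assume "x \<in> carrier (grp A)"
  then show "frag_extend f x \<in> carrier (grp B) \<and> frag_extend \<psi> (frag_extend f x) =
      frag_extend (\<lambda>x. plus_map (tensor_map id v_comult) (tensor_map id v_mult) (frag_of x)) (frag_extend \<phi> x)"
    using comm by (simp flip: plus_map_eq_frag_extend)
\<comment> \<open>What remains are the degree conditions and contraction identities on generators, a
  finite check over 1 and X.\<close>
qed (auto simp: v_mult_def v_comult_def plus_map_frag_of tensor_map_id_frag_of frag_extend_add frag_extend_diff
    frag_extend_minus inl_map_def inr_map_def v_split_defs
    split: vgen.splits dest!: subsetD[OF keys_frag_add] subsetD[OF keys_frag_diff])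

text \<open>Here the kernel of m in V{1} \<otimes> V has generators of degrees 1 and 3, which is
  V{2}; the cokernel of \<Delta> in V{1} \<otimes> V{1} is V{1}. The former sits in homological
  degree \<open>k\<close> with shift \<open>c\<close>, the latter in degree \<open>k + 1\<close>
  with shift \<open>c - 1\<close>.\<close>

theorem total_cohomology_mult_comult:
  fixes C :: "'x complex" and P :: "'p graded" and Q :: "'q graded"
  assumes obj: "obj C k = A" "obj C (k + 1) = B" "\<And>j. j \<noteq> k \<Longrightarrow> j \<noteq> k + 1 \<Longrightarrow> gbasis (obj C j) = {}"
    and cdiff: "cdiff C k = frag_extend f" "\<And>j. j \<noteq> k \<Longrightarrow> cdiff C j = (\<lambda>_. 0)"
    and \<phi>: "gr_iso A ((P \<otimes>\<^sub>g V\<lbrace>1\<rbrace> \<otimes>\<^sub>g V) \<oplus>\<^sub>g (Q \<otimes>\<^sub>g V\<lbrace>2\<rbrace>))\<lbrace>c\<rbrace> (frag_extend \<phi>)"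
    and \<psi>: "gr_iso B ((P \<otimes>\<^sub>g V\<lbrace>1\<rbrace>) \<oplus>\<^sub>g (Q \<otimes>\<^sub>g V\<lbrace>1\<rbrace> \<otimes>\<^sub>g V\<lbrace>1\<rbrace>))\<lbrace>c - 1\<rbrace> (frag_extend \<psi>)"
    and comm: "\<And>x. x \<in> carrier (grp A) \<Longrightarrow> frag_extend f x \<in> carrier (grp B) \<and>
      frag_extend \<psi> (frag_extend f x) =
      plus_map (tensor_map id v_mult) (tensor_map id v_comult) (frag_extend \<phi> x)"
  shows "total_cohomology C d \<cong> piece ((P \<otimes>\<^sub>g V\<lbrace>c + k + 2\<rbrace>) \<oplus>\<^sub>g (Q \<otimes>\<^sub>g V\<lbrace>c + k + 1\<rbrace>)) d"
proof (rule total_cohomology_two_term[OF obj cdiff \<phi> \<psi>, where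
    ?\<delta> = "\<lambda>x. plus_map (tensor_map id v_mult) (tensor_map id v_comult) (frag_of x)" and
    ?h = "case_sum (inl_map mult_homotopy) (inr_map comult_homotopy)" and
    ?W0.0 = "gbasis P \<times> UNIV <+> {}" and ?W1.0 = "{} <+> gbasis Q \<times> UNIV" and
    ?r0.0 = "case_sum (inl_map ker_proj) (\<lambda>_. 0)" and
    ?s0.0 = "case_sum (inl_map ker_incl) (\<lambda>_. 0)" and
    ?r1.0 = "case_sum (\<lambda>_. 0) (inr_map coker_proj)" and
    ?s1.0 = "case_sum (\<lambda>_. 0) (inr_map coker_incl)"])
  fix x assume "x \<in> carrier (grp A)"
  then show "frag_extend f x \<in> carrier (grp B) \<and> frag_extend \<psi> (frag_extend f x) =
      frag_extend (\<lambda>x. plus_map (tensor_map id v_mult) (tensor_map id v_comult) (frag_of x)) (frag_extend \<phi> x)"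
    using comm by (simp flip: plus_map_eq_frag_extend)
qed (auto simp: v_mult_def v_comult_def plus_map_frag_of tensor_map_id_frag_of frag_extend_add frag_extend_diff
    frag_extend_minus inl_map_def inr_map_def v_split_defs
    split: vgen.splits dest!: subsetD[OF keys_frag_add] subsetD[OF keys_frag_diff])

section \<open>Circles and crossingless matchings\<close>

lemma circ_self [simp]: "p \<in> circ E p"
  by (simp add: circ_def)

lemma circ_step:
  assumes "x \<in> circ E p" "{x, y} \<in> E" shows "y \<in> circ E p"
  using assms rtrancl_into_rtrancl[of p x "{(x, y). {x, y} \<in> E}" y] by (simp add: circ_def)

lemma circ_induct [consumes 1, case_names base step]:
  assumes "x \<in> circ E p" "P p" "\<And>x y. x \<in> circ E p \<Longrightarrow> {x, y} \<in> E \<Longrightarrow> P x \<Longrightarrow> P y"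
  shows "P x"
proof -
  have "(p, x) \<in> {(x, y). {x, y} \<in> E}\<^sup>*" using assms(1) by (simp add: circ_def)
  then show ?thesis
    by (induction rule: rtrancl_induct) (use assms(2,3) in \<open>auto simp: circ_def\<close>)
qed

lemma circ_least:
  assumes "p \<in> S" "\<And>x y. x \<in> S \<Longrightarrow> {x, y} \<in> E \<Longrightarrow> y \<in> S"
  shows "circ E p \<subseteq> S"
proof
  fix x assume "x \<in> circ E p"
  then show "x \<in> S" by (induction rule: circ_induct) (use assms in auto)
qed

lemma circ_sym: "q \<in> circ E p \<longleftrightarrow> p \<in> circ E q"
proof -
  have "p \<in> circ E q" if "q \<in> circ E p" for p q
    using that
  proof (induction rule: circ_induct)
    case (step x y)
    have "x \<in> circ E y" using step(2) by (metis circ_self circ_step insert_commute)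
    then have "circ E x \<subseteq> circ E y" by (rule circ_least) (rule circ_step)
    then show ?case using step by blast
  qed simp
  then show ?thesis by blast
qed

lemma circ_eq_iff: "circ E p = circ E q \<longleftrightarrow> q \<in> circ E p"
proof
  assume "q \<in> circ E p"
  then have "p \<in> circ E q" using circ_sym by metis
  show "circ E p = circ E q"
  proof
    show "circ E p \<subseteq> circ E q" using \<open>p \<in> circ E q\<close> by (rule circ_least) (rule circ_step)
    show "circ E q \<subseteq> circ E p" using \<open>q \<in> circ E p\<close> by (rule circ_least) (rule circ_step)
  qed
next
  assume "circ E p = circ E q"
  then show "q \<in> circ E p" by simp
qed

lemma circ_edge_eq: "{p, q} \<in> E \<Longrightarrow> circ E p = circ E q"
  unfolding circ_eq_iff by (rule circ_step[OF circ_self])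

text \<open>Only arcs that start on the circle itself enter its construction, so two graphs may
  differ arbitrarily elsewhere.\<close>

lemma circ_cong:
  assumes "\<And>x y. x \<in> circ E p \<Longrightarrow> {x, y} \<in> E' \<longleftrightarrow> {x, y} \<in> E"
  shows "circ E' p = circ E p"
proof
  show "circ E' p \<subseteq> circ E p"
  proof (rule circ_least)
    fix x y assume xy: "x \<in> circ E p" "{x, y} \<in> E'"
    then have "{x, y} \<in> E" using assms by simp
    then show "y \<in> circ E p" by (rule circ_step[OF xy(1)])
  qed simp
  show "circ E p \<subseteq> circ E' p"
  proof
    fix x assume "x \<in> circ E p"
    then show "x \<in> circ E' p"
    proof (induction rule: circ_induct)
      case (step x y)
      then show ?case using assms[of x y] circ_step[of x E' p y] by simp
    qed simp
  qed
qed

text \<open>The assumption says that \<open>g\<close> carries arcs to arcs and that no arc leads out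
  of its range, so a walk that starts in the range lifts step by step.\<close>

lemma circ_image:
  assumes "\<And>x y. {g x, y} \<in> E \<longleftrightarrow> (\<exists>y'. y = g y' \<and> {x, y'} \<in> E0)"
  shows "circ E (g p) = g ` circ E0 p"
proof
  show "circ E (g p) \<subseteq> g ` circ E0 p"
  proof (rule circ_least)
    fix x y assume "x \<in> g ` circ E0 p" and xy: "{x, y} \<in> E"
    then obtain x' where x': "x' \<in> circ E0 p" "x = g x'" by auto
    then obtain y' where "y = g y'" "{x', y'} \<in> E0" using xy assms by auto
    then show "y \<in> g ` circ E0 p" using circ_step[OF x'(1)] by simp
  qed simp
  show "g ` circ E0 p \<subseteq> circ E (g p)"
  proof (rule image_subsetI)
    fix x assume "x \<in> circ E0 p"
    then show "g x \<in> circ E (g p)"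
    proof (induction rule: circ_induct)
      case (step x y)
      then have "{g x, g y} \<in> E" using assms by auto
      with step(3) show ?case by (rule circ_step)
    qed simp
  qed
qed

lemma circlesE:
  assumes "C \<in> circles E" obtains p where "p \<in> \<Union>E" "C = circ E p"
  using assms by (auto simp: circles_def)

lemma circles_eq_circ: "C \<in> circles E \<Longrightarrow> p \<in> C \<Longrightarrow> C = circ E p"
  by (metis circlesE circ_eq_iff)

text \<open>The partition is unpacked into statements about single arcs \<open>{k, l}\<close>. Later
  proofs follow arcs from one end to the other, and matchings are built by checking these
  conditions.\<close>

lemma CM_iff:
  "a \<in> CM m \<longleftrightarrow>
    (\<forall>e\<in>a. \<exists>k l. e = {k, l} \<and> k \<noteq> l) \<and>
    (\<forall>k l. {k, l} \<in> a \<longrightarrow> k \<in> {1..2 * m} \<and> l \<in> {1..2 * m}) \<and>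
    (\<forall>k\<in>{1..2 * m}. \<exists>l. {k, l} \<in> a) \<and>
    (\<forall>k l l'. {k, l} \<in> a \<longrightarrow> {k, l'} \<in> a \<longrightarrow> l = l') \<and>
    (\<forall>p q r s. p < q \<longrightarrow> q < r \<longrightarrow> r < s \<longrightarrow> {p, r} \<in> a \<longrightarrow> {q, s} \<in> a \<longrightarrow> False)"
    (is "_ \<longleftrightarrow> ?pairs \<and> ?range \<and> ?cover \<and> ?unique \<and> ?planar")
proof
  assume a: "a \<in> CM m"
  then have part: "partition_on {1..2 * m} a" by (simp add: CM_def)
  have pairs: ?pairs
  proof
    fix e assume "e \<in> a"
    then have "card e = 2" using a by (simp add: CM_def)
    then show "\<exists>k l. e = {k, l} \<and> k \<noteq> l" by (metis card_2_iff)
  qed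
  have ?range using partition_onD1[OF part] by blast
  moreover have ?cover
  proof
    fix k assume "k \<in> {1..2 * m}"
    then obtain e where "e \<in> a" "k \<in> e" using partition_onD1[OF part] by blast
    then show "\<exists>l. {k, l} \<in> a" using pairs by (metis insert_commute insert_iff singletonD)
  qed
  moreover have ?unique
  proof (intro allI impI)
    fix k l l' assume kl: "{k, l} \<in> a" "{k, l'} \<in> a"
    then have "{k, l} = {k, l'}"
      using partition_onD2[OF part] by (metis disjointD insertI1 insert_disjoint(1))
    then show "l = l'" by (metis doubleton_eq_iff)
  qed
  moreover have ?planar using a unfolding CM_def by blast
  ultimately show "?pairs \<and> ?range \<and> ?cover \<and> ?unique \<and> ?planar" using pairs by blast
next
  assume *: "?pairs \<and> ?range \<and> ?cover \<and> ?unique \<and> ?planar"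
  then have pairs: ?pairs and range: ?range and cover: ?cover and unique: ?unique and planar: ?planar
    by blast+
  have "partition_on {1..2 * m} a"
  proof (rule partition_onI)
    show "\<Union>a = {1..2 * m}"
    proof
      show "\<Union>a \<subseteq> {1..2 * m}"
      proof
        fix k assume "k \<in> \<Union>a"
        then obtain e where e: "e \<in> a" "k \<in> e" by blast
        then obtain l where "e = {k, l}" using pairs by (metis insert_commute insert_iff singletonD)
        then show "k \<in> {1..2 * m}" using range e by blast
      qed
      show "{1..2 * m} \<subseteq> \<Union>a" using cover by blast
    qed
    show "disjnt e e'" if e: "e \<in> a" "e' \<in> a" "e \<noteq> e'" for e e'
    proof (rule ccontr)
      assume "\<not> disjnt e e'"
      then obtain k where "k \<in> e" "k \<in> e'" by (auto simp: disjnt_iff)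
      then obtain l l' where "e = {k, l}" "e' = {k, l'}"
        using pairs e by (metis insert_commute insert_iff singletonD)
      then show False using unique e by blast
    qed
    show "{} \<notin> a" using pairs by blast
  qed
  moreover have "\<forall>e\<in>a. card e = 2"
  proof
    fix e assume "e \<in> a"
    then obtain k l where "e = {k, l}" "k \<noteq> l" using pairs by blast
    then show "card e = 2" by simp
  qed
  ultimately show "a \<in> CM m" unfolding CM_def using planar by blast
qed

lemma
  assumes "a \<in> CM m"
  shows CM_pair: "e \<in> a \<Longrightarrow> \<exists>k l. e = {k, l} \<and> k \<noteq> l"
    and CM_range: "{k, l} \<in> a \<Longrightarrow> k \<in> {1..2 * m}" "{k, l} \<in> a \<Longrightarrow> l \<in> {1..2 * m}"
    and CM_cover: "k \<in> {1..2 * m} \<Longrightarrow> \<exists>l. {k, l} \<in> a"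
    and CM_unique: "{k, l} \<in> a \<Longrightarrow> {k, l'} \<in> a \<Longrightarrow> l = l'"
    and CM_planar: "p < q \<Longrightarrow> q < r \<Longrightarrow> r < s \<Longrightarrow> {p, r} \<in> a \<Longrightarrow> {q, s} \<notin> a"
  using assms unfolding CM_iff by blast+

lemma CM_neq: "a \<in> CM m \<Longrightarrow> {k, l} \<in> a \<Longrightarrow> k \<noteq> l"
  using CM_pair by (metis doubleton_eq_iff)

text \<open>An arc that left the open interval between the ends of another arc would cross it, so
  the points inside are matched among themselves and their number is even.\<close>

lemma CM_parity:
  assumes a: "a \<in> CM m" and kl: "{k, l} \<in> a"
  shows "even k \<longleftrightarrow> odd l"
proof -
  have *: "even p \<longleftrightarrow> odd q" if pq: "{p, q} \<in> a" "p < q" for p q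
  proof -
    define B where "B = {e \<in> a. e \<subseteq> {p<..<q}}"
    have mem: "s \<in> {p<..<q}" if rs: "{r, s} \<in> a" "r \<in> {p<..<q}" for r s
    proof (rule ccontr)
      assume s: "s \<notin> {p<..<q}"
      have "s \<noteq> p" "s \<noteq> q" using CM_unique[OF a] rs pq by (metis greaterThanLessThan_iff insert_commute less_irrefl)+
      then consider "s < p" | "q < s" using s by force
      then show False
      proof cases
        case 1
        then show False using CM_planar[OF a, of s p r q] rs pq by (simp add: insert_commute)
      next
        case 2
        then show False using CM_planar[OF a, of p r q s] rs pq by (simp add: insert_commute)
      qed
    qed
    have "\<Union>B = {p<..<q}"
    proof
      show "{p<..<q} \<subseteq> \<Union>B"
      proof
        fix r assume r: "r \<in> {p<..<q}"
        have "p \<in> {1..2 * m}" "q \<in> {1..2 * m}" using CM_range[OF a] pq by blast+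
        then have "r \<in> {1..2 * m}" using r by simp
        then obtain s where s: "{r, s} \<in> a" using CM_cover[OF a] by blast
        then have "{r, s} \<in> B" using mem r by (simp add: B_def)
        then show "r \<in> \<Union>B" by blast
      qed
    qed (auto simp: B_def)
    moreover have "card (\<Union>B) = (\<Sum>e\<in>B. card e)"
    proof (rule card_Union_disjoint)
      have "disjoint a" using a by (simp add: CM_def partition_on_def)
      then show "pairwise disjnt B" using pairwise_subset[of disjnt a B] by (auto simp: disjoint_def B_def pairwise_def disjnt_def)
      show "finite e" if "e \<in> B" for e using that finite_subset[of e "{p<..<q}"] by (simp add: B_def)
    qed
    moreover have "(\<Sum>e\<in>B. card e) = (\<Sum>e\<in>B. 2)"
      by (rule sum.cong) (use a in \<open>auto simp: B_def CM_def\<close>)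
    \<comment> \<open>The open interval has \<open>q - Suc p\<close> points, so \<open>q\<close> and
      \<open>p + 1\<close> have the same parity.\<close>
    ultimately have "q - Suc p = card B * 2" by simp
    then show ?thesis using \<open>p < q\<close> by (metis Suc_leI add_diff_inverse_nat dvd_triv_right even_Suc even_add linorder_not_less)
  qed
  show ?thesis
    using *[of k l] *[of l k] kl CM_neq[OF a kl] by (metis insert_commute nat_neq_iff)
qed

text \<open>
  Following alternately the two involutions from a fixed point \<open>u\<close> of \<open>T\<close> leads to a second fixed
  point \<open>v\<close>, after an odd number of steps, so \<open>v\<close> has the other colour.
\<close>

lemma alternating_walk:
  fixes A T :: "'p \<Rightarrow> 'p" and c :: "'p \<Rightarrow> bool"
  assumes A: "\<And>x. A (A x) = x" and T: "\<And>x. T (T x) = x"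
    and fin: "finite M" and AV: "\<And>x. x \<in> M \<Longrightarrow> A x \<in> M" and TV: "\<And>x. x \<in> M \<Longrightarrow> T x \<in> M"
    and cA: "\<And>x. x \<in> M \<Longrightarrow> c (A x) \<noteq> c x" and cT: "\<And>x. x \<in> M \<Longrightarrow> T x \<noteq> x \<Longrightarrow> c (T x) \<noteq> c x"
    and u: "u \<in> M" "T u = u"
  obtains P v where "u \<in> P" "v \<in> P" "P \<subseteq> M" "\<And>x. x \<in> P \<Longrightarrow> A x \<in> P" "\<And>x. x \<in> P \<Longrightarrow> T x \<in> P"
    "c v \<noteq> c u" "T v = v" "\<And>x. x \<in> P \<Longrightarrow> T x = x \<Longrightarrow> x = u \<or> x = v"
    "\<And>S. u \<in> S \<Longrightarrow> (\<And>x. x \<in> S \<Longrightarrow> A x \<in> S) \<Longrightarrow> (\<And>x. x \<in> S \<Longrightarrow> T x \<in> S) \<Longrightarrow> P \<subseteq> S"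
proof -
  define w where "w n = ((\<lambda>x. T (A x)) ^^ n) u" for n
  have w0: "w 0 = u" and wS: "w (Suc n) = T (A (w n))" for n by (simp_all add: w_def)
  have wV: "w n \<in> M" for n by (induction n) (use u AV TV in \<open>auto simp: w0 wS\<close>)
  have "inj (\<lambda>x. T (A x))" by (metis A T injI)
  moreover have "finite {y. \<exists>n. y = ((\<lambda>x. T (A x)) ^^ n) u}"
    by (rule finite_subset[OF _ fin]) (use wV in \<open>auto simp: w_def\<close>)
  ultimately obtain n where "0 < n" "((\<lambda>x. T (A x)) ^^ n) u = u"
    by (rule funpow_inj_finite)
  then obtain n' where "w (Suc n') = u" by (metis w_def gr0_implies_Suc)
  \<comment> \<open>The orbit of \<open>u\<close> is finite and the step map is injective, so the
    walk returns to \<open>u\<close>. As \<open>u\<close> is its own image under \<open>T\<close>,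
    the point reached just before the last use of \<open>T\<close> was already \<open>u\<close>, a
    fixed point. \<open>N\<close> is the first time a fixed point is met in this way.\<close>
  then have "T (A (w n')) = A (w n')" using T u by (metis wS)
  then obtain N where N: "T (A (w N)) = A (w N)" and less: "\<And>n. n < N \<Longrightarrow> T (A (w n)) \<noteq> A (w n)"
    using exists_least_iff[of "\<lambda>n. T (A (w n)) = A (w n)"] by blast
  \<comment> \<open>Before time \<open>N\<close> each round consists of two genuine moves, both of
    which change the colour. The final move along \<open>A\<close> alone then leaves the opposite
    colour.\<close>
  have cw: "c (w n) = c u" if "n \<le> N" for n
    using that
  proof (induction n)
    case (Suc n)
    then have "c (w (Suc n)) \<noteq> c (A (w n))" using less cT AV wV by (simp add: wS)
    then show ?case using Suc cA wV by auto
  qed (simp add: w0)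
  \<comment> \<open>The points met by the walk. This set is closed under \<open>T\<close> because
    the walk is bounded at both ends by fixed points of \<open>T\<close>.\<close>
  define P where "P = w ` {..N} \<union> A ` w ` {..N}"
  show thesis
  proof (rule that[of P "A (w N)"])
    show "u \<in> P" unfolding P_def using w0 by (metis UnI1 atMost_iff image_eqI le0)
    show "A (w N) \<in> P" by (simp add: P_def)
    show "P \<subseteq> M" using wV AV by (auto simp: P_def)
    show "A x \<in> P" if "x \<in> P" for x using that by (auto simp: P_def A)
    show "T x \<in> P" if "x \<in> P" for x
    proof -
      consider n where "n \<le> N" "x = w n" | n where "n \<le> N" "x = A (w n)"
        using \<open>x \<in> P\<close> unfolding P_def by blast
      then show ?thesis
      proof cases
        case 1
        show ?thesis
        proof (cases n)
          case 0 then show ?thesis using 1 u \<open>u \<in> P\<close> by (simp add: w0)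
        next
          case (Suc k) then show ?thesis using 1 by (auto simp: wS T P_def)
        qed
      next
        case 2
        show ?thesis
        proof (cases "n = N")
          case True then show ?thesis using 2 N by (simp add: P_def)
        next
          case False
          then have "Suc n \<le> N" "T x = w (Suc n)" using 2 by (simp_all add: wS)
          then show ?thesis unfolding P_def by blast
        qed
      qed
    qed
    show "c (A (w N)) \<noteq> c u" using cA wV cw by auto
    show "T (A (w N)) = A (w N)" by (rule N)
    show "x = u \<or> x = A (w N)" if "x \<in> P" and fp: "T x = x" for x
    proof -
      consider n where "n \<le> N" "x = w n" | n where "n \<le> N" "x = A (w n)"
        using \<open>x \<in> P\<close> unfolding P_def by blast
      then show ?thesis
      proof cases
        case 1
        show ?thesis
        proof (cases n)
          case 0 then show ?thesis using 1 by (simp add: w0)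
        next
          case (Suc k)
          then have "T (A (w k)) = A (w k)" using 1 fp T by (metis wS)
          then show ?thesis using less[of k] Suc 1 by simp
        qed
      next
        case 2 then show ?thesis using less[of n] fp by (cases "n = N") auto
      qed
    qed
    show "P \<subseteq> S" if S: "u \<in> S" "\<And>x. x \<in> S \<Longrightarrow> A x \<in> S" "\<And>x. x \<in> S \<Longrightarrow> T x \<in> S" for S
    proof -
      have "w n \<in> S" for n by (induction n) (use S in \<open>auto simp: w0 wS\<close>)
      then show ?thesis using S(2) by (auto simp: P_def)
    qed
  qed
qed

section \<open>Surgery on closed diagrams\<close>

text \<open>A point outside the matching is its own mate, which makes \<open>mate a\<close> an
  involution on all numbers, as \<open>alternating_walk\<close> requires.\<close>

definition mate :: "nat set set \<Rightarrow> nat \<Rightarrow> nat" where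
  "mate a k = (if \<exists>l. {k, l} \<in> a then THE l. {k, l} \<in> a else k)"

lemma mate_eq:
  assumes "a \<in> CM m" "{k, l} \<in> a" shows "mate a k = l"
proof -
  have "(THE l. {k, l} \<in> a) = l" using assms CM_unique by (intro the_equality) blast+
  then show ?thesis using assms(2) by (auto simp: mate_def)
qed

lemma edge_iff_mate:
  assumes a: "a \<in> CM m" shows "{k, l} \<in> a \<longleftrightarrow> k \<in> {1..2 * m} \<and> l = mate a k"
proof
  assume "{k, l} \<in> a" then show "k \<in> {1..2 * m} \<and> l = mate a k" using mate_eq[OF a] CM_range[OF a] by blast
next
  assume *: "k \<in> {1..2 * m} \<and> l = mate a k"
  then obtain l' where "{k, l'} \<in> a" using CM_cover[OF a] by blast
  then show "{k, l} \<in> a" using mate_eq[OF a] * by metis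
qed

lemma mate_mate:
  assumes a: "a \<in> CM m" shows "mate a (mate a k) = k"
proof (cases "\<exists>l. {k, l} \<in> a")
  case True
  then obtain l where "{k, l} \<in> a" by blast
  then show ?thesis using mate_eq[OF a] by (metis insert_commute)
qed (simp add: mate_def)

lemma mate_in_range: "a \<in> CM m \<Longrightarrow> k \<in> {1..2 * m} \<Longrightarrow> mate a k \<in> {1..2 * m}"
  using edge_iff_mate CM_range(2) by blast

lemma mate_parity: "a \<in> CM m \<Longrightarrow> k \<in> {1..2 * m} \<Longrightarrow> even (mate a k) \<longleftrightarrow> odd k"
  using edge_iff_mate[of a m k "mate a k"] CM_parity[of a m k "mate a k"] by blast

lemma closure_arcs_edge:
  "{Inl j, Inl k} \<in> closure_arcs a T b \<longleftrightarrow> {j, k} \<in> a \<or> {Inl j, Inl k} \<in> T"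
  "{Inr j, Inr k} \<in> closure_arcs a T b \<longleftrightarrow> {j, k} \<in> b \<or> {Inr j, Inr k} \<in> T"
  "{Inl j, Inr k} \<in> closure_arcs a T b \<longleftrightarrow> {Inl j, Inr k} \<in> T"
proof -
  have l: "{Inl j, Inl k} \<in> image Inl ` a \<longleftrightarrow> {j, k} \<in> a" for j k :: nat and a
  proof -
    have "{Inl j, Inl k} = Inl ` {j, k}" by simp
    then show ?thesis by (metis (no_types, lifting) image_iff inj_Inl inj_image_eq_iff)
  qed
  have r: "{Inr j, Inr k} \<in> image Inr ` b \<longleftrightarrow> {j, k} \<in> b" for j k :: nat and b
  proof -
    have "{Inr j, Inr k} = Inr ` {j, k}" by simp
    then show ?thesis by (metis (no_types, lifting) image_iff inj_Inr inj_image_eq_iff)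
  qed
  have "{x, Inr k} \<notin> image Inl ` a" "{Inl j, x} \<notin> image Inr ` b" for x by blast+
  moreover have "{Inr j, Inr k} \<notin> image Inl ` a" "{Inl j, Inl k} \<notin> image Inr ` b" by blast+
  ultimately show
    "{Inl j, Inl k} \<in> closure_arcs a T b \<longleftrightarrow> {j, k} \<in> a \<or> {Inl j, Inl k} \<in> T"
    "{Inr j, Inr k} \<in> closure_arcs a T b \<longleftrightarrow> {j, k} \<in> b \<or> {Inr j, Inr k} \<in> T"
    "{Inl j, Inr k} \<in> closure_arcs a T b \<longleftrightarrow> {Inl j, Inr k} \<in> T"
    by (auto simp: closure_arcs_def l r)
qed

lemma id_tangle_edge:
  "{Inl j, Inl k} \<notin> id_tangle m" "{Inr j, Inr k} \<notin> id_tangle m"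
  "{Inl j, Inr k} \<in> id_tangle m \<longleftrightarrow> j = k \<and> j \<in> {1..2 * m}"
  by (auto simp: id_tangle_def doubleton_eq_iff)

lemma cupcap_edge:
  "{Inl j, Inl k} \<in> cupcap m i \<longleftrightarrow> {j, k} = {i, i + 1}"
  "{Inr j, Inr k} \<in> cupcap m i \<longleftrightarrow> {j, k} = {i, i + 1}"
  "{Inl j, Inr k} \<in> cupcap m i \<longleftrightarrow> j = k \<and> j \<in> {1..2 * m} - {i, i + 1}"
  by (auto simp: cupcap_def doubleton_eq_iff)

section \<open>Closed diagrams as pairs of involutions on their end points\<close>

abbreviation swap_side :: "nat + nat \<Rightarrow> nat + nat" where
  "swap_side \<equiv> case_sum Inr Inl"

lemma swap_swap [simp]: "swap_side (swap_side x) = x"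
  by (cases x) simp_all

definition verts :: "nat \<Rightarrow> (nat + nat) set" where
  "verts m = {1..2 * m} <+> {1..2 * m}"

lemma verts_simps [simp]: "Inl k \<in> verts m \<longleftrightarrow> k \<in> {1..2 * m}" "Inr k \<in> verts m \<longleftrightarrow> k \<in> {1..2 * m}"
  by (auto simp: verts_def)

locale matching_pair =
  fixes m :: nat and a b :: "nat set set"
  assumes a: "a \<in> CM m" and b: "b \<in> CM m"
begin

abbreviation "idE \<equiv> id_closure m a b"

definition mate_out :: "nat + nat \<Rightarrow> nat + nat" where
  "mate_out = map_sum (mate a) (mate b)"

lemma swap_verts [simp]: "swap_side x \<in> verts m \<longleftrightarrow> x \<in> verts m"
  by (cases x) auto

lemma mate_out_mate_out [simp]: "mate_out (mate_out x) = x"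
  using mate_mate[OF a] mate_mate[OF b] by (cases x) (simp_all add: mate_out_def)

lemma mate_out_verts: "x \<in> verts m \<Longrightarrow> mate_out x \<in> verts m"
  using mate_in_range[OF a] mate_in_range[OF b] by (cases x) (simp_all add: mate_out_def del: atLeastAtMost_iff)

lemma idE_edge: "{x, y} \<in> idE \<longleftrightarrow> x \<in> verts m \<and> (y = mate_out x \<or> y = swap_side x)"
proof (cases x; cases y)
  fix j k assume "x = Inl j" "y = Inl k"
  then show ?thesis
    by (simp add: id_closure_def closure_arcs_edge id_tangle_edge edge_iff_mate[OF a] mate_out_def del: atLeastAtMost_iff)
next
  fix j k assume "x = Inr j" "y = Inr k"
  then show ?thesis
    by (simp add: id_closure_def closure_arcs_edge id_tangle_edge edge_iff_mate[OF b] mate_out_def del: atLeastAtMost_iff)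
next
  fix j k assume "x = Inl j" "y = Inr k"
  then show ?thesis
    by (auto simp add: id_closure_def closure_arcs_edge id_tangle_edge mate_out_def)
next
  fix j k assume *: "x = Inr j" "y = Inl k"
  have "{x, y} = {Inl k, Inr j}" using * by blast
  then show ?thesis using *
    by (auto simp add: id_closure_def closure_arcs_edge id_tangle_edge mate_out_def)
qed

lemma outer_arc_pair:
  assumes "e \<in> image Inl ` a \<or> e \<in> image Inr ` b" shows "\<exists>x y. e = {x, y}"
  using assms
proof
  assume "e \<in> image Inl ` a"
  then obtain e' where "e' \<in> a" "e = Inl ` e'" by (rule imageE)
  then show ?thesis using CM_pair[OF a] by (metis image_empty image_insert)
next
  assume "e \<in> image Inr ` b"
  then obtain e' where "e' \<in> b" "e = Inr ` e'" by (rule imageE)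
  then show ?thesis using CM_pair[OF b] by (metis image_empty image_insert)
qed

text \<open>The set \<open>circles E\<close> is indexed by the points of \<open>\<Union>E\<close>; a
  general \<open>T\<close> allows one argument for both closures.\<close>

lemma closure_arcs_Union:
  assumes T: "\<And>e. e \<in> T \<Longrightarrow> \<exists>x y. e = {x, y}"
    and edge: "\<And>x y. {x, y} \<in> closure_arcs a T b \<Longrightarrow> x \<in> verts m"
    and mate: "\<And>x. x \<in> verts m \<Longrightarrow> {x, mate_out x} \<in> closure_arcs a T b"
  shows "\<Union>(closure_arcs a T b) = verts m"
proof
  show "\<Union>(closure_arcs a T b) \<subseteq> verts m"
  proof
    fix p assume "p \<in> \<Union>(closure_arcs a T b)"
    then obtain e where e: "e \<in> closure_arcs a T b" "p \<in> e" by blast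
    then obtain x y where "e = {x, y}"
      using outer_arc_pair[of e] T[of e] by (auto simp: closure_arcs_def)
    then have "e = {p, x} \<or> e = {p, y}" using e by auto
    then show "p \<in> verts m" using edge e by metis
  qed
  show "verts m \<subseteq> \<Union>(closure_arcs a T b)" using mate by blast
qed

lemma Union_idE: "\<Union>idE = verts m"
  unfolding id_closure_def
proof (rule closure_arcs_Union)
  show "\<exists>x y. e = {x, y}" if "e \<in> id_tangle m" for e using that unfolding id_tangle_def by auto
qed (simp_all flip: id_closure_def add: idE_edge)

lemma circ_idE_verts: "p \<in> verts m \<Longrightarrow> circ idE p \<subseteq> verts m"
  by (rule circ_least) (use mate_out_verts in \<open>auto simp: idE_edge\<close>)

lemma swap_in_circ_idE: "p \<in> verts m \<Longrightarrow> x \<in> circ idE p \<Longrightarrow> swap_side x \<in> circ idE p"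
proof -
  assume p: "p \<in> verts m" and x: "x \<in> circ idE p"
  have "x \<in> verts m" using circ_idE_verts[OF p] x by (rule subsetD)
  then have "{x, swap_side x} \<in> idE" unfolding idE_edge by simp
  with x show ?thesis by (rule circ_step)
qed

end

locale diagram = matching_pair m a b for m i :: nat and a b :: "nat set set" +
  assumes i: "1 \<le> i" "i + 1 \<le> 2 * m"
begin

definition four :: "(nat + nat) set" where
  "four = {Inl i, Inl (i + 1), Inr i, Inr (i + 1)}"

text \<open>The cup and the cap as an exchange of \<open>i\<close> and \<open>i + 1\<close> on each
  side, meant for the points of \<open>four\<close>; other points receive the default
  \<open>i\<close>.\<close>

definition mate_cap :: "nat + nat \<Rightarrow> nat + nat" where
  "mate_cap = map_sum (\<lambda>k. if k = i then i + 1 else i) (\<lambda>k. if k = i then i + 1 else i)"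

abbreviation "capE \<equiv> closure_arcs a (cupcap m i) b"

lemma swap_four [simp]: "swap_side x \<in> four \<longleftrightarrow> x \<in> four"
  by (cases x) (auto simp: four_def)

lemma capE_edge:
  "{x, y} \<in> capE \<longleftrightarrow>
    x \<in> verts m \<and> (y = mate_out x \<or> (if x \<in> four then y = mate_cap x else y = swap_side x))"
proof (cases x; cases y)
  fix j k assume "x = Inl j" "y = Inl k"
  moreover have "{j, k} = {i, i + 1} \<longleftrightarrow> j \<in> {1..2 * m} \<and> j \<in> {i, i + 1} \<and> k = (if j = i then i + 1 else i)"
    using i by (auto simp: doubleton_eq_iff)
  ultimately show ?thesis
    by (auto simp add: closure_arcs_edge cupcap_edge edge_iff_mate[OF a] mate_out_def mate_cap_def four_def
        simp del: atLeastAtMost_iff)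
next
  fix j k assume "x = Inr j" "y = Inr k"
  moreover have "{j, k} = {i, i + 1} \<longleftrightarrow> j \<in> {1..2 * m} \<and> j \<in> {i, i + 1} \<and> k = (if j = i then i + 1 else i)"
    using i by (auto simp: doubleton_eq_iff)
  ultimately show ?thesis
    by (auto simp add: closure_arcs_edge cupcap_edge edge_iff_mate[OF b] mate_out_def mate_cap_def four_def
        simp del: atLeastAtMost_iff)
next
  fix j k assume "x = Inl j" "y = Inr k"
  then show ?thesis
    by (auto simp add: closure_arcs_edge cupcap_edge mate_out_def mate_cap_def four_def)
next
  fix j k assume *: "x = Inr j" "y = Inl k"
  have "{x, y} = {Inl k, Inr j}" using * by blast
  then show ?thesis using *
    by (auto simp add: closure_arcs_edge cupcap_edge mate_out_def mate_cap_def four_def)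
qed

lemma Union_capE: "\<Union>capE = verts m"
proof (rule closure_arcs_Union)
  show "\<exists>x y. e = {x, y}" if "e \<in> cupcap m i" for e using that unfolding cupcap_def by auto
qed (simp_all add: capE_edge)

lemma circ_idE_four:
  "circ idE (Inr i) = circ idE (Inl i)" "circ idE (Inr (i + 1)) = circ idE (Inl (i + 1))"
  using i by (intro circ_edge_eq; simp add: idE_edge)+

lemma circ_capE_four:
  "circ capE (Inl (i + 1)) = circ capE (Inl i)" "circ capE (Inr (i + 1)) = circ capE (Inr i)"
  using i by (intro circ_edge_eq; simp add: capE_edge four_def mate_cap_def)+

text \<open>The two diagrams differ only in the arcs of the saddle. With these removed, the
  component \<open>P\<close> of \<open>Inl i\<close> is a path between two of the four points,
  contained in the circle through \<open>Inl i\<close> of either diagram. In one diagram an arc of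
  the saddle joins the ends of the path and closes it to a circle that misses the other two points;
  in the other diagram the path shows that its ends share a circle. So the end point
  \<open>v\<close> decides both sides of the equivalence at once.\<close>

lemma surgery: "circ idE (Inl i) = circ idE (Inl (i + 1)) \<longleftrightarrow> circ capE (Inl i) \<noteq> circ capE (Inr i)"
proof -
  \<comment> \<open>The strands at \<open>i\<close> and \<open>i + 1\<close> are cut, so that the
    four saddle points become the fixed points where a walk ends. The colour is parity, inverted on
    the right: then strands as well as outer arcs change it.\<close>
  define stop where "stop x = (if x \<in> four then x else swap_side x)" for x
  define col :: "nat + nat \<Rightarrow> bool" where "col = case_sum even odd"
  have col_mate: "col (mate_out x) \<noteq> col x" if "x \<in> verts m" for x
    using that mate_parity[OF a] mate_parity[OF b]
    by (cases x) (simp_all add: col_def mate_out_def del: atLeastAtMost_iff)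
  have col_swap: "col (swap_side x) \<noteq> col x" for x by (cases x) (simp_all add: col_def)
  obtain P v where P: "Inl i \<in> P" "v \<in> P" "P \<subseteq> verts m" "\<And>x. x \<in> P \<Longrightarrow> mate_out x \<in> P"
      "\<And>x. x \<in> P \<Longrightarrow> stop x \<in> P"
    and v: "col v \<noteq> col (Inl i)" "stop v = v" "\<And>x. x \<in> P \<Longrightarrow> stop x = x \<Longrightarrow> x = Inl i \<or> x = v"
    and least: "\<And>S. Inl i \<in> S \<Longrightarrow> (\<And>x. x \<in> S \<Longrightarrow> mate_out x \<in> S) \<Longrightarrow> (\<And>x. x \<in> S \<Longrightarrow> stop x \<in> S) \<Longrightarrow> P \<subseteq> S"
  proof (rule alternating_walk[of mate_out stop "verts m" col "Inl i"])
    show "finite (verts m)" by (simp add: verts_def)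
    show "stop (stop x) = x" for x by (simp add: stop_def)
    show "stop x \<in> verts m" if "x \<in> verts m" for x using that by (simp add: stop_def)
    show "col (stop x) \<noteq> col x" if "stop x \<noteq> x" for x
    proof -
      have "stop x = swap_side x" using that by (auto simp: stop_def)
      then show ?thesis using col_swap by simp
    qed
    show "Inl i \<in> verts m" using i by simp
    show "stop (Inl i) = Inl i" by (simp add: stop_def four_def)
  qed (use mate_out_verts col_mate in auto)
  have fixed: "stop x = x \<longleftrightarrow> x \<in> four" for x
    by (cases x) (auto simp: stop_def)
  \<comment> \<open>\<open>Inr (i + 1)\<close> has the colour of \<open>Inl i\<close>. This excludes
    the diagonal connection, for which the saddle would be nonorientable.\<close>
  have not_diag: "v \<noteq> Inr (i + 1)" "v \<noteq> Inl i" using v(1) by (auto simp: col_def)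
  have mem_P: "x \<in> P \<longleftrightarrow> x = Inl i \<or> x = v" if "x \<in> four" for x
    using v(3)[of x] P that fixed by auto
  \<comment> \<open>Every move of the walk follows an arc common to both diagrams, so minimality of
    \<open>P\<close> bounds it by a circle of either one.\<close>
  have P_id: "P \<subseteq> circ idE (Inl i)"
  proof (rule least)
    fix x assume x: "x \<in> circ idE (Inl i)"
    then have xv: "x \<in> verts m" using circ_idE_verts[of "Inl i"] i by auto
    show "mate_out x \<in> circ idE (Inl i)" by (rule circ_step[OF x]) (simp add: idE_edge xv)
    show "stop x \<in> circ idE (Inl i)"
      using x swap_in_circ_idE[of "Inl i" x] i by (simp add: stop_def)
  qed simp
  \<comment> \<open>The bound by \<open>verts m\<close> is part of the invariant, since
    \<open>capE_edge\<close> yields arcs only at points known to lie there.\<close>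
  have P_cap: "P \<subseteq> circ capE (Inl i) \<inter> verts m"
  proof (rule least)
    fix x assume x: "x \<in> circ capE (Inl i) \<inter> verts m"
    then have x': "x \<in> circ capE (Inl i)" by simp
    have "mate_out x \<in> circ capE (Inl i)" by (rule circ_step[OF x']) (use x in \<open>simp add: capE_edge\<close>)
    then show "mate_out x \<in> circ capE (Inl i) \<inter> verts m" using mate_out_verts x by simp
    have "stop x \<in> circ capE (Inl i)"
    proof (cases "x \<in> four")
      case False
      have "swap_side x \<in> circ capE (Inl i)"
        by (rule circ_step[OF x']) (use x False in \<open>simp add: capE_edge\<close>)
      then show ?thesis using False by (simp add: stop_def)
    qed (use x in \<open>simp add: stop_def\<close>)
    then show "stop x \<in> circ capE (Inl i) \<inter> verts m" using x by (simp add: stop_def)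
  qed (use i in simp)
  have "v \<in> four" using v(2) fixed by blast
  then consider "v = Inl (i + 1)" | "v = Inr i" using not_diag by (auto simp: four_def)
  then show ?thesis
  proof cases
    case 1
    \<comment> \<open>The cup joins the two ends of the path, so the circle never leaves
      \<open>P\<close> and does not meet the cap.\<close>
    have "circ capE (Inl i) \<subseteq> P"
    proof (rule circ_least[OF P(1)])
      fix x y assume x: "x \<in> P" and "{x, y} \<in> capE"
      then consider "y = mate_out x" | "x \<in> four" "y = mate_cap x" | "x \<notin> four" "y = swap_side x"
        by (auto simp: capE_edge split: if_splits)
      then show "y \<in> P"
      proof cases
        case 2
        then have "x = Inl i \<or> x = Inl (i + 1)" using mem_P x 1 by blast
        then have "y = Inl (i + 1) \<or> y = Inl i" using 2 by (auto simp: mate_cap_def)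
        then show ?thesis using P 1 by auto
      next
        case 3
        then show ?thesis using P(5)[OF x] by (simp add: stop_def)
      qed (use P(4) x in simp)
    qed
    moreover have "Inr i \<notin> P" using mem_P[of "Inr i"] 1 by (simp add: four_def)
    ultimately have "circ capE (Inl i) \<noteq> circ capE (Inr i)" by (metis circ_self subsetD)
    moreover have "circ idE (Inl i) = circ idE (Inl (i + 1))"
      unfolding circ_eq_iff using P_id P(2) 1 by blast
    ultimately show ?thesis by blast
  next
    case 2
    \<comment> \<open>Now the identity strand at \<open>i\<close> joins the two ends, and the circle
      avoids the strand at \<open>i + 1\<close>.\<close>
    have "circ idE (Inl i) \<subseteq> P"
    proof (rule circ_least[OF P(1)])
      fix x y assume x: "x \<in> P" and "{x, y} \<in> idE"
      then consider "y = mate_out x" | "x \<in> four" "y = swap_side x" | "x \<notin> four" "y = swap_side x"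
        by (auto simp: idE_edge)
      then show "y \<in> P"
      proof cases
        case mid: 2
        then have "x = Inl i \<or> x = Inr i" using mem_P x 2 by blast
        then have "y = Inr i \<or> y = Inl i" using mid by auto
        then show ?thesis using P 2 by auto
      next
        case 3
        then show ?thesis using P(5)[OF x] by (simp add: stop_def)
      qed (use P(4) x in simp)
    qed
    moreover have "Inl (i + 1) \<notin> P" using mem_P[of "Inl (i + 1)"] 2 by (simp add: four_def)
    ultimately have "circ idE (Inl i) \<noteq> circ idE (Inl (i + 1))" by (metis circ_self subsetD)
    moreover have "circ capE (Inl i) = circ capE (Inr i)"
      unfolding circ_eq_iff using P_cap P(2) 2 by blast
    ultimately show ?thesis by blast
  qed
qed

section \<open>Circles away from the saddle and circles through it\<close>

lemma far_circles_eq: "far_circles m i a b = {C \<in> circles idE. C \<inter> four = {}}"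
  by (simp add: far_circles_def four_def)

text \<open>The diagrams have the same arcs at every point outside \<open>four\<close>. The
  disjunction permits starting from a circle of either diagram.\<close>

lemma circ_off_four: "circ idE p \<inter> four = {} \<or> circ capE p \<inter> four = {} \<Longrightarrow> circ capE p = circ idE p"
proof (elim disjE)
  have edge: "{x, y} \<in> capE \<longleftrightarrow> {x, y} \<in> idE" if "x \<notin> four" for x y
    using that by (simp add: idE_edge capE_edge)
  show "circ capE p = circ idE p" if far: "circ idE p \<inter> four = {}"
  proof (rule circ_cong)
    fix x y assume "x \<in> circ idE p"
    then show "{x, y} \<in> capE \<longleftrightarrow> {x, y} \<in> idE" using far by (intro edge) blast
  qed
  show "circ capE p = circ idE p" if far: "circ capE p \<inter> four = {}"
  proof (rule circ_cong[symmetric])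
    fix x y assume "x \<in> circ capE p"
    then show "{x, y} \<in> idE \<longleftrightarrow> {x, y} \<in> capE" using far by (intro edge[symmetric]) blast
  qed
qed

lemma far_circles_cap: "far_circles m i a b = {C \<in> circles capE. C \<inter> four = {}}"
proof -
  have "C \<in> circles idE \<longleftrightarrow> C \<in> circles capE" if "C \<inter> four = {}" for C
  proof
    assume "C \<in> circles idE"
    then obtain p where p: "p \<in> verts m" "C = circ idE p" unfolding circles_def Union_idE by (rule imageE)
    then have "C = circ capE p" using circ_off_four[of p] that by simp
    then show "C \<in> circles capE" using p(1) by (simp add: circles_def Union_capE)
  next
    assume "C \<in> circles capE"
    then obtain p where p: "p \<in> verts m" "C = circ capE p" unfolding circles_def Union_capE by (rule imageE)
    then have "C = circ idE p" using circ_off_four[of p] that by simp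
    then show "C \<in> circles idE" using p(1) by (simp add: circles_def Union_idE)
  qed
  then show ?thesis unfolding far_circles_eq by blast
qed

lemma circles_idE:
  "circles idE = insert (circ idE (Inl i)) (insert (circ idE (Inl (i + 1))) (far_circles m i a b))"
proof -
  have "C \<in> {circ idE (Inl i), circ idE (Inl (i + 1))}" if C: "C \<in> circles idE" "C \<inter> four \<noteq> {}" for C
  proof -
    obtain z where z: "z \<in> C" "z \<in> four" using C by blast
    have "C = circ idE z" by (rule circles_eq_circ[OF C(1) z(1)])
    then show ?thesis using \<open>z \<in> four\<close> circ_idE_four by (auto simp: four_def)
  qed
  moreover have "circ idE (Inl i) \<in> circles idE" "circ idE (Inl (i + 1)) \<in> circles idE"
    using i by (auto simp: circles_def Union_idE)
  ultimately show ?thesis unfolding far_circles_eq by blast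
qed

lemma circles_capE:
  "circles capE = insert (circ capE (Inl i)) (insert (circ capE (Inr i)) (far_circles m i a b))"
proof -
  have "C \<in> {circ capE (Inl i), circ capE (Inr i)}" if C: "C \<in> circles capE" "C \<inter> four \<noteq> {}" for C
  proof -
    obtain z where z: "z \<in> C" "z \<in> four" using C by blast
    have "C = circ capE z" by (rule circles_eq_circ[OF C(1) z(1)])
    then show ?thesis using \<open>z \<in> four\<close> circ_capE_four by (auto simp: four_def)
  qed
  moreover have "circ capE (Inl i) \<in> circles capE" "circ capE (Inr i) \<in> circles capE"
    using i by (auto simp: circles_def Union_capE)
  ultimately show ?thesis unfolding far_circles_cap by blast
qed

lemma near_not_far: "z \<in> four \<Longrightarrow> circ E z \<notin> far_circles m i a b"
proof -
  assume "z \<in> four"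
  then have "circ E z \<inter> four \<noteq> {}" using circ_self[of z E] by blast
  then show ?thesis by (simp add: far_circles_eq)
qed

lemma finite_far: "finite (far_circles m i a b)"
proof -
  have "finite (circles idE)" by (simp add: circles_def Union_idE verts_def)
  then show ?thesis by (simp add: far_circles_eq)
qed

lemma arc_imp_single:
  assumes "{i, i + 1} \<in> a \<or> {i, i + 1} \<in> b"
  shows "circ idE (Inl i) = circ idE (Inl (i + 1))"
  using assms
proof
  assume "{i, i + 1} \<in> a"
  then have "{Inl i, Inl (i + 1)} \<in> idE" unfolding id_closure_def closure_arcs_edge by blast
  then show ?thesis by (rule circ_edge_eq)
next
  assume "{i, i + 1} \<in> b"
  then have "{Inr i, Inr (i + 1)} \<in> idE" unfolding id_closure_def closure_arcs_edge by blast
  then show ?thesis using circ_edge_eq circ_idE_four by metis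
qed

end

text \<open>The identity strands join the two copies of every point, so each circle is invariant
  under \<open>swap_side\<close>. The reflection that turns one diagram into the other therefore
  carries every circle to itself.\<close>

lemma (in diagram) far_circles_reflect: "far_circles m i b a = far_circles m i a b"
proof -
  interpret r: diagram m i b a by unfold_locales (use i a b in auto)
  have mate: "r.mate_out x = swap_side (mate_out (swap_side x))" for x
    by (cases x) (simp_all add: mate_out_def r.mate_out_def)
  have "circ r.idE p = circ idE p" if p: "p \<in> verts m" for p
  proof
    show "circ r.idE p \<subseteq> circ idE p"
    proof (rule circ_least)
      fix x y assume x: "x \<in> circ idE p" and "{x, y} \<in> r.idE"
      then consider "y = swap_side (mate_out (swap_side x))" | "y = swap_side x"
        by (auto simp: r.idE_edge mate)
      then show "y \<in> circ idE p"
      proof cases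
        case 1
        have sx: "swap_side x \<in> circ idE p" using swap_in_circ_idE p x by blast
        then have "{swap_side x, mate_out (swap_side x)} \<in> idE"
          using circ_idE_verts[OF p] x by (auto simp: idE_edge)
        then show ?thesis using 1 swap_in_circ_idE p circ_step[OF sx] by blast
      qed (use swap_in_circ_idE p x in blast)
    qed simp
    show "circ idE p \<subseteq> circ r.idE p"
    proof (rule circ_least)
      fix x y assume x: "x \<in> circ r.idE p" and "{x, y} \<in> idE"
      then consider "y = swap_side (r.mate_out (swap_side x))" | "y = swap_side x"
        by (auto simp: idE_edge mate)
      then show "y \<in> circ r.idE p"
      proof cases
        case 1
        have sx: "swap_side x \<in> circ r.idE p" using r.swap_in_circ_idE p x by blast
        then have "{swap_side x, r.mate_out (swap_side x)} \<in> r.idE"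
          using r.circ_idE_verts[OF p] x by (auto simp: r.idE_edge)
        then show ?thesis using 1 r.swap_in_circ_idE p circ_step[OF sx] by blast
      qed (use r.swap_in_circ_idE p x in blast)
    qed simp
  qed
  then have "circles r.idE = circles idE"
    unfolding circles_def Union_idE r.Union_idE by (rule image_cong[OF refl])
  then show ?thesis by (simp add: far_circles_eq r.far_circles_eq r.four_def four_def)
qed

section \<open>Deleting an arc\<close>

lemma inj_skip: "inj (skip i)"
  by (auto simp: inj_def skip_def split: if_splits)

lemma skip_eq_iff [simp]: "skip i j = skip i k \<longleftrightarrow> j = k"
  using inj_skip by (simp add: inj_eq)

lemma skip_less_iff: "skip i j < skip i k \<longleftrightarrow> j < k"
  by (auto simp: skip_def)

lemma skip_neq: "skip i k \<noteq> i" "skip i k \<noteq> i + 1"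
  by (auto simp: skip_def)

lemma skip_surj: "l \<notin> {i, i + 1} \<Longrightarrow> \<exists>k. l = skip i k"
  by (rule exI[of _ "if l < i then l else l - 2"]) (auto simp: skip_def)

lemma skip_range:
  "1 \<le> i \<Longrightarrow> i + 1 \<le> 2 * m \<Longrightarrow> skip i k \<in> {1..2 * m} \<longleftrightarrow> k \<in> {1..2 * (m - 1)}"
  by (auto simp: skip_def)

lemma inj_image_fun: "inj f \<Longrightarrow> inj (image f)"
  by (rule injI) (simp add: inj_image_eq_iff)

lemma ex_eq_map_sum:
  "(\<exists>y. Inl k = map_sum f g y \<and> R y) \<longleftrightarrow> (\<exists>k'. k = f k' \<and> R (Inl k'))"
  "(\<exists>y. Inr k = map_sum f g y \<and> R y) \<longleftrightarrow> (\<exists>k'. k = g k' \<and> R (Inr k'))"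
  unfolding split_sum_ex by simp_all

lemma delete_arc_iff: "{j, k} \<in> delete_arc i a \<longleftrightarrow> {skip i j, skip i k} \<in> a"
  by (simp add: delete_arc_def)

definition insert_arc :: "nat \<Rightarrow> nat set set \<Rightarrow> nat set set" where
  "insert_arc i a = insert {i, i + 1} (image (skip i) ` a)"

lemma insert_arc_iff:
  assumes a: "a \<in> CM m"
  shows "{k, l} \<in> insert_arc i a \<longleftrightarrow>
    {k, l} = {i, i + 1} \<or> (\<exists>k' l'. k = skip i k' \<and> l = skip i l' \<and> {k', l'} \<in> a)"
proof -
  have "(\<exists>k' l'. k = skip i k' \<and> l = skip i l' \<and> {k', l'} \<in> a)" if im: "{k, l} \<in> image (skip i) ` a"
  proof -
    obtain e where e: "e \<in> a" "{k, l} = skip i ` e" using im by (rule imageE) simp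
    obtain k' l' where kl: "e = {k', l'}" using CM_pair[OF a e(1)] by blast
    then have "{k, l} = {skip i k', skip i l'}" using e by simp
    then consider "k = skip i k'" "l = skip i l'" | "k = skip i l'" "l = skip i k'"
      by (auto simp: doubleton_eq_iff)
    then show ?thesis using e(1) kl by cases (auto simp: insert_commute)
  qed
  moreover have "{k, l} \<in> image (skip i) ` a" if "k = skip i k'" "l = skip i l'" "{k', l'} \<in> a" for k' l'
    using that by (intro image_eqI[of _ _ "{k', l'}"]) simp_all
  ultimately show ?thesis unfolding insert_arc_def by auto
qed

context
  fixes m i :: nat
  assumes i: "1 \<le> i" "i + 1 \<le> 2 * m"
begin

text \<open>The points \<open>i\<close> and \<open>i + 1\<close> are taken by each other, so every
  other arc has both ends in the range of \<open>skip i\<close>.\<close>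

lemma CM'_skip:
  assumes a: "a \<in> CM' m i" and kl: "{skip i k, l} \<in> a"
  shows "\<exists>l'. l = skip i l'"
proof (rule skip_surj)
  have a': "a \<in> CM m" "{i, i + 1} \<in> a" "{i + 1, i} \<in> a"
    using a by (simp_all add: CM'_def insert_commute)
  have kl': "{l, skip i k} \<in> a" using kl by (simp add: insert_commute)
  have "l \<noteq> i" using CM_unique[OF a'(1), of i "i + 1" "skip i k"] kl' a'(2) skip_neq(2)[of i k] by metis
  moreover have "l \<noteq> i + 1" using CM_unique[OF a'(1), of "i + 1" i "skip i k"] kl' a'(3) skip_neq(1)[of i k] by metis
  ultimately show "l \<notin> {i, i + 1}" by simp
qed

lemma delete_arc_CM:
  assumes a: "a \<in> CM' m i" shows "delete_arc i a \<in> CM (m - 1)"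
  unfolding CM_iff
proof (intro conjI allI ballI impI)
  have a': "a \<in> CM m" using a by (simp add: CM'_def)
  show "\<exists>k l. e = {k, l} \<and> k \<noteq> l" if "e \<in> delete_arc i a" for e
  proof -
    have "skip i ` e \<in> a" using that by (simp add: delete_arc_def)
    then obtain k l where kl: "skip i ` e = {k, l}" "k \<noteq> l" using CM_pair[OF a'] by blast
    then have "k \<in> skip i ` e" "l \<in> skip i ` e" by simp_all
    then obtain k' l' where k'l': "k = skip i k'" "l = skip i l'" by (elim imageE)
    then have "skip i ` e = skip i ` {k', l'}" "k' \<noteq> l'" using kl by auto
    then have "e = {k', l'}" using inj_image_eq_iff[OF inj_skip[of i], of e "{k', l'}"] by blast
    then show ?thesis using \<open>k' \<noteq> l'\<close> by (intro exI conjI)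
  qed
  show "k \<in> {1..2 * (m - 1)}" if "{k, l} \<in> delete_arc i a" for k l
    using that CM_range(1)[OF a', of "skip i k" "skip i l"] skip_range[OF i, of k]
    by (simp only: delete_arc_iff)
  show "l \<in> {1..2 * (m - 1)}" if "{k, l} \<in> delete_arc i a" for k l
    using that CM_range(2)[OF a', of "skip i k" "skip i l"] skip_range[OF i, of l]
    by (simp only: delete_arc_iff)
  show "\<exists>l. {k, l} \<in> delete_arc i a" if k: "k \<in> {1..2 * (m - 1)}" for k
  proof -
    have "skip i k \<in> {1..2 * m}" using k skip_range[OF i] by blast
    then obtain l where l: "{skip i k, l} \<in> a" using CM_cover[OF a'] by blast
    then obtain l' where "l = skip i l'" using CM'_skip[OF a] by blast
    then show ?thesis using l by (auto simp: delete_arc_iff)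
  qed
  show "l = l'" if "{k, l} \<in> delete_arc i a" "{k, l'} \<in> delete_arc i a" for k l l'
    using that CM_unique[OF a', of "skip i k" "skip i l" "skip i l'"] by (simp add: delete_arc_iff)
  show False if "p < q" "q < r" "r < s" "{p, r} \<in> delete_arc i a" "{q, s} \<in> delete_arc i a" for p q r s
    using that CM_planar[OF a', of "skip i p" "skip i q" "skip i r" "skip i s"]
    by (simp add: delete_arc_iff skip_less_iff)
qed

lemma insert_arc_CM':
  assumes a: "a \<in> CM (m - 1)" shows "insert_arc i a \<in> CM' m i"
proof -
  note iff = insert_arc_iff[OF a]
  have "insert_arc i a \<in> CM m"
    unfolding CM_iff
  proof (intro conjI allI ballI impI)
    show "\<exists>k l. e = {k, l} \<and> k \<noteq> l" if "e \<in> insert_arc i a" for e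
    proof -
      consider "e = {i, i + 1}" | e' where "e' \<in> a" "e = skip i ` e'" using \<open>e \<in> insert_arc i a\<close> unfolding insert_arc_def by blast
      then show ?thesis
      proof cases
        case 1 then show ?thesis by (intro exI[of _ i] exI[of _ "i + 1"]) simp
      next
        case 2
        then obtain k l where "e' = {k, l}" "k \<noteq> l" using CM_pair[OF a] by blast
        then show ?thesis using 2 by (intro exI[of _ "skip i k"] exI[of _ "skip i l"]) simp
      qed
    qed
    have range: "k \<in> {1..2 * m}" if "{k, l} \<in> insert_arc i a" for k l
      using that unfolding iff
    proof (elim disjE exE conjE)
      assume "{k, l} = {i, i + 1}" then show ?thesis using i by (auto simp: doubleton_eq_iff)
    next
      fix k' l' assume "k = skip i k'" "{k', l'} \<in> a"
      then show ?thesis using CM_range(1)[OF a] skip_range[OF i] by blast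
    qed
    then show "k \<in> {1..2 * m}" if "{k, l} \<in> insert_arc i a" for k l using that .
    show "l \<in> {1..2 * m}" if "{k, l} \<in> insert_arc i a" for k l
      using that range[of l k] by (simp add: insert_commute)
    show "\<exists>l. {k, l} \<in> insert_arc i a" if k: "k \<in> {1..2 * m}" for k
    proof (cases "k \<in> {i, i + 1}")
      case True
      then show ?thesis unfolding iff by (metis insert_commute insert_iff singletonD)
    next
      case False
      then obtain k' where k': "k = skip i k'" using skip_surj by blast
      then have "k' \<in> {1..2 * (m - 1)}" using k skip_range[OF i] by blast
      then obtain l' where "{k', l'} \<in> a" using CM_cover[OF a] by blast
      then show ?thesis using k' unfolding iff by blast
    qed
    show "l = l'" if kl: "{k, l} \<in> insert_arc i a" "{k, l'} \<in> insert_arc i a" for k l l'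
    proof (cases "k \<in> {i, i + 1}")
      case True
      then have "\<And>k'. k \<noteq> skip i k'" using skip_neq[of i] by (metis insert_iff singletonD)
      then have "{k, l} = {i, i + 1}" "{k, l'} = {i, i + 1}" using kl unfolding iff by blast+
      then show ?thesis by (metis doubleton_eq_iff)
    next
      case False
      then have "{k, l} \<noteq> {i, i + 1}" "{k, l'} \<noteq> {i, i + 1}" by blast+
      then obtain k1 l1 k2 l2 where "k = skip i k1" "l = skip i l1" "{k1, l1} \<in> a"
          "k = skip i k2" "l' = skip i l2" "{k2, l2} \<in> a"
        using kl unfolding iff by blast
      then show ?thesis using CM_unique[OF a] by simp
    qed
    show False if lt: "p < q" "q < r" "r < s" and pr: "{p, r} \<in> insert_arc i a" and qs: "{q, s} \<in> insert_arc i a" for p q r s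
    proof -
      \<comment> \<open>Crossing arcs have a point strictly between their ends, and the new arc
        joins neighbours. The remaining arcs cross only if they did before, since
        \<open>skip i\<close> is increasing.\<close>
      have "{p, r} \<noteq> {i, i + 1}" "{q, s} \<noteq> {i, i + 1}" using lt by (auto simp: doubleton_eq_iff)
      then obtain p' r' q' s' where *: "p = skip i p'" "r = skip i r'" "{p', r'} \<in> a"
          "q = skip i q'" "s = skip i s'" "{q', s'} \<in> a"
        using pr qs unfolding iff by blast
      then show False using lt CM_planar[OF a, of p' q' r' s'] by (simp add: skip_less_iff)
    qed
  qed
  then show ?thesis by (simp add: CM'_def insert_arc_def)
qed

lemma delete_arc_bij: "bij_betw (delete_arc i) (CM' m i) (CM (m - 1))"
proof (rule bij_betw_byWitness[where f' = "insert_arc i"])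
  show "\<forall>a\<in>CM' m i. insert_arc i (delete_arc i a) = a"
  proof
    fix a assume a: "a \<in> CM' m i"
    then have a': "a \<in> CM m" "{i, i + 1} \<in> a" by (simp_all add: CM'_def)
    have "e \<in> insert_arc i (delete_arc i a)" if e: "e \<in> a" for e
    proof (cases "e = {i, i + 1}")
      case False
      obtain k l where kl: "e = {k, l}" using CM_pair[OF a'(1) e] by blast
      have "k \<notin> {i, i + 1}"
      proof
        assume "k \<in> {i, i + 1}"
        then have "{k, (if k = i then i + 1 else i)} = {i, i + 1}" by auto
        then show False using CM_unique[OF a'(1), of k l] kl e a'(2) False by metis
      qed
      then obtain k' where k': "k = skip i k'" using skip_surj by blast
      then obtain l' where l': "l = skip i l'" using CM'_skip[OF a] e kl by blast
      have "{k', l'} \<in> delete_arc i a" using e kl k' l' by (simp add: delete_arc_iff)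
      then have "skip i ` {k', l'} \<in> image (skip i) ` delete_arc i a" by (rule imageI)
      then show ?thesis using kl k' l' by (simp add: insert_arc_def)
    qed (simp add: insert_arc_def)
    moreover have "e \<in> a" if "e \<in> insert_arc i (delete_arc i a)" for e
      using that a'(2) by (auto simp: insert_arc_def delete_arc_def)
    ultimately show "insert_arc i (delete_arc i a) = a" by blast
  qed
  show "\<forall>a\<in>CM (m - 1). delete_arc i (insert_arc i a) = a"
  proof
    fix a assume a: "a \<in> CM (m - 1)"
    have "skip i ` e \<in> insert_arc i a \<longleftrightarrow> e \<in> a" for e
    proof -
      have "skip i ` e \<noteq> {i, i + 1}" using skip_neq[of i] by (metis imageE insertI1)
      moreover have "skip i ` e \<in> image (skip i) ` a \<longleftrightarrow> e \<in> a"
        by (rule inj_image_mem_iff[OF inj_image_fun[OF inj_skip]])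
      ultimately show ?thesis by (simp add: insert_arc_def)
    qed
    then show "delete_arc i (insert_arc i a) = a" by (simp add: delete_arc_def)
  qed
qed (use delete_arc_CM insert_arc_CM' in auto)

end

context diagram
begin

abbreviation "skip2 \<equiv> map_sum (skip i) (skip i)"

lemma skip2_not_four: "skip2 x \<notin> four"
  using skip_neq[of i] by (cases x) (simp_all add: four_def)

lemma skip2_surj: "x \<notin> four \<Longrightarrow> \<exists>y. x = skip2 y"
proof (cases x)
  fix k assume "x \<notin> four" "x = Inl k"
  then obtain k' where "k = skip i k'" using skip_surj[of k i] by (auto simp: four_def)
  then show ?thesis using \<open>x = Inl k\<close> by (intro exI[of _ "Inl k'"]) simp
next
  fix k assume "x \<notin> four" "x = Inr k"
  then obtain k' where "k = skip i k'" using skip_surj[of k i] by (auto simp: four_def)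
  then show ?thesis using \<open>x = Inr k\<close> by (intro exI[of _ "Inr k'"]) simp
qed

lemma skip2_verts: "skip2 x \<in> verts m \<longleftrightarrow> x \<in> verts (m - 1)"
  using skip_range[OF i] by (cases x) (simp_all del: atLeastAtMost_iff)

lemma inj_skip2: "inj skip2"
proof (rule injI)
  fix x y assume "skip2 x = skip2 y" then show "x = y" by (cases x; cases y) simp_all
qed

text \<open>With the arc present on both sides the four points form a circle of their own, and by
  \<open>CM'_skip\<close> the renumbering carries the smaller diagram onto the rest, arcs to arcs.
  This is why the pairs in \<open>CM' m i \<times> CM' m i\<close> contribute the smaller arc
  ring.\<close>

lemma far_circles_delete:
  assumes "{i, i + 1} \<in> a" "{i, i + 1} \<in> b"
  shows "bij_betw (image skip2) (circles (id_closure (m - 1) (delete_arc i a) (delete_arc i b)))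
    (far_circles m i a b)"
proof -
  have aC: "a \<in> CM' m i" and bC: "b \<in> CM' m i" using assms a b by (simp_all add: CM'_def)
  interpret d: matching_pair "m - 1" "delete_arc i a" "delete_arc i b"
    by unfold_locales (use delete_arc_CM[OF i] aC bC in auto)
  have edge: "{skip2 x, y} \<in> idE \<longleftrightarrow> (\<exists>y'. y = skip2 y' \<and> {x, y'} \<in> d.idE)" for x y
  proof -
    have la: "{skip i j, k} \<in> a \<longleftrightarrow> (\<exists>k'. k = skip i k' \<and> {j, k'} \<in> delete_arc i a)" for j k
      using CM'_skip[OF i aC] unfolding delete_arc_iff by blast
    have lb: "{skip i j, k} \<in> b \<longleftrightarrow> (\<exists>k'. k = skip i k' \<and> {j, k'} \<in> delete_arc i b)" for j k
      using CM'_skip[OF i bC] unfolding delete_arc_iff by blast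
    have flip: "{Inr j, Inl k} = {Inl k, Inr j}" for j k :: nat by blast
    show ?thesis
    proof (cases x; cases y)
      fix j k assume xy: "x = Inl j" "y = Inl k"
      show ?thesis
        unfolding xy ex_eq_map_sum map_sum.simps id_closure_def closure_arcs_edge la by (simp add: id_tangle_edge)
    next
      fix j k assume xy: "x = Inr j" "y = Inr k"
      show ?thesis
        unfolding xy ex_eq_map_sum map_sum.simps id_closure_def closure_arcs_edge lb by (simp add: id_tangle_edge)
    next
      fix j k assume xy: "x = Inl j" "y = Inr k"
      show ?thesis
        unfolding xy ex_eq_map_sum map_sum.simps id_closure_def closure_arcs_edge id_tangle_edge
        using skip_range[OF i, of j] by blast
    next
      fix j k assume xy: "x = Inr j" "y = Inl k"
      show ?thesis
        unfolding xy ex_eq_map_sum map_sum.simps id_closure_def flip closure_arcs_edge id_tangle_edge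
        using skip_range[OF i, of j] by blast
    qed
  qed
  have circ: "circ idE (skip2 p) = skip2 ` circ d.idE p" for p
    by (rule circ_image) (rule edge)
  have "image skip2 ` circles d.idE = far_circles m i a b"
  proof
    show "image skip2 ` circles d.idE \<subseteq> far_circles m i a b"
    proof (rule image_subsetI)
      fix D assume "D \<in> circles d.idE"
      then obtain p where p: "p \<in> verts (m - 1)" "D = circ d.idE p"
        unfolding circles_def d.Union_idE by (rule imageE)
      then have "skip2 ` D \<in> circles idE"
        unfolding circles_def Union_idE circ[symmetric] p(2) using skip2_verts by blast
      moreover have "skip2 ` D \<inter> four = {}" using skip2_not_four by blast
      ultimately show "skip2 ` D \<in> far_circles m i a b" by (simp add: far_circles_eq)
    qed
    show "far_circles m i a b \<subseteq> image skip2 ` circles d.idE"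
    proof
      fix C assume "C \<in> far_circles m i a b"
      then have C: "C \<in> circles idE" "C \<inter> four = {}" by (simp_all add: far_circles_eq)
      obtain p where p: "p \<in> verts m" "C = circ idE p"
        using C(1) unfolding circles_def Union_idE by (rule imageE)
      have "p \<notin> four" using C(2) circ_self[of p idE] p(2) by blast
      then obtain q where q: "p = skip2 q" using skip2_surj by blast
      then have "q \<in> verts (m - 1)" using p skip2_verts by simp
      then have "circ d.idE q \<in> circles d.idE" unfolding circles_def d.Union_idE by (rule imageI)
      then show "C \<in> image skip2 ` circles d.idE" unfolding p(2) q circ by (rule imageI)
    qed
  qed
  moreover have "inj_on (image skip2) (circles d.idE)"
    using inj_on_subset[OF inj_image_fun[OF inj_skip2]] by simp
  ultimately show ?thesis by (simp add: bij_betw_def)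
qed

end

section \<open>The decomposition\<close>

lemma bij_betw_Sigma_map:
  assumes \<kappa>: "bij_betw \<kappa> I J" and \<rho>: "\<And>i. i \<in> I \<Longrightarrow> bij_betw (\<rho> i) (F i) (G (\<kappa> i))"
  shows "bij_betw (\<lambda>(i, x). (\<kappa> i, \<rho> i x)) (Sigma I F) (Sigma J G)"
  unfolding bij_betw_def
proof
  show "inj_on (\<lambda>(i, x). (\<kappa> i, \<rho> i x)) (Sigma I F)"
  proof (rule inj_onI, clarify)
    fix i x j y assume *: "i \<in> I" "x \<in> F i" "j \<in> I" "y \<in> F j" "\<kappa> i = \<kappa> j" "\<rho> i x = \<rho> j y"
    then have "i = j" using \<kappa> by (metis bij_betw_def inj_on_def)
    then show "i = j \<and> x = y" using \<rho>[of i] * by (metis bij_betw_def inj_on_def)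
  qed
  show "(\<lambda>(i, x). (\<kappa> i, \<rho> i x)) ` Sigma I F = Sigma J G"
  proof
    show "(\<lambda>(i, x). (\<kappa> i, \<rho> i x)) ` Sigma I F \<subseteq> Sigma J G"
      using \<kappa> \<rho> by (auto dest: bij_betwE)
    show "Sigma J G \<subseteq> (\<lambda>(i, x). (\<kappa> i, \<rho> i x)) ` Sigma I F"
    proof clarify
      fix j y assume "j \<in> J" and y: "y \<in> G j"
      then obtain i where i: "i \<in> I" "j = \<kappa> i" using \<kappa> unfolding bij_betw_def by blast
      then obtain x where "x \<in> F i" "y = \<rho> i x" using \<rho>[of i] y unfolding bij_betw_def by blast
      then show "(j, y) \<in> (\<lambda>(i, x). (\<kappa> i, \<rho> i x)) ` Sigma I F"
        using i by (intro image_eqI[of _ _ "(i, x)"]) auto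
    qed
  qed
qed

lemma bij_betw_Sigma_split:
  assumes "\<And>i. i \<in> I \<Longrightarrow> bij_betw (\<lambda>l. (\<rho> i l, \<sigma> i l)) (F i) (G i \<times> U)"
  shows "bij_betw (\<lambda>(i, l). ((i, \<rho> i l), \<sigma> i l)) (Sigma I F) (Sigma I G \<times> U)"
proof -
  have "bij_betw (\<lambda>(i, l). (i, (\<rho> i l, \<sigma> i l))) (Sigma I F) (Sigma I (\<lambda>i. G i \<times> U))"
    using bij_betw_Sigma_map[of id I I "\<lambda>i l. (\<rho> i l, \<sigma> i l)" F "\<lambda>i. G i \<times> U"] assms by simp
  moreover have "bij_betw (\<lambda>(i, (x, u)). ((i, x), u)) (Sigma I (\<lambda>i. G i \<times> U)) (Sigma I G \<times> U)"
    by (rule bij_betw_byWitness[where f' = "\<lambda>((i, x), u). (i, (x, u))"]) auto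
  ultimately have "bij_betw ((\<lambda>(i, (x, u)). ((i, x), u)) \<circ> (\<lambda>(i, l). (i, (\<rho> i l, \<sigma> i l)))) (Sigma I F) (Sigma I G \<times> U)"
    by (rule bij_betw_trans)
  then show ?thesis by (simp add: comp_def case_prod_unfold)
qed

lemma bij_betw_PiE_reindex:
  assumes "bij_betw g S T"
  shows "bij_betw (\<lambda>l. \<lambda>x\<in>S. l (g x)) (T \<rightarrow>\<^sub>E U) (S \<rightarrow>\<^sub>E U)"
proof (rule bij_betw_byWitness[where f' = "\<lambda>l. \<lambda>y\<in>T. l (inv_into S g y)"])
  have g: "g x \<in> T" if "x \<in> S" for x using assms that by (rule bij_betw_apply)
  have ginv: "inv_into S g y \<in> S" if "y \<in> T" for y
    using assms that by (metis bij_betw_def inv_into_into)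
  show "\<forall>l\<in>T \<rightarrow>\<^sub>E U. (\<lambda>y\<in>T. (\<lambda>x\<in>S. l (g x)) (inv_into S g y)) = l"
    using ginv bij_betw_inv_into_right[OF assms] by (auto simp: fun_eq_iff PiE_def extensional_def)
  show "\<forall>l\<in>S \<rightarrow>\<^sub>E U. (\<lambda>x\<in>S. (\<lambda>y\<in>T. l (inv_into S g y)) (g x)) = l"
    using g bij_betw_inv_into_left[OF assms] by (auto simp: fun_eq_iff PiE_def extensional_def)
qed (use bij_betw_apply[OF assms] bij_betw_apply[OF bij_betw_inv_into[OF assms]] in \<open>auto simp: PiE_iff\<close>)

lemma bij_betw_PiE_insert:
  assumes "x \<notin> S"
  shows "bij_betw (\<lambda>l. (restrict l S, l x)) (insert x S \<rightarrow>\<^sub>E UNIV) ((S \<rightarrow>\<^sub>E UNIV) \<times> UNIV)"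
proof (rule bij_betw_byWitness[where f' = "\<lambda>(l, v). l(x := v)"])
  show "\<forall>l\<in>insert x S \<rightarrow>\<^sub>E UNIV. (\<lambda>(l, v). l(x := v)) (restrict l S, l x) = l"
    by (auto simp: fun_eq_iff PiE_def extensional_def)
  show "\<forall>lv\<in>(S \<rightarrow>\<^sub>E UNIV) \<times> UNIV. (restrict ((\<lambda>(l, v). l(x := v)) lv) S, (\<lambda>(l, v). l(x := v)) lv x) = lv"
    using assms by (auto simp: fun_eq_iff PiE_def extensional_def)
qed (auto simp: PiE_def extensional_def)

lemma bij_betw_PiE_insert2:
  assumes "x \<notin> S" "y \<notin> S" "x \<noteq> y"
  shows "bij_betw (\<lambda>l. (restrict l S, l x, l y)) (insert x (insert y S) \<rightarrow>\<^sub>E UNIV) ((S \<rightarrow>\<^sub>E UNIV) \<times> UNIV)"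
proof (rule bij_betw_byWitness[where f' = "\<lambda>(l, v, w). l(x := v, y := w)"])
  show "\<forall>l\<in>insert x (insert y S) \<rightarrow>\<^sub>E UNIV. (\<lambda>(l, v, w). l(x := v, y := w)) (restrict l S, l x, l y) = l"
    using assms by (auto simp: fun_eq_iff PiE_def extensional_def)
  show "\<forall>lv\<in>(S \<rightarrow>\<^sub>E UNIV) \<times> UNIV. (restrict ((\<lambda>(l, v, w). l(x := v, y := w)) lv) S,
      (\<lambda>(l, v, w). l(x := v, y := w)) lv x, (\<lambda>(l, v, w). l(x := v, y := w)) lv y) = lv"
    using assms by (auto simp: fun_eq_iff PiE_def extensional_def)
qed (auto simp: PiE_def extensional_def)

lemma bij_betw_inj_comp: "bij_betw f A B \<Longrightarrow> inj g \<Longrightarrow> bij_betw (\<lambda>x. g (f x)) A (g ` B)"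
  using bij_betw_trans[of f A B g "g ` B"] inj_on_imp_bij_betw[of g B] inj_on_subset[of g UNIV B]
  by (simp add: comp_def)

section \<open>The summands and the pairs of matchings that index them\<close>

definition first_four :: "nat \<Rightarrow> nat \<Rightarrow> kh_gen4 graded" where
  "first_four m i = arcH (m - 1) \<oplus>\<^sub>g arcHbar m i \<oplus>\<^sub>g arcHbar m i \<oplus>\<^sub>g arcH1 m i"

definition two_circle_pairs :: "nat \<Rightarrow> nat \<Rightarrow> (nat set set \<times> nat set set) set" where
  "two_circle_pairs m i = CM'' m i \<times> CM'' m i - single_circle m i"

abbreviation far_labels :: "nat \<Rightarrow> nat \<Rightarrow> nat set set \<times> nat set set \<Rightarrow> label set" where
  "far_labels m i \<equiv> \<lambda>(a, b). far_circles m i a b \<rightarrow>\<^sub>E UNIV"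

lemma gbasis_arcH2: "gbasis (arcH2 m i) = Sigma (two_circle_pairs m i) (far_labels m i)"
  by (auto simp: arcH2_def TF'_def two_circle_pairs_def)

text \<open>By \<open>arc_imp_single\<close>, two different circles force both matchings into
  \<open>CM'' m i\<close>, so the circles alone decide to which kind a pair belongs.\<close>

lemma (in diagram) two_circle_pairs_iff:
  "(a, b) \<in> two_circle_pairs m i \<longleftrightarrow> circ idE (Inl i) \<noteq> circ idE (Inl (i + 1))"
  using arc_imp_single a b by (auto simp: two_circle_pairs_def single_circle_def CM''_def CM'_def)

context
  fixes m i :: nat
  assumes i: "1 \<le> i" "i + 1 \<le> 2 * m"
begin

lemma diagramI: "a \<in> CM m \<Longrightarrow> b \<in> CM m \<Longrightarrow> diagram m i a b"
  using i by unfold_locales auto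

text \<open>Only labels of circles away from the saddle are read; when an arc is deleted on both
  sides, \<open>far_circles_delete\<close> ensures this for the transported circles. Hence
  relabelling the circles through the saddle leaves this part alone.\<close>

lemma first_four_part_restrict:
  assumes "a \<in> CM m" "b \<in> CM m" and eq: "\<And>C. C \<in> far_circles m i a b \<Longrightarrow> l C = l' C"
  shows "first_four_part m i a b l = first_four_part m i a b l'"
proof -
  interpret diagram m i a b using assms by (intro diagramI)
  have r: "restrict l (far_circles m i a b) = restrict l' (far_circles m i a b)"
    using eq by (rule restrict_ext)
  have "(\<lambda>C\<in>circles (id_closure (m - 1) (delete_arc i a) (delete_arc i b)). l (map_sum (skip i) (skip i) ` C)) =
        (\<lambda>C\<in>circles (id_closure (m - 1) (delete_arc i a) (delete_arc i b)). l' (map_sum (skip i) (skip i) ` C))"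
    if "a \<in> CM' m i" "b \<in> CM' m i"
    using that by (intro restrict_ext eq bij_betw_apply[OF far_circles_delete]) (simp_all add: CM'_def)
  then show ?thesis
    by (cases "a \<in> CM' m i"; cases "b \<in> CM' m i") (simp_all add: first_four_part_def Let_def r)
qed

text \<open>The pairs fall into four classes according to whether \<open>a\<close> and
  \<open>b\<close> contain the arc \<open>{i, i + 1}\<close>. Each class is mapped bijectively onto
  its own summand, and the disjoint pieces are put together at the end.\<close>

lemma first_four_part_bij:
  "bij_betw (\<lambda>((a, b), l). first_four_part m i a b l)
    (Sigma (CM m \<times> CM m - two_circle_pairs m i) (far_labels m i)) (gbasis (first_four m i))"
proof -
  let ?f = "\<lambda>((a, b), l). first_four_part m i a b l"
  let ?S = "\<lambda>I. Sigma I (far_labels m i)"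
  have CM: "a \<in> CM m" if "a \<in> CM' m i \<or> a \<in> CM'' m i" for a
    using that by (auto simp: CM'_def CM''_def)
  have not: "a \<notin> CM' m i" if "a \<in> CM'' m i" for a
    using that by (simp add: CM''_def)
  have restrict: "restrict l (far_circles m i a b) = l" if "l \<in> far_circles m i a b \<rightarrow>\<^sub>E UNIV" for a b and l :: label
    using that by (simp add: PiE_restrict)
  have "bij_betw (\<lambda>(ab, l). Inl (case ab of (a, b) \<Rightarrow> (delete_arc i a, delete_arc i b),
      case ab of (a, b) \<Rightarrow> \<lambda>C\<in>circles (id_closure (m - 1) (delete_arc i a) (delete_arc i b)). l (map_sum (skip i) (skip i) ` C)))
    (?S (CM' m i \<times> CM' m i)) (Inl ` gbasis (arcH (m - 1)) :: kh_gen4 set)"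
  proof -
    have "bij_betw (\<lambda>(ab, l). (case ab of (a, b) \<Rightarrow> (delete_arc i a, delete_arc i b),
        case ab of (a, b) \<Rightarrow> \<lambda>C\<in>circles (id_closure (m - 1) (delete_arc i a) (delete_arc i b)). l (map_sum (skip i) (skip i) ` C)))
      (?S (CM' m i \<times> CM' m i)) (Sigma (CM (m - 1) \<times> CM (m - 1)) (\<lambda>(a, b). circles (id_closure (m - 1) a b) \<rightarrow>\<^sub>E UNIV))"
    proof (rule bij_betw_Sigma_map)
      show "bij_betw (\<lambda>(a, b). (delete_arc i a, delete_arc i b)) (CM' m i \<times> CM' m i) (CM (m - 1) \<times> CM (m - 1))"
        using bij_betw_map_prod[OF delete_arc_bij[OF i] delete_arc_bij[OF i]] by (simp add: map_prod_def)
      fix ab assume "ab \<in> CM' m i \<times> CM' m i"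
      then obtain a b where ab: "ab = (a, b)" "a \<in> CM' m i" "b \<in> CM' m i" by blast
      interpret diagram m i a b using ab CM by (intro diagramI) auto
      show "bij_betw (\<lambda>l. case ab of (a, b) \<Rightarrow> \<lambda>C\<in>circles (id_closure (m - 1) (delete_arc i a) (delete_arc i b)). l (map_sum (skip i) (skip i) ` C))
        (far_labels m i ab) (case (case ab of (a, b) \<Rightarrow> (delete_arc i a, delete_arc i b)) of (a, b) \<Rightarrow> circles (id_closure (m - 1) a b) \<rightarrow>\<^sub>E UNIV)"
        unfolding ab(1) prod.case
        by (rule bij_betw_PiE_reindex[OF far_circles_delete]) (use ab in \<open>simp_all add: CM'_def\<close>)
    qed
    moreover have "gbasis (arcH (m - 1)) = Sigma (CM (m - 1) \<times> CM (m - 1)) (\<lambda>(a, b). circles (id_closure (m - 1) a b) \<rightarrow>\<^sub>E UNIV)"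
      by (auto simp: arcH_def Kh_flat_def id_closure_def)
    ultimately show ?thesis using bij_betw_inj_comp[OF _ inj_Inl] by (simp add: case_prod_unfold)
  qed
  then have 1: "bij_betw ?f (?S (CM' m i \<times> CM' m i)) (Inl ` gbasis (arcH (m - 1)))"
    by (rule iffD1[OF bij_betw_cong, rotated]) (auto simp: first_four_part_def Let_def)
  have "bij_betw (\<lambda>x. Inr (Inl x)) (?S (CM' m i \<times> CM'' m i))
      ((\<lambda>x. Inr (Inl x)) ` ?S (CM' m i \<times> CM'' m i) :: kh_gen4 set)"
    by (rule inj_on_imp_bij_betw) (simp add: inj_on_def)
  moreover have "gbasis (arcHbar m i) = ?S (CM' m i \<times> CM'' m i)"
    by (auto simp: arcHbar_def TF'_def)
  ultimately have "bij_betw (\<lambda>x. Inr (Inl x)) (?S (CM' m i \<times> CM'' m i))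
      ((\<lambda>x. Inr (Inl x)) ` gbasis (arcHbar m i) :: kh_gen4 set)" by simp
  then have 2: "bij_betw ?f (?S (CM' m i \<times> CM'' m i)) ((\<lambda>x. Inr (Inl x)) ` gbasis (arcHbar m i))"
    by (rule iffD1[OF bij_betw_cong, rotated]) (use not restrict in \<open>auto simp: first_four_part_def Let_def\<close>)
  \<comment> \<open>The second copy of \<open>arcHbar m i\<close> is reached by exchanging the
    matchings; \<open>far_circles_reflect\<close> makes the labels fit unchanged.\<close>
  have "bij_betw (\<lambda>(ab, l). (prod.swap ab, l)) (?S (CM'' m i \<times> CM' m i)) (gbasis (arcHbar m i))"
  proof -
    have "bij_betw (\<lambda>(ab, l). (prod.swap ab, l)) (?S (CM'' m i \<times> CM' m i)) (?S (CM' m i \<times> CM'' m i))"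
    proof (rule bij_betw_Sigma_map)
      show "bij_betw prod.swap (CM'' m i \<times> CM' m i) (CM' m i \<times> CM'' m i)"
        by (rule bij_betw_byWitness[where f' = prod.swap]) auto
      fix ab assume "ab \<in> CM'' m i \<times> CM' m i"
      then obtain a b where ab: "ab = (a, b)" "a \<in> CM'' m i" "b \<in> CM' m i" by blast
      interpret diagram m i a b using ab CM by (intro diagramI) auto
      show "bij_betw (\<lambda>l. l) (far_labels m i ab) (far_labels m i (prod.swap ab))"
        using bij_betw_id by (simp add: ab(1) far_circles_reflect id_def)
    qed
    moreover have "gbasis (arcHbar m i) = ?S (CM' m i \<times> CM'' m i)"
      by (auto simp: arcHbar_def TF'_def)
    ultimately show ?thesis by simp
  qed
  then have "bij_betw (\<lambda>x. Inr (Inr (Inl (case x of (ab, l) \<Rightarrow> (prod.swap ab, l)))))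
      (?S (CM'' m i \<times> CM' m i)) ((\<lambda>x. Inr (Inr (Inl x))) ` gbasis (arcHbar m i) :: kh_gen4 set)"
    by (rule bij_betw_inj_comp) (simp add: inj_def)
  then have 3: "bij_betw ?f (?S (CM'' m i \<times> CM' m i)) ((\<lambda>x. Inr (Inr (Inl x))) ` gbasis (arcHbar m i))"
    by (rule iffD1[OF bij_betw_cong, rotated]) (use not restrict in \<open>auto simp: first_four_part_def Let_def\<close>)
  have "bij_betw (\<lambda>x. Inr (Inr (Inr x))) (?S (single_circle m i))
      ((\<lambda>x. Inr (Inr (Inr x))) ` ?S (single_circle m i) :: kh_gen4 set)"
    by (rule inj_on_imp_bij_betw) (simp add: inj_on_def)
  moreover have "gbasis (arcH1 m i) = ?S (single_circle m i)"
    by (auto simp: arcH1_def TF'_def)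
  ultimately have "bij_betw (\<lambda>x. Inr (Inr (Inr x))) (?S (single_circle m i))
      ((\<lambda>x. Inr (Inr (Inr x))) ` gbasis (arcH1 m i) :: kh_gen4 set)" by simp
  then have 4: "bij_betw ?f (?S (single_circle m i)) ((\<lambda>x. Inr (Inr (Inr x))) ` gbasis (arcH1 m i))"
    by (rule iffD1[OF bij_betw_cong, rotated])
      (use not restrict in \<open>auto simp: first_four_part_def Let_def single_circle_def\<close>)
  have "bij_betw ?f (?S (CM' m i \<times> CM' m i) \<union> (?S (CM' m i \<times> CM'' m i) \<union>
      (?S (CM'' m i \<times> CM' m i) \<union> ?S (single_circle m i))))
    (Inl ` gbasis (arcH (m - 1)) \<union> ((\<lambda>x. Inr (Inl x)) ` gbasis (arcHbar m i) \<union>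
      ((\<lambda>x. Inr (Inr (Inl x))) ` gbasis (arcHbar m i) \<union> (\<lambda>x. Inr (Inr (Inr x))) ` gbasis (arcH1 m i))))"
    by (intro bij_betw_combine 1 2 3 4) auto
  moreover have "CM m \<times> CM m - two_circle_pairs m i = CM' m i \<times> CM' m i \<union> (CM' m i \<times> CM'' m i \<union>
      (CM'' m i \<times> CM' m i \<union> single_circle m i))"
    by (auto simp: two_circle_pairs_def single_circle_def CM'_def CM''_def)
  moreover have "gbasis (first_four m i) = Inl ` gbasis (arcH (m - 1)) \<union> ((\<lambda>x. Inr (Inl x)) ` gbasis (arcHbar m i) \<union>
      ((\<lambda>x. Inr (Inr (Inl x))) ` gbasis (arcHbar m i) \<union> (\<lambda>x. Inr (Inr (Inr x))) ` gbasis (arcH1 m i)))"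
    by (simp add: first_four_def Plus_def image_Un image_image)
  ultimately show ?thesis by (simp only: Sigma_Un_distrib1)
qed

text \<open>All four summands carry the shift by m - 1: three by definition, and the arc ring for m
  - 1 through its own normalization, with the degrees summed along
  \<open>far_circles_delete\<close>.\<close>

lemma first_four_part_deg:
  assumes ab: "a \<in> CM m" "b \<in> CM m" "(a, b) \<notin> two_circle_pairs m i"
  shows "gdeg (first_four m i) (first_four_part m i a b l) =
    (\<Sum>C\<in>far_circles m i a b. gdeg V (l C)) + int m - 1"
proof -
  interpret diagram m i a b using ab by (intro diagramI)
  have m: "int (m - 1) = int m - 1" using i by simp
  consider "a \<in> CM' m i" "b \<in> CM' m i" | "a \<in> CM' m i" "b \<notin> CM' m i" | "a \<notin> CM' m i" "b \<in> CM' m i"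
    | "a \<notin> CM' m i" "b \<notin> CM' m i" by blast
  then show ?thesis
  proof cases
    case 1
    then have arcs: "{i, i + 1} \<in> a" "{i, i + 1} \<in> b" by (simp_all add: CM'_def)
    have "(\<Sum>C\<in>circles (id_closure (m - 1) (delete_arc i a) (delete_arc i b)). gdeg V (l (skip2 ` C))) =
        (\<Sum>C\<in>far_circles m i a b. gdeg V (l C))"
      by (rule sum.reindex_bij_betw[OF far_circles_delete[OF arcs]])
    then show ?thesis using 1 m
      by (simp add: first_four_part_def first_four_def Let_def arcH_def Kh_flat_def flip: id_closure_def)
  qed (simp_all add: first_four_part_def first_four_def Let_def arcHbar_def arcH1_def TF'_def far_circles_reflect)
qed

text \<open>The common form of both identifications: \<open>S\<close> gives the circles of the
  closure, \<open>\<sigma>1\<close> and \<open>\<sigma>2\<close> read the labels of those through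
  the saddle, and \<open>U1\<close>, \<open>U2\<close> are the factors that hold them. The constants
  1 and 2 in \<open>deg1\<close> and \<open>deg2\<close> are the differences between the shift m of
  the whole and the shifts m - 1, m - 2 of the parts.\<close>

lemma decomposition_gr_iso:
  fixes S :: "nat set set \<times> nat set set \<Rightarrow> (nat + nat) set set"
    and \<sigma>1 :: "nat set set \<times> nat set set \<Rightarrow> label \<Rightarrow> 'u" and \<sigma>2 :: "nat set set \<times> nat set set \<Rightarrow> label \<Rightarrow> 'v"
    and U1 :: "'u graded" and U2 :: "'v graded"
  assumes split1: "\<And>a b. a \<in> CM m \<Longrightarrow> b \<in> CM m \<Longrightarrow> (a, b) \<notin> two_circle_pairs m i \<Longrightarrow>
      bij_betw (\<lambda>l. (restrict l (far_circles m i a b), \<sigma>1 (a, b) l)) (S (a, b) \<rightarrow>\<^sub>E UNIV) (far_labels m i (a, b) \<times> gbasis U1)"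
    and split2: "\<And>a b. a \<in> CM m \<Longrightarrow> b \<in> CM m \<Longrightarrow> (a, b) \<in> two_circle_pairs m i \<Longrightarrow>
      bij_betw (\<lambda>l. (restrict l (far_circles m i a b), \<sigma>2 (a, b) l)) (S (a, b) \<rightarrow>\<^sub>E UNIV) (far_labels m i (a, b) \<times> gbasis U2)"
    and deg1: "\<And>a b l. a \<in> CM m \<Longrightarrow> b \<in> CM m \<Longrightarrow> (a, b) \<notin> two_circle_pairs m i \<Longrightarrow>
      (\<Sum>C\<in>S (a, b). gdeg V (l C)) = (\<Sum>C\<in>far_circles m i a b. gdeg V (l C)) + gdeg U1 (\<sigma>1 (a, b) l) - 1"
    and deg2: "\<And>a b l. a \<in> CM m \<Longrightarrow> b \<in> CM m \<Longrightarrow> (a, b) \<in> two_circle_pairs m i \<Longrightarrow>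
      (\<Sum>C\<in>S (a, b). gdeg V (l C)) = (\<Sum>C\<in>far_circles m i a b. gdeg V (l C)) + gdeg U2 (\<sigma>2 (a, b) l) - 2"
  shows "gr_iso (gsum (CM m \<times> CM m) (\<lambda>ab. (TF (S ab))\<lbrace>int m\<rbrace>))
      ((first_four m i \<otimes>\<^sub>g U1) \<oplus>\<^sub>g (arcH2 m i \<otimes>\<^sub>g U2))
      (frag_extend (frag_of \<circ> (\<lambda>((a, b), l).
        if (a, b) \<in> two_circle_pairs m i then Inr (H2_part m i a b l, \<sigma>2 (a, b) l)
        else Inl (first_four_part m i a b l, \<sigma>1 (a, b) l))))"
    (is "gr_iso ?A ?B (frag_extend (frag_of \<circ> ?f))")
proof (rule gr_iso_basis_map)
  let ?N = "CM m \<times> CM m - two_circle_pairs m i" and ?D = "two_circle_pairs m i"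
  let ?S = "\<lambda>ab. S ab \<rightarrow>\<^sub>E (UNIV :: vgen set)"
  have D: "?D \<subseteq> CM m \<times> CM m" by (auto simp: two_circle_pairs_def CM''_def)
  have "bij_betw (\<lambda>(ab, l). ((ab, restrict l (case_prod (far_circles m i) ab)), \<sigma>1 ab l)) (Sigma ?N ?S)
      (Sigma ?N (far_labels m i) \<times> gbasis U1)"
    by (rule bij_betw_Sigma_split) (use split1 in auto)
  moreover have "bij_betw (map_prod (\<lambda>((a, b), l). first_four_part m i a b l) id)
      (Sigma ?N (far_labels m i) \<times> gbasis U1) (gbasis (first_four m i) \<times> gbasis U1)"
    by (rule bij_betw_map_prod[OF first_four_part_bij bij_betw_id])
  ultimately have "bij_betw (map_prod (\<lambda>((a, b), l). first_four_part m i a b l) id \<circ>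
      (\<lambda>(ab, l). ((ab, restrict l (case_prod (far_circles m i) ab)), \<sigma>1 ab l))) (Sigma ?N ?S)
      (gbasis (first_four m i) \<times> gbasis U1)"
    by (rule bij_betw_trans)
  from bij_betw_inj_comp[OF this inj_Inl] have N: "bij_betw ?f (Sigma ?N ?S) (Inl ` (gbasis (first_four m i) \<times> gbasis U1))"
    by (rule iffD1[OF bij_betw_cong, rotated]) (auto intro!: first_four_part_restrict)
  have "bij_betw (\<lambda>(ab, l). ((ab, restrict l (case_prod (far_circles m i) ab)), \<sigma>2 ab l)) (Sigma ?D ?S)
      (Sigma ?D (far_labels m i) \<times> gbasis U2)"
    by (rule bij_betw_Sigma_split) (use split2 D in auto)
  from bij_betw_inj_comp[OF this inj_Inr] have "bij_betw ?f (Sigma ?D ?S) (Inr ` (Sigma ?D (far_labels m i) \<times> gbasis U2))"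
    by (rule iffD1[OF bij_betw_cong, rotated]) (auto simp: H2_part_def)
  with N have "bij_betw ?f (Sigma ?N ?S \<union> Sigma ?D ?S)
      (Inl ` (gbasis (first_four m i) \<times> gbasis U1) \<union> Inr ` (gbasis (arcH2 m i) \<times> gbasis U2))"
    unfolding gbasis_arcH2 by (rule bij_betw_combine) auto
  moreover have "gbasis ?A = Sigma ?N ?S \<union> Sigma ?D ?S" using D by auto
  ultimately show "bij_betw ?f (gbasis ?A) (gbasis ?B)" by (simp add: Plus_def)
next
  fix x assume "x \<in> gbasis ?A"
  then obtain a b l where x: "x = ((a, b), l)" "a \<in> CM m" "b \<in> CM m" by auto
  show "gdeg ?B (?f x) = gdeg ?A x"
  proof (cases "(a, b) \<in> two_circle_pairs m i")
    case True
    then show ?thesis using deg2[of a b l] x by (simp add: H2_part_def arcH2_def TF'_def)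
  next
    case False
    then show ?thesis using deg1[of a b l] x by (simp add: first_four_part_deg)
  qed
qed

end

section \<open>The saddle maps and the cohomology\<close>

lemma linear_square:
  assumes "\<And>x. x \<in> gbasis A \<Longrightarrow> Poly_Mapping.keys (f x) \<subseteq> gbasis B \<and> frag_extend \<psi> (f x) = frag_extend \<delta> (\<phi> x)"
    and c: "c \<in> carrier (grp A)"
  shows "frag_extend f c \<in> carrier (grp B) \<and> frag_extend \<psi> (frag_extend f c) = frag_extend \<delta> (frag_extend \<phi> c)"
proof
  have c': "Poly_Mapping.keys c \<subseteq> gbasis A" using c by (simp only: carrier_grp)
  show "frag_extend f c \<in> carrier (grp B)"
    unfolding carrier_grp using keys_frag_extend_subset[OF c'] assms(1) by blast
  show "frag_extend \<psi> (frag_extend f c) = frag_extend \<delta> (frag_extend \<phi> c)"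
    unfolding frag_extend_frag_extend
    by (rule frag_extend_eq) (use assms(1) c' in blast)
qed

section \<open>The saddle maps on generators\<close>

definition phi_gen :: "nat \<Rightarrow> nat \<Rightarrow> kh_gen \<Rightarrow> kh_gen4 \<times> vgen + kh_gen \<times> vgen \<times> vgen" where
  "phi_gen m i = (\<lambda>((a, b), l).
    if (a, b) \<in> two_circle_pairs m i
    then Inr (H2_part m i a b l, l (circ (id_closure m a b) (Inl i)), l (circ (id_closure m a b) (Inl (i + 1))))
    else Inl (first_four_part m i a b l, l (circ (id_closure m a b) (Inl i))))"

definition psi_gen :: "nat \<Rightarrow> nat \<Rightarrow> kh_gen \<Rightarrow> kh_gen4 \<times> vgen \<times> vgen + kh_gen \<times> vgen" where
  "psi_gen m i = (\<lambda>((a, b), l).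
    if (a, b) \<in> two_circle_pairs m i
    then Inr (H2_part m i a b l, l (circ (closure_arcs a (cupcap m i) b) (Inl i)))
    else Inl (first_four_part m i a b l, l (circ (closure_arcs a (cupcap m i) b) (Inl i)),
      l (circ (closure_arcs a (cupcap m i) b) (Inr i))))"

lemma Phi_eq: "Phi m i = frag_extend (frag_of \<circ> phi_gen m i)"
  by (simp add: Phi_def phi_gen_def two_circle_pairs_def Let_def comp_def case_prod_unfold)

lemma Psi_eq: "Psi m i = frag_extend (frag_of \<circ> psi_gen m i)"
  by (simp add: Psi_def psi_gen_def two_circle_pairs_def Let_def comp_def case_prod_unfold)

lemma alpha_eq: "alpha m i = frag_extend (\<lambda>x. alpha m i (frag_of x))"
  and beta_eq: "beta m i = frag_extend (\<lambda>x. beta m i (frag_of x))"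
  by (simp_all add: alpha_def beta_def gsum_map_def)

lemma arcH_eq: "arcH m = gsum (CM m \<times> CM m) (\<lambda>ab. (TF (circles (case_prod (id_closure m) ab)))\<lbrace>int m\<rbrace>)"
  by (simp add: arcH_def Kh_flat_def id_closure_def case_prod_unfold)

lemma Kh_cupcap_eq:
  "Kh_cupcap m i = gsum (CM m \<times> CM m) (\<lambda>ab. (TF (circles (case ab of (a, b) \<Rightarrow> closure_arcs a (cupcap m i) b)))\<lbrace>int m\<rbrace>)"
  by (simp add: Kh_cupcap_def Kh_flat_def case_prod_unfold)

context diagram
begin

abbreviation "far \<equiv> far_circles m i a b"
abbreviation "cI \<equiv> circ idE (Inl i)"
abbreviation "cI' \<equiv> circ idE (Inl (i + 1))"
abbreviation "cC \<equiv> circ capE (Inl i)"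
abbreviation "cC' \<equiv> circ capE (Inr i)"

lemma near: "cI \<notin> far" "cI' \<notin> far" "cC \<notin> far" "cC' \<notin> far"
  by (rule near_not_far, simp add: four_def)+

text \<open>Both spellings are declared because simplification turns \<open>i + 1\<close> into
  \<open>Suc i\<close>.\<close>

lemmas near_simps [simp] = near near[simplified]

lemma single_pair:
  assumes "(a, b) \<notin> two_circle_pairs m i"
  shows "cI' = cI" "cC \<noteq> cC'" "circles idE = insert cI far" "circles capE = insert cC (insert cC' far)"
  using assms two_circle_pairs_iff surgery circles_idE circles_capE by auto

lemma double_pair:
  assumes "(a, b) \<in> two_circle_pairs m i"
  shows "cI \<noteq> cI'" "cC' = cC" "circles idE = insert cI (insert cI' far)" "circles capE = insert cC far"
  using assms two_circle_pairs_iff surgery circles_idE circles_capE by auto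

lemma circles_minus:
  "circles idE - {cI, cI'} = far" "circles capE - {cC, cC'} = far"
  unfolding circles_idE circles_capE by auto

text \<open>The second marked point \<open>Inr (i + 1)\<close> lies on \<open>cI'\<close> in one
  diagram and on \<open>cC'\<close> in the other. By \<open>surgery\<close> exactly one of the two
  diagrams has a single circle here, so the nonorientable alternative of \<open>TF_saddle\<close>
  never occurs.\<close>

lemma TF_saddle_id_cap:
  "TF_saddle idE capE (Inl i) (Inr (i + 1)) (frag_of l) =
    (if (a, b) \<in> two_circle_pairs m i
     then frag_extend (\<lambda>v. frag_of ((restrict l far)(cC := v))) (v_mult (frag_of (l cI, l cI')))
     else frag_extend (\<lambda>(v, w). frag_of ((restrict l far)(cC := v, cC' := w))) (v_comult (frag_of (l cI))))"
  using circles_minus single_pair double_pair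
  by (simp add: TF_saddle_def circ_idE_four(2) circ_capE_four(2) Let_def del: One_nat_def add_Suc_right)

lemma TF_saddle_cap_id:
  "TF_saddle capE idE (Inl i) (Inr (i + 1)) (frag_of l) =
    (if (a, b) \<in> two_circle_pairs m i
     then frag_extend (\<lambda>(v, w). frag_of ((restrict l far)(cI := v, cI' := w))) (v_comult (frag_of (l cC)))
     else frag_extend (\<lambda>v. frag_of ((restrict l far)(cI := v))) (v_mult (frag_of (l cC, l cC'))))"
  using circles_minus single_pair double_pair
  by (simp add: TF_saddle_def circ_idE_four(2) circ_capE_four(2) Let_def del: One_nat_def add_Suc_right)

lemma part_upd:
  assumes "\<And>C. C \<in> far \<Longrightarrow> l' C = l C"
  shows "first_four_part m i a b l' = first_four_part m i a b l" "H2_part m i a b l' = H2_part m i a b l"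
  using first_four_part_restrict[OF i a b assms] restrict_ext[of far l' l] assms
  by (simp_all add: H2_part_def)

text \<open>The saddle changes only labels of circles through the four points. These are what the V
  factors record, while the remaining component of \<open>Psi\<close> depends on the other labels
  alone; so only \<Delta> or m on the V factors is left.\<close>

lemma alpha_square:
  "Poly_Mapping.keys (alpha m i (frag_of ((a, b), l))) \<subseteq> gbasis (Kh_cupcap m i) \<and>
   Psi m i (alpha m i (frag_of ((a, b), l))) =
     plus_map (tensor_map id v_comult) (tensor_map id v_mult) (frag_of (phi_gen m i ((a, b), l)))"
proof -
  have alpha: "alpha m i (frag_of ((a, b), l)) =
      frag_extend (\<lambda>y. frag_of ((a, b), y)) (TF_saddle idE capE (Inl i) (Inr (i + 1)) (frag_of l))"
    by (simp add: alpha_def gsum_map_def id_closure_def)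
  show ?thesis
  proof (cases "(a, b) \<in> two_circle_pairs m i")
    case True
    note D = double_pair[OF True]
    \<comment> \<open>Basis labellings are undefined off the circles of their diagram, so the result
      must be defined exactly on \<open>circles capE\<close>.\<close>
    have upd: "(restrict l far)(cC := v) \<in> circles capE \<rightarrow>\<^sub>E UNIV" for v
      unfolding D by (auto simp: PiE_def extensional_def)
    have psi: "psi_gen m i ((a, b), (restrict l far)(cC := v)) = Inr (H2_part m i a b l, v)" for v
    proof -
      have "H2_part m i a b ((restrict l far)(cC := v)) = H2_part m i a b l"
        by (rule part_upd) auto
      then show ?thesis using True by (simp add: psi_gen_def del: restrict_upd One_nat_def)
    qed
    have alpha': "alpha m i (frag_of ((a, b), l)) =
        frag_extend (\<lambda>v. frag_of ((a, b), (restrict l far)(cC := v))) (v_mult (frag_of (l cI, l cI')))"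
      unfolding alpha TF_saddle_id_cap using True by (simp add: frag_extend_frag_extend)
    have "Poly_Mapping.keys (alpha m i (frag_of ((a, b), l))) \<subseteq> gbasis (Kh_cupcap m i)"
      unfolding alpha' by (rule keys_frag_extend_subset[OF subset_UNIV]) (use upd a b in \<open>simp add: Kh_cupcap_eq\<close>)
    moreover have "Psi m i (alpha m i (frag_of ((a, b), l))) =
        frag_extend (\<lambda>v. frag_of (Inr (H2_part m i a b l, v))) (v_mult (frag_of (l cI, l cI')))"
      unfolding alpha' Psi_eq by (simp add: frag_extend_frag_extend psi del: restrict_upd One_nat_def)
    ultimately show ?thesis
      using True by (simp add: phi_gen_def plus_map_frag_of tensor_map_id_frag_of frag_extend_frag_extend)
  next
    case False
    note S = single_pair[OF False]
    have upd: "(restrict l far)(cC := v, cC' := w) \<in> circles capE \<rightarrow>\<^sub>E UNIV" for v w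
      unfolding S by (auto simp: PiE_def extensional_def)
    \<comment> \<open>The inequality of \<open>cC\<close> and \<open>cC'\<close> keeps the second
      update from overwriting the first.\<close>
    have psi: "psi_gen m i ((a, b), (restrict l far)(cC := v, cC' := w)) = Inl (first_four_part m i a b l, v, w)" for v w
    proof -
      have "first_four_part m i a b ((restrict l far)(cC := v, cC' := w)) = first_four_part m i a b l"
        by (rule part_upd) auto
      then show ?thesis using False S by (simp add: psi_gen_def del: restrict_upd One_nat_def)
    qed
    have alpha': "alpha m i (frag_of ((a, b), l)) =
        frag_extend (\<lambda>(v, w). frag_of ((a, b), (restrict l far)(cC := v, cC' := w))) (v_comult (frag_of (l cI)))"
      unfolding alpha TF_saddle_id_cap using False by (simp add: frag_extend_frag_extend case_prod_unfold)
    have "Poly_Mapping.keys (alpha m i (frag_of ((a, b), l))) \<subseteq> gbasis (Kh_cupcap m i)"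
      unfolding alpha' by (rule keys_frag_extend_subset[OF subset_UNIV])
        (use upd a b in \<open>simp add: Kh_cupcap_eq split: prod.split\<close>)
    moreover have "Psi m i (alpha m i (frag_of ((a, b), l))) =
        frag_extend (\<lambda>vw. frag_of (Inl (first_four_part m i a b l, vw))) (v_comult (frag_of (l cI)))"
      unfolding alpha' Psi_eq by (simp add: frag_extend_frag_extend psi case_prod_unfold del: restrict_upd One_nat_def)
    ultimately show ?thesis
      using False by (simp add: phi_gen_def plus_map_frag_of tensor_map_id_frag_of frag_extend_frag_extend)
  qed
qed

text \<open>The reverse saddle acts on the same circles, so \<Delta> and m trade places between the
  two kinds of pairs.\<close>

lemma beta_square:
  "Poly_Mapping.keys (beta m i (frag_of ((a, b), l))) \<subseteq> gbasis (arcH m) \<and>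
   Phi m i (beta m i (frag_of ((a, b), l))) =
     plus_map (tensor_map id v_mult) (tensor_map id v_comult) (frag_of (psi_gen m i ((a, b), l)))"
proof -
  have beta: "beta m i (frag_of ((a, b), l)) =
      frag_extend (\<lambda>y. frag_of ((a, b), y)) (TF_saddle capE idE (Inl i) (Inr (i + 1)) (frag_of l))"
    by (simp add: beta_def gsum_map_def id_closure_def)
  show ?thesis
  proof (cases "(a, b) \<in> two_circle_pairs m i")
    case True
    note D = double_pair[OF True]
    have upd: "(restrict l far)(cI := v, cI' := w) \<in> circles idE \<rightarrow>\<^sub>E UNIV" for v w
      unfolding D by (auto simp: PiE_def extensional_def)
    have phi: "phi_gen m i ((a, b), (restrict l far)(cI := v, cI' := w)) = Inr (H2_part m i a b l, v, w)" for v w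
    proof -
      have "H2_part m i a b ((restrict l far)(cI := v, cI' := w)) = H2_part m i a b l"
        by (rule part_upd) auto
      then show ?thesis using True D by (simp add: phi_gen_def del: restrict_upd One_nat_def)
    qed
    have beta': "beta m i (frag_of ((a, b), l)) =
        frag_extend (\<lambda>(v, w). frag_of ((a, b), (restrict l far)(cI := v, cI' := w))) (v_comult (frag_of (l cC)))"
      unfolding beta TF_saddle_cap_id using True by (simp add: frag_extend_frag_extend case_prod_unfold)
    have "Poly_Mapping.keys (beta m i (frag_of ((a, b), l))) \<subseteq> gbasis (arcH m)"
      unfolding beta' by (rule keys_frag_extend_subset[OF subset_UNIV])
        (use upd a b in \<open>simp add: arcH_eq split: prod.split\<close>)
    moreover have "Phi m i (beta m i (frag_of ((a, b), l))) =
        frag_extend (\<lambda>vw. frag_of (Inr (H2_part m i a b l, vw))) (v_comult (frag_of (l cC)))"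
      unfolding beta' Phi_eq by (simp add: frag_extend_frag_extend phi case_prod_unfold del: restrict_upd One_nat_def)
    ultimately show ?thesis
      using True by (simp add: psi_gen_def plus_map_frag_of tensor_map_id_frag_of frag_extend_frag_extend)
  next
    case False
    note S = single_pair[OF False]
    have upd: "(restrict l far)(cI := v) \<in> circles idE \<rightarrow>\<^sub>E UNIV" for v
      unfolding S by (auto simp: PiE_def extensional_def)
    have phi: "phi_gen m i ((a, b), (restrict l far)(cI := v)) = Inl (first_four_part m i a b l, v)" for v
    proof -
      have "first_four_part m i a b ((restrict l far)(cI := v)) = first_four_part m i a b l"
        by (rule part_upd) auto
      then show ?thesis using False by (simp add: phi_gen_def del: restrict_upd One_nat_def)
    qed
    have beta': "beta m i (frag_of ((a, b), l)) =
        frag_extend (\<lambda>v. frag_of ((a, b), (restrict l far)(cI := v))) (v_mult (frag_of (l cC, l cC')))"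
      unfolding beta TF_saddle_cap_id using False by (simp add: frag_extend_frag_extend)
    have "Poly_Mapping.keys (beta m i (frag_of ((a, b), l))) \<subseteq> gbasis (arcH m)"
      unfolding beta' by (rule keys_frag_extend_subset[OF subset_UNIV]) (use upd a b in \<open>simp add: arcH_eq\<close>)
    moreover have "Phi m i (beta m i (frag_of ((a, b), l))) =
        frag_extend (\<lambda>v. frag_of (Inl (first_four_part m i a b l, v))) (v_mult (frag_of (l cC, l cC')))"
      unfolding beta' Phi_eq by (simp add: frag_extend_frag_extend phi del: restrict_upd One_nat_def)
    ultimately show ?thesis
      using False by (simp add: psi_gen_def plus_map_frag_of tensor_map_id_frag_of frag_extend_frag_extend)
  qed
qed

end

section \<open>Summation over all pairs and the cohomology of the crossings\<close>

context
  fixes m i :: nat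
  assumes i: "1 \<le> i" "i + 1 \<le> 2 * m"
begin

lemma Phi_gr_iso:
  "gr_iso (arcH m) ((first_four m i \<otimes>\<^sub>g V\<lbrace>1\<rbrace>) \<oplus>\<^sub>g (arcH2 m i \<otimes>\<^sub>g V\<lbrace>1\<rbrace> \<otimes>\<^sub>g V\<lbrace>1\<rbrace>)) (Phi m i)"
proof -
  let ?\<sigma>1 = "\<lambda>(a, b) (l :: label). l (circ (id_closure m a b) (Inl i))"
  let ?\<sigma>2 = "\<lambda>(a, b) (l :: label). (l (circ (id_closure m a b) (Inl i)), l (circ (id_closure m a b) (Inl (i + 1))))"
  have "gr_iso (arcH m) ((first_four m i \<otimes>\<^sub>g V\<lbrace>1\<rbrace>) \<oplus>\<^sub>g (arcH2 m i \<otimes>\<^sub>g V\<lbrace>1\<rbrace> \<otimes>\<^sub>g V\<lbrace>1\<rbrace>))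
      (frag_extend (frag_of \<circ> (\<lambda>((a, b), l).
        if (a, b) \<in> two_circle_pairs m i then Inr (H2_part m i a b l, ?\<sigma>2 (a, b) l)
        else Inl (first_four_part m i a b l, ?\<sigma>1 (a, b) l))))"
    unfolding arcH_eq
  proof (rule decomposition_gr_iso[OF i])
    fix a b assume "a \<in> CM m" "b \<in> CM m"
    then interpret diagram m i a b by (rule diagramI[OF i])
    {
      assume "(a, b) \<notin> two_circle_pairs m i"
      note S = single_pair[OF this]
      show "bij_betw (\<lambda>l. (restrict l far, ?\<sigma>1 (a, b) l)) (circles (case_prod (id_closure m) (a, b)) \<rightarrow>\<^sub>E UNIV)
          (far_labels m i (a, b) \<times> gbasis V\<lbrace>1\<rbrace>)"
        using bij_betw_PiE_insert[of cI far] by (simp add: S)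
      show "(\<Sum>C\<in>circles (case_prod (id_closure m) (a, b)). gdeg V (l C)) =
          (\<Sum>C\<in>far. gdeg V (l C)) + gdeg V\<lbrace>1\<rbrace> (?\<sigma>1 (a, b) l) - 1" for l
        by (simp add: S finite_far)
    next
      assume "(a, b) \<in> two_circle_pairs m i"
      note D = double_pair[OF this]
      show "bij_betw (\<lambda>l. (restrict l far, ?\<sigma>2 (a, b) l)) (circles (case_prod (id_closure m) (a, b)) \<rightarrow>\<^sub>E UNIV)
          (far_labels m i (a, b) \<times> gbasis (V\<lbrace>1\<rbrace> \<otimes>\<^sub>g V\<lbrace>1\<rbrace>))"
        using bij_betw_PiE_insert2[of cI far cI'] D(1) by (simp add: D)
      show "(\<Sum>C\<in>circles (case_prod (id_closure m) (a, b)). gdeg V (l C)) =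
          (\<Sum>C\<in>far. gdeg V (l C)) + gdeg (V\<lbrace>1\<rbrace> \<otimes>\<^sub>g V\<lbrace>1\<rbrace>) (?\<sigma>2 (a, b) l) - 2" for l
        using D(1) by (simp add: D finite_far)
    }
  qed
  then show ?thesis by (simp only: Phi_eq phi_gen_def prod.case)
qed

text \<open>The part away from the saddle is the same as for \<open>Phi\<close>, so the V factors
  must again carry a total shift of 1 or 2. Where one circle has become two, the shift 1 stays on
  the first factor; where two have become one, the single factor takes both.\<close>

lemma Psi_gr_iso:
  "gr_iso (Kh_cupcap m i) ((first_four m i \<otimes>\<^sub>g V\<lbrace>1\<rbrace> \<otimes>\<^sub>g V) \<oplus>\<^sub>g (arcH2 m i \<otimes>\<^sub>g V\<lbrace>2\<rbrace>)) (Psi m i)"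
proof -
  let ?\<sigma>1 = "\<lambda>(a, b) (l :: label). (l (circ (closure_arcs a (cupcap m i) b) (Inl i)), l (circ (closure_arcs a (cupcap m i) b) (Inr i)))"
  let ?\<sigma>2 = "\<lambda>(a, b) (l :: label). l (circ (closure_arcs a (cupcap m i) b) (Inl i))"
  have "gr_iso (Kh_cupcap m i) ((first_four m i \<otimes>\<^sub>g V\<lbrace>1\<rbrace> \<otimes>\<^sub>g V) \<oplus>\<^sub>g (arcH2 m i \<otimes>\<^sub>g V\<lbrace>2\<rbrace>))
      (frag_extend (frag_of \<circ> (\<lambda>((a, b), l).
        if (a, b) \<in> two_circle_pairs m i then Inr (H2_part m i a b l, ?\<sigma>2 (a, b) l)
        else Inl (first_four_part m i a b l, ?\<sigma>1 (a, b) l))))"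
    unfolding Kh_cupcap_eq
  proof (rule decomposition_gr_iso[OF i])
    fix a b assume "a \<in> CM m" "b \<in> CM m"
    then interpret diagram m i a b by (rule diagramI[OF i])
    {
      assume "(a, b) \<notin> two_circle_pairs m i"
      note S = single_pair[OF this]
      show "bij_betw (\<lambda>l. (restrict l far, ?\<sigma>1 (a, b) l)) (circles (case (a, b) of (a, b) \<Rightarrow> closure_arcs a (cupcap m i) b) \<rightarrow>\<^sub>E UNIV)
          (far_labels m i (a, b) \<times> gbasis (V\<lbrace>1\<rbrace> \<otimes>\<^sub>g V))"
        using bij_betw_PiE_insert2[of cC far cC'] S(2) by (simp add: S)
      show "(\<Sum>C\<in>circles (case (a, b) of (a, b) \<Rightarrow> closure_arcs a (cupcap m i) b). gdeg V (l C)) =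
          (\<Sum>C\<in>far. gdeg V (l C)) + gdeg (V\<lbrace>1\<rbrace> \<otimes>\<^sub>g V) (?\<sigma>1 (a, b) l) - 1" for l
        using S(2) by (simp add: S finite_far)
    next
      assume "(a, b) \<in> two_circle_pairs m i"
      note D = double_pair[OF this]
      show "bij_betw (\<lambda>l. (restrict l far, ?\<sigma>2 (a, b) l)) (circles (case (a, b) of (a, b) \<Rightarrow> closure_arcs a (cupcap m i) b) \<rightarrow>\<^sub>E UNIV)
          (far_labels m i (a, b) \<times> gbasis V\<lbrace>2\<rbrace>)"
        using bij_betw_PiE_insert[of cC far] by (simp add: D)
      show "(\<Sum>C\<in>circles (case (a, b) of (a, b) \<Rightarrow> closure_arcs a (cupcap m i) b). gdeg V (l C)) =
          (\<Sum>C\<in>far. gdeg V (l C)) + gdeg V\<lbrace>2\<rbrace> (?\<sigma>2 (a, b) l) - 2" for l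
        by (simp add: D finite_far)
    }
  qed
  then show ?thesis by (simp only: Psi_eq psi_gen_def prod.case)
qed

lemma alpha_commutes:
  assumes "x \<in> carrier (grp (arcH m))"
  shows "alpha m i x \<in> carrier (grp (Kh_cupcap m i)) \<and>
    Psi m i (alpha m i x) = plus_map (tensor_map id v_comult) (tensor_map id v_mult) (Phi m i x)"
proof -
  have "frag_extend (\<lambda>x. alpha m i (frag_of x)) x \<in> carrier (grp (Kh_cupcap m i)) \<and>
    frag_extend (frag_of \<circ> psi_gen m i) (frag_extend (\<lambda>x. alpha m i (frag_of x)) x) =
    frag_extend (\<lambda>x. plus_map (tensor_map id v_comult) (tensor_map id v_mult) (frag_of x))
      (frag_extend (frag_of \<circ> phi_gen m i) x)"
  proof (rule linear_square[OF _ assms])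
    fix g assume "g \<in> gbasis (arcH m)"
    then obtain a b l where g: "g = ((a, b), l)" "a \<in> CM m" "b \<in> CM m" by (auto simp: arcH_eq)
    interpret diagram m i a b using g by (intro diagramI[OF i])
    show "Poly_Mapping.keys (alpha m i (frag_of g)) \<subseteq> gbasis (Kh_cupcap m i) \<and>
        frag_extend (frag_of \<circ> psi_gen m i) (alpha m i (frag_of g)) =
        frag_extend (\<lambda>x. plus_map (tensor_map id v_comult) (tensor_map id v_mult) (frag_of x)) ((frag_of \<circ> phi_gen m i) g)"
      using alpha_square[of l] by (simp add: g Psi_eq)
  qed
  then show ?thesis by (simp only: Psi_eq Phi_eq flip: alpha_eq plus_map_eq_frag_extend)
qed

lemma beta_commutes:
  assumes "x \<in> carrier (grp (Kh_cupcap m i))"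
  shows "beta m i x \<in> carrier (grp (arcH m)) \<and>
    Phi m i (beta m i x) = plus_map (tensor_map id v_mult) (tensor_map id v_comult) (Psi m i x)"
proof -
  have "frag_extend (\<lambda>x. beta m i (frag_of x)) x \<in> carrier (grp (arcH m)) \<and>
    frag_extend (frag_of \<circ> phi_gen m i) (frag_extend (\<lambda>x. beta m i (frag_of x)) x) =
    frag_extend (\<lambda>x. plus_map (tensor_map id v_mult) (tensor_map id v_comult) (frag_of x))
      (frag_extend (frag_of \<circ> psi_gen m i) x)"
  proof (rule linear_square[OF _ assms])
    fix g assume "g \<in> gbasis (Kh_cupcap m i)"
    then obtain a b l where g: "g = ((a, b), l)" "a \<in> CM m" "b \<in> CM m" by (auto simp: Kh_cupcap_eq)
    interpret diagram m i a b using g by (intro diagramI[OF i])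
    show "Poly_Mapping.keys (beta m i (frag_of g)) \<subseteq> gbasis (arcH m) \<and>
        frag_extend (frag_of \<circ> phi_gen m i) (beta m i (frag_of g)) =
        frag_extend (\<lambda>x. plus_map (tensor_map id v_mult) (tensor_map id v_comult) (frag_of x)) ((frag_of \<circ> psi_gen m i) g)"
      using beta_square[of l] by (simp add: g Phi_eq)
  qed
  then show ?thesis by (simp only: Psi_eq Phi_eq flip: beta_eq plus_map_eq_frag_extend)
qed

lemma total_cohomology_sigma_plus:
  "total_cohomology (Kh_sigma_plus m i) d \<cong> piece ((first_four m i \<otimes>\<^sub>g V\<lbrace>- 1\<rbrace>) \<oplus>\<^sub>g (arcH2 m i \<otimes>\<^sub>g V\<lbrace>2\<rbrace>)) d"
proof -
  have "total_cohomology (Kh_sigma_plus m i) d \<cong>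
      piece ((first_four m i \<otimes>\<^sub>g V\<lbrace>- 1 + 0\<rbrace>) \<oplus>\<^sub>g (arcH2 m i \<otimes>\<^sub>g V\<lbrace>- 1 + 0 + 3\<rbrace>)) d"
  \<comment> \<open>Here \<open>k = 0\<close> and \<open>c = - 1\<close>: the target carries one
    shift from \<open>C_plus\<close> and one from the normalization of the crossing.\<close>
  proof (rule total_cohomology_comult_mult)
    show "gr_iso (arcH m)\<lbrace>- 1\<rbrace>
        ((first_four m i \<otimes>\<^sub>g V\<lbrace>1\<rbrace>) \<oplus>\<^sub>g (arcH2 m i \<otimes>\<^sub>g V\<lbrace>1\<rbrace> \<otimes>\<^sub>g V\<lbrace>1\<rbrace>))\<lbrace>- 1\<rbrace> (frag_extend (frag_of \<circ> phi_gen m i))"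
      using gr_iso_shift[OF Phi_gr_iso] by (simp only: Phi_eq)
    show "gr_iso (Kh_cupcap m i)\<lbrace>- 1 - 1\<rbrace>
        ((first_four m i \<otimes>\<^sub>g V\<lbrace>1\<rbrace> \<otimes>\<^sub>g V) \<oplus>\<^sub>g (arcH2 m i \<otimes>\<^sub>g V\<lbrace>2\<rbrace>))\<lbrace>- 1 - 1\<rbrace> (frag_extend (frag_of \<circ> psi_gen m i))"
      using gr_iso_shift[OF Psi_gr_iso] by (simp only: Psi_eq)
    show "cdiff (Kh_sigma_plus m i) 0 = frag_extend (\<lambda>x. alpha m i (frag_of x))"
      unfolding alpha_eq[symmetric] by (simp add: Kh_sigma_plus_def C_plus_def two_term_def int_shift_def)
    show "frag_extend (\<lambda>x. alpha m i (frag_of x)) x \<in> carrier (grp (Kh_cupcap m i)\<lbrace>- 1 - 1\<rbrace>) \<and>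
        frag_extend (frag_of \<circ> psi_gen m i) (frag_extend (\<lambda>x. alpha m i (frag_of x)) x) =
        plus_map (tensor_map id v_comult) (tensor_map id v_mult) (frag_extend (frag_of \<circ> phi_gen m i) x)"
      if "x \<in> carrier (grp (arcH m)\<lbrace>- 1\<rbrace>)" for x
      using alpha_commutes[of x] that by (simp only: grp_gshift Psi_eq Phi_eq flip: alpha_eq)
  qed (simp_all add: Kh_sigma_plus_def C_plus_def two_term_def int_shift_def gzero_def)
  then show ?thesis by simp
qed

lemma total_cohomology_sigma_minus:
  "total_cohomology (Kh_sigma_minus m i) d \<cong> piece ((first_four m i \<otimes>\<^sub>g V\<lbrace>3\<rbrace>) \<oplus>\<^sub>g (arcH2 m i \<otimes>\<^sub>g V\<lbrace>2\<rbrace>)) d"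
proof -
  have "total_cohomology (Kh_sigma_minus m i) d \<cong>
      piece ((first_four m i \<otimes>\<^sub>g V\<lbrace>2 + - 1 + 2\<rbrace>) \<oplus>\<^sub>g (arcH2 m i \<otimes>\<^sub>g V\<lbrace>2 + - 1 + 1\<rbrace>)) d"
  \<comment> \<open>Here \<open>k = - 1\<close> and \<open>c = 2\<close>: the homological shift
    moves the two terms to degrees -1 and 0, and the total degree of the kernel drops by 1
    accordingly.\<close>
  proof (rule total_cohomology_mult_comult)
    show "gr_iso (Kh_cupcap m i)\<lbrace>2\<rbrace>
        ((first_four m i \<otimes>\<^sub>g V\<lbrace>1\<rbrace> \<otimes>\<^sub>g V) \<oplus>\<^sub>g (arcH2 m i \<otimes>\<^sub>g V\<lbrace>2\<rbrace>))\<lbrace>2\<rbrace> (frag_extend (frag_of \<circ> psi_gen m i))"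
      using gr_iso_shift[OF Psi_gr_iso] by (simp only: Psi_eq)
    show "gr_iso (arcH m)\<lbrace>2 - 1\<rbrace>
        ((first_four m i \<otimes>\<^sub>g V\<lbrace>1\<rbrace>) \<oplus>\<^sub>g (arcH2 m i \<otimes>\<^sub>g V\<lbrace>1\<rbrace> \<otimes>\<^sub>g V\<lbrace>1\<rbrace>))\<lbrace>2 - 1\<rbrace> (frag_extend (frag_of \<circ> phi_gen m i))"
      using gr_iso_shift[OF Phi_gr_iso] by (simp only: Phi_eq)
    show "cdiff (Kh_sigma_minus m i) (- 1) = frag_extend (\<lambda>x. beta m i (frag_of x))"
      unfolding beta_eq[symmetric]
      by (simp add: Kh_sigma_minus_def C_minus_def two_term_def int_shift_def hom_shift_def)
    show "frag_extend (\<lambda>x. beta m i (frag_of x)) x \<in> carrier (grp (arcH m)\<lbrace>2 - 1\<rbrace>) \<and>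
        frag_extend (frag_of \<circ> phi_gen m i) (frag_extend (\<lambda>x. beta m i (frag_of x)) x) =
        plus_map (tensor_map id v_mult) (tensor_map id v_comult) (frag_extend (frag_of \<circ> psi_gen m i) x)"
      if "x \<in> carrier (grp (Kh_cupcap m i)\<lbrace>2\<rbrace>)" for x
      using beta_commutes[of x] that by (simp only: grp_gshift Psi_eq Phi_eq flip: beta_eq)
  qed (simp_all add: Kh_sigma_minus_def C_minus_def two_term_def int_shift_def hom_shift_def gzero_def)
  then show ?thesis by simp
qed

end

theorem proposition2p9:
  fixes m i :: nat
  assumes "1 \<le> m" and "1 \<le> i" and "i \<le> 2 * m - 1"
  shows
    "gr_iso (arcH m)
       (((arcH (m - 1) \<oplus>\<^sub>g arcHbar m i \<oplus>\<^sub>g arcHbar m i \<oplus>\<^sub>g arcH1 m i)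
           \<otimes>\<^sub>g V\<lbrace>1\<rbrace>)
        \<oplus>\<^sub>g (arcH2 m i \<otimes>\<^sub>g V\<lbrace>1\<rbrace> \<otimes>\<^sub>g V\<lbrace>1\<rbrace>))
       (Phi m i) \<and>
     gr_iso (Kh_cupcap m i)
       (((arcH (m - 1) \<oplus>\<^sub>g arcHbar m i \<oplus>\<^sub>g arcHbar m i \<oplus>\<^sub>g arcH1 m i)
           \<otimes>\<^sub>g V\<lbrace>1\<rbrace> \<otimes>\<^sub>g V)
        \<oplus>\<^sub>g (arcH2 m i \<otimes>\<^sub>g V\<lbrace>2\<rbrace>))
       (Psi m i) \<and>
     (\<forall>x \<in> carrier (grp (arcH m)).
        alpha m i x \<in> carrier (grp (Kh_cupcap m i)) \<and>
        Psi m i (alpha m i x) =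
          plus_map (tensor_map id v_comult) (tensor_map id v_mult) (Phi m i x)) \<and>
     (\<forall>y \<in> carrier (grp (Kh_cupcap m i)).
        beta m i y \<in> carrier (grp (arcH m)) \<and>
        Phi m i (beta m i y) =
          plus_map (tensor_map id v_mult) (tensor_map id v_comult) (Psi m i y)) \<and>
     (\<forall>d. total_cohomology (Kh_sigma_plus m i) d \<cong>
        piece
          (((arcH (m - 1) \<oplus>\<^sub>g arcHbar m i \<oplus>\<^sub>g arcHbar m i \<oplus>\<^sub>g arcH1 m i)
              \<otimes>\<^sub>g V\<lbrace>- 1\<rbrace>)
           \<oplus>\<^sub>g (arcH2 m i \<otimes>\<^sub>g V\<lbrace>2\<rbrace>)) d) \<and>
     (\<forall>d. total_cohomology (Kh_sigma_minus m i) d \<cong>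
        piece
          (((arcH (m - 1) \<oplus>\<^sub>g arcHbar m i \<oplus>\<^sub>g arcHbar m i \<oplus>\<^sub>g arcH1 m i)
              \<otimes>\<^sub>g V\<lbrace>3\<rbrace>)
           \<oplus>\<^sub>g (arcH2 m i \<otimes>\<^sub>g V\<lbrace>2\<rbrace>)) d)"
proof -
  have i: "1 \<le> i" "i + 1 \<le> 2 * m" using assms by auto
  show ?thesis
    unfolding first_four_def[symmetric]
    by (intro conjI ballI allI Phi_gr_iso[OF i] Psi_gr_iso[OF i] alpha_commutes[OF i] beta_commutes[OF i]
        total_cohomology_sigma_plus[OF i] total_cohomology_sigma_minus[OF i])
qed

end
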